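(* There exist a stochastic process $X=(X_i)_{i\in\mathbb Z}$ that is a $1$-dependent $4$-coloring of $\mathbb Z$, and an i.i.d. process $Y=(Y_i)_{i\in\mathbb Z}$, such that $X$ is a finitary factor of $Y$, and the coding radius $T$ of this finitary factor satisfies $$\mathbb P(T>t) < c\,t^{-\alpha},\qquad t\geq 1,$$ for some absolute constants $c,\alpha>0$.
   Context: A process $X=(X_i)_{i\in\mathbb Z}$ is a (proper) $q$-coloring if each $X_i$ takes values in $[q]:=\{1,\ldots,q\}$ and almost surely $X_i\neq X_{i+1}$ for all $i\in\mathbb Z$. A process $X$ is $k$-dependent if the random vectors $(X_i)_{i\in A}$ and $(X_i)_{i\in B}$ are independent of each other whenever $A,B\subseteq\mathbb Z$ satisfy $|a-b|>k$ for all $a\in A$, $b\in B$. An i.i.d. process is a family $Y=(Y_i)_{i\in\mathbb Z}$ of independent identically distributed random variables (taking values in some measurable space). A process $X$ is a factor of a process $Y$ if it is equal in law to $F(Y)$, where $F$ is a (measurable) translation-equivariant function, i.e. $F$ commutes with the action of translations of $\mathbb Z$. The factor is finitary if for almost every $y$ (with respect to the law of $Y$) there exists $t<\infty$ such that whenever $y'$ agrees with $y$ on the interval $\{-t,\ldots,t\}$, we have $F(y')_0=F(y)_0$. In that case $T(y)$ denotes the minimum such $t$, and the random variable $T=T(Y)$ is called the coding radius of the factor. *)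

theory Defs
  imports "HOL-Probability.Probability"
begin

text \<open>Processes indexed by the integers, on a probability space \<open>M\<close>, with values in the
  measurable space underlying \<open>N\<close> (any measure carried by \<open>N\<close> is ignored).\<close>

definition process :: "'w measure \<Rightarrow> 'a measure \<Rightarrow> (int \<Rightarrow> 'w \<Rightarrow> 'a) \<Rightarrow> bool" where
  "process M N X \<longleftrightarrow> prob_space M \<and> (\<forall>i. X i \<in> measurable M N)"

abbreviation seq_space :: "'a measure \<Rightarrow> (int \<Rightarrow> 'a) measure" where
  "seq_space N \<equiv> PiM UNIV (\<lambda>_. N)"

definition law :: "'w measure \<Rightarrow> 'a measure \<Rightarrow> (int \<Rightarrow> 'w \<Rightarrow> 'a) \<Rightarrow> (int \<Rightarrow> 'a) measure" where
  "law M N X = distr M (seq_space N) (\<lambda>\<omega> i. X i \<omega>)"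

definition colors :: "nat \<Rightarrow> nat measure" where
  "colors q = count_space {1..q}"

definition coloring :: "nat \<Rightarrow> 'w measure \<Rightarrow> (int \<Rightarrow> 'w \<Rightarrow> nat) \<Rightarrow> bool" where
  "coloring q M X \<longleftrightarrow> process M (colors q) X \<and> (AE \<omega> in M. \<forall>i. X i \<omega> \<noteq> X (i + 1) \<omega>)"

definition k_dependent ::
  "nat \<Rightarrow> 'w measure \<Rightarrow> 'a measure \<Rightarrow> (int \<Rightarrow> 'w \<Rightarrow> 'a) \<Rightarrow> bool" where
  "k_dependent k M N X \<longleftrightarrow> process M N X \<and>
    (\<forall>A B. (\<forall>a\<in>A. \<forall>b\<in>B. \<bar>a - b\<bar> > int k) \<longrightarrow>
      prob_space.indep_var M
        (PiM A (\<lambda>_. N)) (\<lambda>\<omega>. \<lambda>i\<in>A. X i \<omega>)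
        (PiM B (\<lambda>_. N)) (\<lambda>\<omega>. \<lambda>i\<in>B. X i \<omega>))"

definition iid_process :: "'w measure \<Rightarrow> 'a measure \<Rightarrow> (int \<Rightarrow> 'w \<Rightarrow> 'a) \<Rightarrow> bool" where
  "iid_process M N Y \<longleftrightarrow> process M N Y \<and>
    prob_space.indep_vars M (\<lambda>_. N) Y UNIV \<and>
    (\<forall>i j. distr M N (Y i) = distr M N (Y j))"

definition shift :: "int \<Rightarrow> (int \<Rightarrow> 'a) \<Rightarrow> int \<Rightarrow> 'a" where
  "shift n y = (\<lambda>i. y (i + n))"

definition equivariant :: "'a measure \<Rightarrow> ((int \<Rightarrow> 'a) \<Rightarrow> int \<Rightarrow> 'b) \<Rightarrow> bool" where
  "equivariant N F \<longleftrightarrow> (\<forall>y\<in>space (seq_space N). \<forall>n. F (shift n y) = shift n (F y))"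

definition factor_via ::
  "((int \<Rightarrow> 'a) \<Rightarrow> int \<Rightarrow> 'b) \<Rightarrow> 'v measure \<Rightarrow> 'b measure \<Rightarrow> (int \<Rightarrow> 'v \<Rightarrow> 'b) \<Rightarrow>
   'w measure \<Rightarrow> 'a measure \<Rightarrow> (int \<Rightarrow> 'w \<Rightarrow> 'a) \<Rightarrow> bool" where
  "factor_via F M' N' X M N Y \<longleftrightarrow>
    F \<in> measurable (seq_space N) (seq_space N') \<and> equivariant N F \<and>
    law M' N' X = law M N' (\<lambda>i \<omega>. F (\<lambda>j. Y j \<omega>) i)"

definition determined_within ::
  "'a measure \<Rightarrow> ((int \<Rightarrow> 'a) \<Rightarrow> int \<Rightarrow> 'b) \<Rightarrow> (int \<Rightarrow> 'a) \<Rightarrow> nat \<Rightarrow> bool" where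
  "determined_within N F y t \<longleftrightarrow>
    (\<forall>y'\<in>space (seq_space N). (\<forall>i\<in>{- int t..int t}. y' i = y i) \<longrightarrow> F y' 0 = F y 0)"

definition finitary ::
  "((int \<Rightarrow> 'a) \<Rightarrow> int \<Rightarrow> 'b) \<Rightarrow> 'w measure \<Rightarrow> 'a measure \<Rightarrow> (int \<Rightarrow> 'w \<Rightarrow> 'a) \<Rightarrow> bool" where
  "finitary F M N Y \<longleftrightarrow> (AE y in law M N Y. \<exists>t. determined_within N F y t)"

text \<open>The infimum of the empty set is \<open>\<infinity>\<close>, so the radius is infinite where no \<open>t\<close> works.\<close>

definition coding_radius ::
  "'a measure \<Rightarrow> ((int \<Rightarrow> 'a) \<Rightarrow> int \<Rightarrow> 'b) \<Rightarrow> (int \<Rightarrow> 'a) \<Rightarrow> enat" where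
  "coding_radius N F y = Inf (enat ` {t. determined_within N F y t})"

end

theory Submission
  imports Defs "HOL-Real_Asymp.Real_Asymp"
begin

text \<open>
  Every site carries a uniform arrival time and a fair coin. Imagine the sites arriving in the order
  of their times: a new site lands between its nearest earlier neighbors on the left and on the right,
  whose colors are already different, and its coin selects one of the two remaining colors. The coloring
  is the result of this process when it is run from time \<open>0\<close>, where no first arrival exists.

  Inside a finite interval \<open>(l, r)\<close> with given colors \<open>a \<noteq> b\<close> at its ends, assumed to be older than
  everything inside, the process is well defined (\<open>col\<close>). If all interior points of \<open>(l, r)\<close> are younger
  than both ends, then whatever happens outside influences the interior only through the colors of the ends
  (\<open>col_frame\<close>). So once the color produced at a site is the same for all pairs of end colors of some
  such interval around it, that color is known from finitely many marks; this is the finitary factor.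

  The law. The word produced in a finite interval has probabilities \<open>word_prob\<close> (\<open>emeasure_word\<close>):
  splitting at the earliest arrival gives a recursion, and this recursion is equivalent to a second one in which
  the latest arrival is removed (\<open>word_prob_remove\<close>). Summing the second recursion over all words with a given
  subword \<open>x\<close> in the window of positions starting at \<open>j\<close> and ending \<open>k\<close> sites before the right end gives a linear recursion
  in \<open>j\<close>, \<open>k\<close> and \<open>x\<close> (\<open>window_prob_rec\<close>). Its solution that does not depend on \<open>j\<close> and \<open>k\<close> is the
  Holroyd-Liggett cylinder function \<open>color_prob\<close>, and the window probabilities differ from it by at most
  \<open>1/(j+1) + 1/(k+1)\<close> (\<open>window_prob_approx\<close>). Hence the factor has exactly the marginals
  \<open>color_prob\<close> (\<open>measure_factor_window\<close>). One-dependence follows from the identity of Holroyd and Liggett that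
  summing \<open>color_prob (x @ c # y)\<close> over the color \<open>c\<close> gives \<open>color_prob x * color_prob y\<close>
  (\<open>color_prob_indep\<close>).

  The tail. Looked at from the origin, the visible arrivals (the running minima of the arrival times on the two sides) form
  in logarithmic time a Poisson process with independent marks. In dyadic time slots this becomes: the
  event that a slot contains exactly one visible arrival, on a prescribed side and with a prescribed coin, has
  probability \<open>1/16\<close> and is independent of all earlier times (\<open>measure_slot\<close>). Five prescribed steps send all
  twelve pairs of colors to the same pair (\<open>run_steps_sync\<close>), so each block of five slots produces
  coalescence with probability \<open>16^-5\<close>, independently. Since \<open>n\<close> blocks fit into a distance that is
  exponential in \<open>n\<close>, the coding radius has a power tail (\<open>late_bound\<close>, \<open>tail_bound\<close>).
\<close>

section \<open>The law of the word built in an interval\<close>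

text \<open>Insertion of a letter before position \<open>i\<close>, and deletion of the letter at position \<open>i\<close>.\<close>
definition insert_at :: "nat \<Rightarrow> 'a \<Rightarrow> 'a list \<Rightarrow> 'a list" where
  "insert_at i c w = take i w @ c # drop i w"

definition delete_at :: "nat \<Rightarrow> 'a list \<Rightarrow> 'a list" where
  "delete_at i w = take i w @ drop (Suc i) w"

lemma length_insert_at [simp]: "i \<le> length w \<Longrightarrow> length (insert_at i c w) = Suc (length w)"
  by (simp add: insert_at_def)

lemma length_delete_at [simp]: "i < length w \<Longrightarrow> length (delete_at i w) = length w - 1"
  by (simp add: delete_at_def)

lemma delete_insert [simp]: "i \<le> length w \<Longrightarrow> delete_at i (insert_at i c w) = w"
  by (simp add: delete_at_def insert_at_def)

lemma insert_delete [simp]: "i < length w \<Longrightarrow> insert_at i (w ! i) (delete_at i w) = w"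
  by (simp add: delete_at_def insert_at_def id_take_nth_drop[symmetric] min_def)

lemma nth_insert_at [simp]: "i \<le> length w \<Longrightarrow> insert_at i c w ! i = c"
  by (simp add: insert_at_def nth_append)

lemma nth_delete_at: "i < length w \<Longrightarrow> m < length w - 1 \<Longrightarrow>
    delete_at i w ! m = (if m < i then w ! m else w ! Suc m)"
  by (auto simp: delete_at_def nth_append min_def)

lemma take_delete_at: "k < length w \<Longrightarrow> m < length w - 1 \<Longrightarrow>
    take m (delete_at k w) = (if m < k then take m w else delete_at k (take (Suc m) w))"
  by (rule nth_equalityI) (auto simp: nth_delete_at min_def)

lemma drop_delete_at: "k < length w \<Longrightarrow> m < length w - 1 \<Longrightarrow>
    drop (Suc m) (delete_at k w) = (if m < k then delete_at (k - Suc m) (drop (Suc m) w) else drop (Suc (Suc m)) w)"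
  by (rule nth_equalityI) (auto simp: nth_delete_at)

lemma distinct_adj_insert:
  assumes "xs \<noteq> []" "ys \<noteq> []" "distinct_adj (xs @ ys)"
  shows "distinct_adj (xs @ c # ys) \<longleftrightarrow> c \<noteq> last xs \<and> c \<noteq> hd ys"
  using assms by (cases ys) (auto simp: distinct_adj_append_iff)

lemma distinct_adj_split:
  "xs \<noteq> [] \<Longrightarrow> ys \<noteq> [] \<Longrightarrow> distinct_adj (xs @ c # ys) \<longleftrightarrow> distinct_adj (xs @ [c]) \<and> distinct_adj (c # ys)"
  by (cases ys) (auto simp: distinct_adj_append_iff)

text \<open>The probability that the word \<open>w\<close> is produced between two old sites of colors \<open>a\<close> and \<open>b\<close>.
  The earliest arrival is uniform among the positions, its color \<open>w ! i\<close> is one of two possible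
  colors (whence the factor \<open>2\<close> in the denominator), and the two sides then evolve independently.
  Letters outside \<open>{1..4}\<close> are not excluded here; the
  probabilistic meaning is only used for words over \<open>{1..4}\<close>.\<close>
function word_prob :: "nat \<Rightarrow> nat list \<Rightarrow> nat \<Rightarrow> real" where
  "word_prob a w b = (if w = [] then 1 else
     (\<Sum>i<length w. if w ! i \<noteq> a \<and> w ! i \<noteq> b
        then word_prob a (take i w) (w ! i) * word_prob (w ! i) (drop (Suc i) w) b else 0) / (2 * real (length w)))"
  by pat_completeness auto
termination
  by (relation "Wellfounded.measure (\<lambda>(a, w, b). length w)") auto

declare word_prob.simps [simp del]

lemma word_prob_Nil [simp]: "word_prob a [] b = 1"
  by (simp add: word_prob.simps)

lemma word_prob_nonneg: "0 \<le> word_prob a w b"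
proof (induction "length w" arbitrary: a w b rule: less_induct)
  case less
  show ?case
    by (subst word_prob.simps) (auto intro!: divide_nonneg_nonneg sum_nonneg mult_nonneg_nonneg less)
qed

lemma word_prob_eq_0:
  assumes "w \<noteq> []" "\<not> distinct_adj (a # w @ [b])"
  shows "word_prob a w b = 0"
  using assms
proof (induction "length w" arbitrary: a w b rule: less_induct)
  case less
  have "word_prob a (take i w) (w ! i) * word_prob (w ! i) (drop (Suc i) w) b = 0"
    if i: "i < length w" "w ! i \<noteq> a" "w ! i \<noteq> b" for i
  proof -
    have w: "a # w @ [b] = (a # take i w) @ (w ! i) # (drop (Suc i) w @ [b])"
      using i id_take_nth_drop[of i w] by simp
    have "\<not> distinct_adj ((a # take i w) @ [w ! i]) \<or> \<not> distinct_adj (w ! i # (drop (Suc i) w @ [b]))"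
      using less.prems(2) unfolding w by (subst (asm) distinct_adj_split) auto
    then consider "\<not> distinct_adj (a # take i w @ [w ! i])" | "\<not> distinct_adj (w ! i # drop (Suc i) w @ [b])"
      by auto
    then show ?thesis
    proof cases
      case 1
      then have "take i w \<noteq> []" using i by (intro notI) auto
      with 1 less.hyps[of "take i w" a "w ! i"] i show ?thesis by simp
    next
      case 2
      then have "drop (Suc i) w \<noteq> []" using i by (intro notI) auto
      with 2 less.hyps[of "drop (Suc i) w" "w ! i" b] i show ?thesis by simp
    qed
  qed
  then have "(\<Sum>i<length w. if w ! i \<noteq> a \<and> w ! i \<noteq> b
        then word_prob a (take i w) (w ! i) * word_prob (w ! i) (drop (Suc i) w) b else 0) = 0"
    by (intro sum.neutral) auto
  then show ?case
    using less.prems by (subst word_prob.simps) simp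
qed

lemma sum_skip:
  fixes f :: "nat \<Rightarrow> real"
  assumes "k \<le> n"
  shows "(\<Sum>m<n. f (if m < k then m else Suc m)) = (\<Sum>i\<in>{..n} - {k}. f i)"
  by (rule sum.reindex_bij_witness[of _ "\<lambda>i. if i < k then i else i - 1" "\<lambda>m. if m < k then m else Suc m"])
     (use assms in auto)

text \<open>The recursion by the latest arrival, derived from the one by the earliest. After expanding each
  term on the right at its earliest arrival \<open>i\<close> and exchanging the sums, the deleted position \<open>k\<close> lies on one side of \<open>i\<close>,
  and the induction hypothesis applies to that side.\<close>
lemma word_prob_remove:
  assumes "w \<noteq> []" "distinct_adj (a # w @ [b])"
  shows "2 * real (length w) * word_prob a w b = (\<Sum>k<length w. word_prob a (delete_at k w) b)"
  using assms
proof (induction "length w" arbitrary: a w b rule: less_induct)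
  case less
  define ok where "ok i \<longleftrightarrow> w ! i \<noteq> a \<and> w ! i \<noteq> b" for i
  define Lf where "Lf i = word_prob a (take i w) (w ! i)" for i
  define Rt where "Rt i = word_prob (w ! i) (drop (Suc i) w) b" for i
  have Hw: "2 * real (length w) * word_prob a w b = (\<Sum>i<length w. if ok i then Lf i * Rt i else 0)"
    using less.prems by (subst word_prob.simps) (simp add: ok_def Lf_def Rt_def cong: if_cong)
  show ?case
  proof (cases "length w = 1")
    case True
    then obtain c where w: "w = [c]" by (cases w) auto
    then show ?thesis using Hw less.prems
      by (auto simp: ok_def Lf_def Rt_def delete_at_def)
  next
    case False
    then obtain n where n: "length w = Suc n" "0 < n"
      using less.prems by (cases "length w") auto
    have split: "distinct_adj (a # take i w @ [w ! i])" "distinct_adj (w ! i # drop (Suc i) w @ [b])"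
      if i: "i < length w" for i
    proof -
      have w: "a # w @ [b] = (a # take i w) @ (w ! i) # (drop (Suc i) w @ [b])"
        using i id_take_nth_drop[of i w] by simp
      have "distinct_adj ((a # take i w) @ [w ! i]) \<and> distinct_adj (w ! i # (drop (Suc i) w @ [b]))"
        using less.prems(2) unfolding w by (subst (asm) distinct_adj_split) auto
      then show "distinct_adj (a # take i w @ [w ! i])" "distinct_adj (w ! i # drop (Suc i) w @ [b])"
        by auto
    qed
    define g where "g k i = (if ok i then (if k < i then word_prob a (delete_at k (take i w)) (w ! i) * Rt i
        else Lf i * word_prob (w ! i) (delete_at (k - Suc i) (drop (Suc i) w)) b) else 0)" for k i
    have expand: "2 * real n * word_prob a (delete_at k w) b = (\<Sum>i\<in>{..n} - {k}. g k i)" if k: "k < length w" for k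
    proof -
      have "delete_at k w \<noteq> []" using n k length_delete_at[of k w] by (intro notI) simp
      then have "2 * real n * word_prob a (delete_at k w) b = (\<Sum>m<n. g k (if m < k then m else Suc m))"
        using n k
        by (subst word_prob.simps) (auto simp: g_def ok_def Lf_def Rt_def nth_delete_at take_delete_at drop_delete_at intro!: sum.cong)
      then show ?thesis
        using sum_skip[of k n "g k"] k n by simp
    qed
    have inner: "(\<Sum>k\<in>{..n} - {i}. g k i) = 2 * real n * (if ok i then Lf i * Rt i else 0)"
      if i: "i \<le> n" for i
    proof (cases "ok i")
      case True
      have "{..n} - {i} = {..<i} \<union> {Suc i..n}" using i by auto
      then have "(\<Sum>k\<in>{..n} - {i}. g k i) = (\<Sum>k<i. g k i) + (\<Sum>k=Suc i..n. g k i)"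
        by (simp only:) (rule sum.union_disjoint; force)
      also have "(\<Sum>k<i. g k i) = (\<Sum>k<i. word_prob a (delete_at k (take i w)) (w ! i)) * Rt i"
        using True by (simp add: g_def sum_distrib_right)
      also have "(\<Sum>k<i. word_prob a (delete_at k (take i w)) (w ! i)) = 2 * real i * Lf i"
      proof (cases "i = 0")
        case False
        then have "take i w \<noteq> []" using n by auto
        then show ?thesis
          using less.hyps[of "take i w" a "w ! i"] i n split(1)[of i] by (simp add: Lf_def)
      qed simp
      also have "(\<Sum>k=Suc i..n. g k i) = (\<Sum>k<n - i. g (k + Suc i) i)"
        by (rule sum.reindex_bij_witness[of _ "\<lambda>k. k + Suc i" "\<lambda>k. k - Suc i"]) auto
      also have "\<dots> = Lf i * (\<Sum>k<n - i. word_prob (w ! i) (delete_at k (drop (Suc i) w)) b)"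
        using True by (simp add: g_def sum_distrib_left)
      also have "(\<Sum>k<n - i. word_prob (w ! i) (delete_at k (drop (Suc i) w)) b) = 2 * real (n - i) * Rt i"
      proof (cases "i = n")
        case False
        then have "drop (Suc i) w \<noteq> []" using i n by auto
        then show ?thesis
          using less.hyps[of "drop (Suc i) w" "w ! i" b] i n split(2)[of i] by (simp add: Rt_def)
      qed simp
      finally show ?thesis
        using True i by (simp add: of_nat_diff algebra_simps)
    qed (simp add: g_def)
    have "2 * real n * (\<Sum>k\<le>n. word_prob a (delete_at k w) b) = (\<Sum>k\<le>n. \<Sum>i\<in>{..n} - {k}. g k i)"
      using expand n by (simp add: sum_distrib_left)
    also have "\<dots> = (\<Sum>i\<le>n. \<Sum>k\<in>{..n} - {i}. g k i)"
      by (simp add: sum.Sigma, rule sum.reindex_bij_witness[of _ prod.swap prod.swap]) auto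
    also have "\<dots> = 2 * real n * (\<Sum>i\<le>n. if ok i then Lf i * Rt i else 0)"
      using inner by (simp add: sum_distrib_left)
    also have "\<dots> = 2 * real n * (2 * real (length w) * word_prob a w b)"
      unfolding Hw by (simp add: n lessThan_Suc_atMost)
    finally show ?thesis using n by (simp add: lessThan_Suc_atMost)
  qed
qed

text \<open>Words of length \<open>n\<close> over the four colors.\<close>
definition words :: "nat \<Rightarrow> nat list set" where
  "words n = {w. set w \<subseteq> {1..4} \<and> length w = n}"

lemma finite_words [simp]: "finite (words n)"
  unfolding words_def by (rule finite_lists_length_eq) simp

lemma sum_words_insert_at:
  fixes f :: "nat list \<Rightarrow> real"
  assumes "i \<le> n"
  shows "(\<Sum>w\<in>words (Suc n). f w) = (\<Sum>w\<in>words n. \<Sum>c\<in>{1..4}. f (insert_at i c w))"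
proof -
  have "(\<Sum>w\<in>words n. \<Sum>c\<in>{1..4}. f (insert_at i c w)) = (\<Sum>(w, c)\<in>words n \<times> {1..4}. f (insert_at i c w))"
    by (simp add: sum.cartesian_product)
  also have "\<dots> = (\<Sum>w\<in>words (Suc n). f w)"
  proof (rule sum.reindex_bij_witness[of _ "\<lambda>w. (delete_at i w, w ! i)" "\<lambda>(w, c). insert_at i c w"], goal_cases)
    case (1 a)
    then show ?case using assms by (auto simp: words_def)
  next
    case (2 a)
    have "set (insert_at i (snd a) (fst a)) \<subseteq> insert (snd a) (set (fst a))"
      by (auto simp: insert_at_def dest: in_set_takeD in_set_dropD)
    also have "\<dots> \<subseteq> {1..4}" using 2 by (auto simp: words_def)
    finally have "set (insert_at i (snd a) (fst a)) \<subseteq> {1..4}" .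
    moreover have "length (fst a) = n" using 2 by (auto simp: words_def)
    ultimately show ?case using assms by (simp add: words_def case_prod_beta)
  next
    case (3 w)
    then show ?case using assms by (auto simp: words_def)
  next
    case (4 w)
    have "set (delete_at i w) \<subseteq> set w"
      by (auto simp: delete_at_def dest: in_set_takeD in_set_dropD)
    moreover have "w ! i \<in> set w" using 4 assms by (auto simp: words_def)
    ultimately show ?case using 4 assms by (auto simp: words_def subset_iff)
  qed auto
  finally show ?thesis ..
qed

text \<open>The colors that may be inserted before position \<open>i\<close> of \<open>w\<close>, where \<open>w\<close> is enclosed by the
  letters \<open>a\<close> and \<open>b\<close>.\<close>
definition avail :: "nat \<Rightarrow> nat \<Rightarrow> nat list \<Rightarrow> nat \<Rightarrow> nat set" where
  "avail a i w b = {1..4} - {(a # w) ! i, (w @ [b]) ! i}"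

lemma insert_at_ends: "i \<le> length w \<Longrightarrow> a # insert_at i c w @ [b] = (a # take i w) @ c # (drop i w @ [b])"
  by (simp add: insert_at_def)

lemma last_take_Cons: "i \<le> length w \<Longrightarrow> last (a # take i w) = (a # w) ! i"
  by (cases i) (auto simp: last_conv_nth nth_Cons')

lemma hd_drop_append: "i \<le> length w \<Longrightarrow> hd (drop i w @ [b]) = (w @ [b]) ! i"
  by (cases "i = length w") (auto simp: nth_append hd_append hd_drop_conv_nth)

lemma distinct_adj_insert_at:
  assumes "i \<le> length w" "distinct_adj (a # w @ [b])"
  shows "distinct_adj (a # insert_at i c w @ [b]) \<longleftrightarrow> c \<noteq> (a # w) ! i \<and> c \<noteq> (w @ [b]) ! i"
proof -
  have "distinct_adj ((a # take i w) @ (drop i w @ [b]))"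
    using assms(2) by (simp del: distinct_adj_Cons flip: append_assoc)
  then have "distinct_adj ((a # take i w) @ c # (drop i w @ [b])) \<longleftrightarrow>
      c \<noteq> last (a # take i w) \<and> c \<noteq> hd (drop i w @ [b])"
    by (intro distinct_adj_insert) auto
  then show ?thesis
    using assms(1) by (simp only: insert_at_ends last_take_Cons hd_drop_append)
qed

text \<open>The removal recursion in dual form: averaging a test function \<open>\<phi>\<close> over words of length
  \<open>n + 1\<close> amounts to inserting a letter at a random position of a random word of length \<open>n\<close>.\<close>
lemma word_prob_sum_insert:
  assumes ab: "a \<noteq> b"
  shows "2 * real (Suc n) * (\<Sum>w\<in>words (Suc n). word_prob a w b * \<phi> w) =
    (\<Sum>w\<in>words n. word_prob a w b * (\<Sum>i\<le>n. \<Sum>c\<in>avail a i w b. \<phi> (insert_at i c w)))"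
proof -
  have "2 * real (Suc n) * (\<Sum>w\<in>words (Suc n). word_prob a w b * \<phi> w) =
    (\<Sum>w\<in>words (Suc n). \<Sum>i\<le>n. of_bool (distinct_adj (a # w @ [b])) * word_prob a (delete_at i w) b * \<phi> w)"
    unfolding sum_distrib_left
  proof (rule sum.cong[OF refl], goal_cases)
    case (1 w)
    then have l: "length w = Suc n" and ne: "w \<noteq> []" by (auto simp: words_def)
    have "2 * real (Suc n) * word_prob a w b = of_bool (distinct_adj (a # w @ [b])) * (\<Sum>i\<le>n. word_prob a (delete_at i w) b)"
      using word_prob_remove[of w a b] word_prob_eq_0[of w a b] ne l
      by (cases "distinct_adj (a # w @ [b])") (simp_all add: lessThan_Suc_atMost del: distinct_adj_Cons)
    then show ?case
      by (simp add: sum_distrib_left sum_distrib_right mult.assoc[symmetric] del: distinct_adj_Cons)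
  qed
  also have "\<dots> = (\<Sum>i\<le>n. \<Sum>w\<in>words (Suc n). of_bool (distinct_adj (a # w @ [b])) * word_prob a (delete_at i w) b * \<phi> w)"
    by (rule sum.swap)
  also have "\<dots> = (\<Sum>i\<le>n. \<Sum>w\<in>words n. word_prob a w b * (\<Sum>c\<in>avail a i w b. \<phi> (insert_at i c w)))"
  proof (rule sum.cong[OF refl], goal_cases)
    case (1 i)
    then have i: "i \<le> n" by simp
    show ?case
      unfolding sum_words_insert_at[OF i]
    proof (rule sum.cong[OF refl], goal_cases)
      case (1 w)
      then have l: "length w = n" by (auto simp: words_def)
      show ?case
      proof (cases "distinct_adj (a # w @ [b])")
        case True
        have "(\<Sum>c\<in>{1..4}. of_bool (distinct_adj (a # insert_at i c w @ [b])) * word_prob a (delete_at i (insert_at i c w)) b * \<phi> (insert_at i c w))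
          = (\<Sum>c\<in>{1..4}. if c \<in> avail a i w b then word_prob a w b * \<phi> (insert_at i c w) else 0)"
          using l i by (intro sum.cong refl) (simp add: distinct_adj_insert_at[OF _ True] avail_def del: distinct_adj_Cons)
        also have "\<dots> = (\<Sum>c\<in>avail a i w b. word_prob a w b * \<phi> (insert_at i c w))"
          by (subst sum.inter_filter[symmetric]) (auto simp: avail_def intro!: sum.cong)
        finally show ?thesis by (simp add: sum_distrib_left)
      next
        case False
        then have "w \<noteq> []" using ab by (intro notI) auto
        then have "word_prob a w b = 0" using False by (rule word_prob_eq_0)
        then show ?thesis using l i by simp
      qed
    qed
  qed
  also have "\<dots> = (\<Sum>w\<in>words n. \<Sum>i\<le>n. word_prob a w b * (\<Sum>c\<in>avail a i w b. \<phi> (insert_at i c w)))"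
    by (rule sum.swap)
  finally show ?thesis by (simp add: sum_distrib_left)
qed

lemma card_avail:
  assumes "i \<le> length w" "distinct_adj (a # w @ [b])" "w \<in> words n" "a \<in> {1..4}" "b \<in> {1..4}"
  shows "card (avail a i w b) = 2"
proof -
  have 1: "(a # w) ! i \<noteq> (w @ [b]) ! i"
  proof -
    have "distinct_adj ((a # take i w) @ (drop i w @ [b]))"
      using assms(2) by (simp del: distinct_adj_Cons flip: append_assoc)
    then have "last (a # take i w) \<noteq> hd (drop i w @ [b])"
      unfolding distinct_adj_append_iff by blast
    then show ?thesis using assms(1) by (metis last_take_Cons hd_drop_append)
  qed
  have 2: "(a # w) ! i \<in> {1..4}"
  proof -
    have "(a # w) ! i \<in> set (a # w)" using assms(1) by (intro nth_mem) simp
    then show ?thesis using assms by (auto simp: words_def)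
  qed
  have 3: "(w @ [b]) ! i \<in> {1..4}"
  proof -
    have "(w @ [b]) ! i \<in> set (w @ [b])" using assms(1) by (intro nth_mem) simp
    then show ?thesis using assms by (auto simp: words_def)
  qed
  show ?thesis unfolding avail_def using 1 2 3 by (subst card_Diff_subset) auto
qed

text \<open>The subword of length \<open>n\<close> that starts at position \<open>j\<close>.\<close>
definition window :: "nat \<Rightarrow> nat \<Rightarrow> 'a list \<Rightarrow> 'a list" where
  "window j n w = take n (drop j w)"

text \<open>The probability of reading \<open>x\<close> with exactly \<open>j\<close> sites to its left and \<open>k\<close> sites to its right,
  between end colors \<open>a\<close> and \<open>b\<close>.\<close>
definition window_prob :: "nat \<Rightarrow> nat \<Rightarrow> nat \<Rightarrow> nat list \<Rightarrow> nat \<Rightarrow> real" where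
  "window_prob a b j x k = (\<Sum>w\<in>words (j + length x + k). word_prob a w b * of_bool (window j (length x) w = x))"

lemma window_insert_left: "i < j \<Longrightarrow> j + n \<le> Suc (length w) \<Longrightarrow> window j n (insert_at i c w) = window (j - 1) n w"
  by (cases "j - i") (auto simp: window_def insert_at_def intro!: arg_cong[where f = "\<lambda>m. take n (drop m w)"])

lemma window_insert_right: "j + n \<le> i \<Longrightarrow> i \<le> length w \<Longrightarrow> window j n (insert_at i c w) = window j n w"
  by (auto simp: window_def insert_at_def drop_take min_def)

lemma window_insert_mid: "p < n \<Longrightarrow> j + n \<le> Suc (length w) \<Longrightarrow>
    window j n (insert_at (j + p) c w) = insert_at p c (window j (n - 1) w)"
proof -
  assume a: "p < n" "j + n \<le> Suc (length w)"
  define u v z where "u = take j w" and "v = take (n - 1) (drop j w)" and "z = drop (n - 1) (drop j w)"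
  have w: "w = u @ v @ z" and l: "length u = j" "length v = n - 1"
    using a by (auto simp: u_def v_def z_def simp del: drop_drop)
  have "take (n - p) (c # drop p v @ z) = c # drop p v"
    using a l by (cases "n - p") auto
  then show ?thesis
    using a l unfolding w by (simp add: window_def insert_at_def)
qed

lemma insert_at_eq_iff:
  assumes "p < length x" "length u = length x - 1"
  shows "insert_at p c u = x \<longleftrightarrow> c = x ! p \<and> u = delete_at p x"
proof
  have "p \<le> length u" using assms by simp
  note f = nth_insert_at[OF this, of c] delete_insert[OF this, of c]
  assume "insert_at p c u = x"
  with f show "c = x ! p \<and> u = delete_at p x" by metis
next
  assume "c = x ! p \<and> u = delete_at p x"
  with insert_delete[OF assms(1)] show "insert_at p c u = x" by metis
qed

lemma window_nth: "q < n \<Longrightarrow> j + n \<le> length w \<Longrightarrow> window j n w ! q = w ! (j + q)"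
  by (simp add: window_def)

lemma length_window [simp]: "j + n \<le> length w \<Longrightarrow> length (window j n w) = n"
  by (simp add: window_def)

lemma window_Suc_left: "0 < j \<Longrightarrow> j + n \<le> length w \<Longrightarrow> window (j - 1) (Suc n) w = w ! (j - 1) # window j n w"
  using Cons_nth_drop_Suc[of "j - 1" w] take_Suc_Cons[of n "w ! (j - 1)" "drop j w"]
  by (simp add: window_def)

lemma window_Suc_right: "j + n < length w \<Longrightarrow> window j (Suc n) w = window j n w @ [w ! (j + n)]"
  by (simp add: window_def take_Suc_conv_app_nth)

text \<open>An insertion at position \<open>p\<close> of the window. The inserted letter \<open>x ! p\<close> differs from its
  neighbors inside the window because \<open>x\<close> is proper; at the two ends of the window the
  excluded case is that the outer neighbor has the color of the inserted letter, and then the old word already shows \<open>x\<close>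
  in a window that contains this neighbor.\<close>
lemma window_mid_term:
  assumes x: "distinct_adj x" "x \<in> words n" and p: "p < n" and j: "0 < j" and k: "0 < k"
    and w: "Suc (length w) = j + n + k" "distinct_adj (a # w @ [b])"
  shows "(\<Sum>c\<in>avail a (j + p) w b. of_bool (window j n (insert_at (j + p) c w) = x)) =
     (of_bool (window j (n - 1) w = delete_at p x) - of_bool (p = 0 \<and> window (j - 1) n w = x)
       - of_bool (p = n - 1 \<and> window j n w = x) :: real)"
proof -
  have lx: "length x = n" and sx: "set x \<subseteq> {1..4}" using x by (auto simp: words_def)
  have xp: "x ! p \<in> {1..4}" using sx lx p nth_mem[of p x] by blast
  have L: "(a # w) ! (j + p) = w ! (j + p - 1)" using j by (simp add: nth_Cons')
  have R: "(w @ [b]) ! (j + p) = w ! (j + p)" using w k p by (simp add: nth_append)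
  have "(\<Sum>c\<in>avail a (j + p) w b. of_bool (window j n (insert_at (j + p) c w) = x)) =
     (\<Sum>c\<in>avail a (j + p) w b. if c = x ! p then of_bool (window j (n - 1) w = delete_at p x) else 0 :: real)"
    using p w k lx by (intro sum.cong refl) (auto simp: window_insert_mid insert_at_eq_iff)
  also have "\<dots> = of_bool (x ! p \<noteq> w ! (j + p - 1) \<and> x ! p \<noteq> w ! (j + p) \<and> window j (n - 1) w = delete_at p x)"
    using xp by (subst sum.delta) (auto simp: avail_def L R)
  also have "\<dots> = (of_bool (window j (n - 1) w = delete_at p x) - of_bool (p = 0 \<and> window (j - 1) n w = x)
       - of_bool (p = n - 1 \<and> window j n w = x) :: real)"
  proof -
    have A: "window (j - 1) n w = x \<longleftrightarrow> w ! (j - 1) = x ! p \<and> window j (n - 1) w = delete_at p x" if "p = 0"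
    proof -
      obtain y ys where "x = y # ys" using lx p by (cases x) auto
      then show ?thesis using window_Suc_left[of j "n - 1" w] j k w p that lx by (auto simp: delete_at_def)
    qed
    have B: "window j n w = x \<longleftrightarrow> w ! (j + p) = x ! p \<and> window j (n - 1) w = delete_at p x" if "p = n - 1"
    proof -
      obtain y ys where "x = ys @ [y]" using lx p by (cases x rule: rev_cases) auto
      then show ?thesis using window_Suc_right[of j "n - 1" w] j k w p that lx by (auto simp: delete_at_def)
    qed
    have C: "x ! p \<noteq> w ! (j + p - 1)" if "window j (n - 1) w = delete_at p x" "p \<noteq> 0"
    proof -
      have "w ! (j + p - 1) = window j (n - 1) w ! (p - 1)" using that p w k by (subst window_nth) auto
      also have "\<dots> = x ! (p - 1)" using that p lx by (simp add: nth_delete_at)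
      also have "\<dots> \<noteq> x ! p" using x(1) p that lx unfolding distinct_adj_conv_nth by (cases p) auto
      finally show ?thesis by simp
    qed
    have D: "x ! p \<noteq> w ! (j + p)" if "window j (n - 1) w = delete_at p x" "p \<noteq> n - 1"
    proof -
      have "w ! (j + p) = window j (n - 1) w ! p" using that p w k by (subst window_nth) auto
      also have "\<dots> = x ! Suc p" using that p lx by (simp add: nth_delete_at)
      also have "\<dots> \<noteq> x ! p" using x(1) p that lx unfolding distinct_adj_conv_nth by (metis Suc_lessI Suc_pred' diff_Suc_1 gr_zeroI less_nat_zero_code)
      finally show ?thesis by simp
    qed
    have E: "w ! (j - 1) \<noteq> w ! j"
    proof -
      have "distinct_adj w" using w(2) by (cases w) (auto simp: distinct_adj_append_iff simp flip: append_Cons)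
      moreover have "Suc (j - 1) < length w" using j k w p by auto
      ultimately have "w ! (j - 1) \<noteq> w ! Suc (j - 1)" unfolding distinct_adj_conv_nth by blast
      then show ?thesis using j by simp
    qed
    show ?thesis
      by (cases "p = 0"; cases "p = n - 1"; cases "window j (n - 1) w = delete_at p x")
         (use A B C D E in \<open>auto simp: of_bool_def\<close>)
  qed
  finally show ?thesis .
qed

text \<open>The letter inserted last is to the left of the window, to its right, or in it. The two terms
  \<open>- 1\<close> are the corrections at the ends of the window.\<close>
lemma window_prob_rec:
  assumes x: "distinct_adj x" "x \<in> words n" and n: "0 < n" and j: "0 < j" and k: "0 < k"
    and ab: "a \<noteq> b" "a \<in> {1..4}" "b \<in> {1..4}"
  shows "2 * real (j + n + k) * window_prob a b j x k =
    (2 * real j - 1) * window_prob a b (j - 1) x k + (2 * real k - 1) * window_prob a b j x (k - 1)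
    + (\<Sum>p<n. window_prob a b j (delete_at p x) k)"
proof -
  have lx: "length x = n" using x by (auto simp: words_def)
  define N where "N = j + n + k - 1"
  have N: "j + n + k = Suc N" using n by (simp add: N_def)
  have "2 * real (j + n + k) * window_prob a b j x k
    = (\<Sum>w\<in>words N. word_prob a w b * (\<Sum>i\<le>N. \<Sum>c\<in>avail a i w b. of_bool (window j n (insert_at i c w) = x)))"
    unfolding window_prob_def lx N by (rule word_prob_sum_insert[OF ab(1)])
  also have "\<dots> = (\<Sum>w\<in>words N. word_prob a w b * ((2 * real j - 1) * of_bool (window (j - 1) n w = x) +
      (2 * real k - 1) * of_bool (window j n w = x) + (\<Sum>p<n. of_bool (window j (n - 1) w = delete_at p x))))"
  proof (rule sum.cong[OF refl], goal_cases)
    case (1 w)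
    then have lw: "length w = N" by (auto simp: words_def)
    show ?case
    proof (cases "distinct_adj (a # w @ [b])")
      case True
      let ?f = "\<lambda>i. \<Sum>c\<in>avail a i w b. of_bool (window j n (insert_at i c w) = x) :: real"
      have "{..N} = {..<j} \<union> {j..<j + n} \<union> {j + n..N}" using k N by auto
      then have "(\<Sum>i\<le>N. ?f i) = (\<Sum>i<j. ?f i) + (\<Sum>i=j..<j + n. ?f i) + (\<Sum>i=j + n..N. ?f i)"
        by (simp only:, subst sum.union_disjoint, auto, subst sum.union_disjoint, auto)
      also have "(\<Sum>i<j. ?f i) = (\<Sum>i<j. 2 * of_bool (window (j - 1) n w = x))"
      proof (rule sum.cong[OF refl], goal_cases)
        case (1 i)
        then have "window j n (insert_at i c w) = window (j - 1) n w" for c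
          using k N lw by (intro window_insert_left) auto
        then show ?case using card_avail[OF _ True \<open>w \<in> words N\<close> ab(2,3), of i] 1 N lw by simp
      qed
      also have "(\<Sum>i=j + n..N. ?f i) = real k * (2 * of_bool (window j n w = x))"
      proof -
        have "(\<Sum>i=j + n..N. ?f i) = (\<Sum>i=j + n..N. 2 * of_bool (window j n w = x))"
      proof (rule sum.cong[OF refl], goal_cases)
        case (1 i)
        then have "window j n (insert_at i c w) = window j n w" for c
          using k N lw by (intro window_insert_right) auto
        then show ?case using card_avail[OF _ True \<open>w \<in> words N\<close> ab(2,3), of i] 1 N lw by simp
      qed
      also have "\<dots> = real (Suc N - (j + n)) * (2 * of_bool (window j n w = x))" by simp
      also have "Suc N - (j + n) = k" using N by simp
      finally show ?thesis .
      qed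
      also have "(\<Sum>i=j..<j + n. ?f i) = (\<Sum>p<n. ?f (j + p))"
        by (rule sum.reindex_bij_witness[of _ "\<lambda>p. j + p" "\<lambda>i. i - j"]) auto
      also have "\<dots> = (\<Sum>p<n. of_bool (window j (n - 1) w = delete_at p x) - of_bool (p = 0 \<and> window (j - 1) n w = x)
       - of_bool (p = n - 1 \<and> window j n w = x))"
        using x j k N lw True by (intro sum.cong refl window_mid_term[where k = k]) auto
      also have "\<dots> = (\<Sum>p<n. of_bool (window j (n - 1) w = delete_at p x)) - of_bool (window (j - 1) n w = x) - of_bool (window j n w = x)"
      proof -
        have "(\<Sum>p<n. of_bool (p = 0 \<and> window (j - 1) n w = x) :: real) = (\<Sum>p<n. if p = 0 then of_bool (window (j - 1) n w = x) else 0)"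
          by (intro sum.cong) auto
        moreover have "(\<Sum>p<n. of_bool (p = n - 1 \<and> window j n w = x) :: real) = (\<Sum>p<n. if p = n - 1 then of_bool (window j n w = x) else 0)"
          by (intro sum.cong) auto
        ultimately show ?thesis using n by (simp add: sum_subtractf sum.delta)
      qed
      finally have "(\<Sum>i\<le>N. ?f i) = (2 * real j - 1) * of_bool (window (j - 1) n w = x) +
          (2 * real k - 1) * of_bool (window j n w = x) + (\<Sum>p<n. of_bool (window j (n - 1) w = delete_at p x))"
        by (simp add: algebra_simps del: sum_of_bool_eq)
      then show ?thesis by simp
    next
      case False
      then have "w \<noteq> []" using ab by (intro notI) auto
      then have "word_prob a w b = 0" using False by (rule word_prob_eq_0)
      then show ?thesis by simp
    qed
  qed
  also have "\<dots> = (2 * real j - 1) * (\<Sum>w\<in>words N. word_prob a w b * of_bool (window (j - 1) n w = x)) +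
      (2 * real k - 1) * (\<Sum>w\<in>words N. word_prob a w b * of_bool (window j n w = x)) +
      (\<Sum>p<n. \<Sum>w\<in>words N. word_prob a w b * of_bool (window j (n - 1) w = delete_at p x))"
    unfolding sum.swap[of _ "words N" "{..<n}"] sum_distrib_left sum.distrib[symmetric]
    by (intro sum.cong refl) (simp add: algebra_simps sum_distrib_left)
  also have "(\<Sum>w\<in>words N. word_prob a w b * of_bool (window (j - 1) n w = x)) = window_prob a b (j - 1) x k"
    using j by (simp add: window_prob_def lx N_def)
  also have "(\<Sum>w\<in>words N. word_prob a w b * of_bool (window j n w = x)) = window_prob a b j x (k - 1)"
    using k by (simp add: window_prob_def lx N_def)
  also have "(\<Sum>p<n. \<Sum>w\<in>words N. word_prob a w b * of_bool (window j (n - 1) w = delete_at p x)) = (\<Sum>p<n. window_prob a b j (delete_at p x) k)"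
    using n by (intro sum.cong refl) (simp add: window_prob_def lx N_def)
  finally show ?thesis .
qed

section \<open>The Holroyd-Liggett cylinder probabilities\<close>

text \<open>The probability of the word \<open>x\<close> in the one-dependent 4-coloring.\<close>
function color_prob :: "nat list \<Rightarrow> real" where
  "color_prob x = (if x = [] then 1 else if distinct_adj x
     then (\<Sum>p<length x. color_prob (delete_at p x)) / (2 * (real (length x) + 1)) else 0)"
  by pat_completeness auto
termination
  by (relation "Wellfounded.measure length") auto

declare color_prob.simps [simp del]

lemma color_prob_Nil [simp]: "color_prob [] = 1"
  by (simp add: color_prob.simps)

lemma color_prob_eq_0: "\<not> distinct_adj x \<Longrightarrow> color_prob x = 0"
  by (cases "x = []") (auto simp: color_prob.simps)

lemma color_prob_rec: "x \<noteq> [] \<Longrightarrow> distinct_adj x \<Longrightarrow>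
    2 * (real (length x) + 1) * color_prob x = (\<Sum>p<length x. color_prob (delete_at p x))"
  by (subst color_prob.simps) simp

lemma color_prob_bounds: "0 \<le> color_prob x \<and> color_prob x \<le> 1"
proof (induction "length x" arbitrary: x rule: less_induct)
  case less
  show ?case
  proof (cases "x = [] \<or> \<not> distinct_adj x")
    case False
    have ih: "0 \<le> color_prob (delete_at p x) \<and> color_prob (delete_at p x) \<le> 1" if "p < length x" for p
      using less[of "delete_at p x"] that by simp
    then have "0 \<le> (\<Sum>p<length x. color_prob (delete_at p x))" by (intro sum_nonneg) auto
    moreover have "(\<Sum>p<length x. color_prob (delete_at p x)) \<le> real (length x)"
      using sum_mono[of "{..<length x}" "\<lambda>p. color_prob (delete_at p x)" "\<lambda>_. 1"] ih by simp
    ultimately show ?thesis using False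
      by (subst (1 2) color_prob.simps) (auto simp: field_simps)
  qed (auto simp: color_prob_eq_0)
qed

lemma delete_at_append1: "i < length x \<Longrightarrow> delete_at i (x @ y) = delete_at i x @ y"
  by (simp add: delete_at_def)

lemma delete_at_append2: "delete_at (length x + i) (x @ y) = x @ delete_at i y"
  by (simp add: delete_at_def)

lemma set_delete_at: "set (delete_at i x) \<subseteq> set x"
  by (auto simp: delete_at_def dest: in_set_takeD in_set_dropD)

lemma last_delete_at: "Suc i < length x \<Longrightarrow> delete_at i x \<noteq> [] \<and> last (delete_at i x) = last x"
  by (auto simp: delete_at_def)

lemma delete_at_last: "x \<noteq> [] \<Longrightarrow> delete_at (length x - 1) x = butlast x"
  by (simp add: delete_at_def butlast_conv_take)

lemma hd_delete_at: "0 < i \<Longrightarrow> i < length x \<Longrightarrow> delete_at i x \<noteq> [] \<and> hd (delete_at i x) = hd x"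
  by (cases x; cases i) (auto simp: delete_at_def)

lemma delete_at_0: "delete_at 0 x = tl x"
  by (simp add: delete_at_def drop_Suc)

text \<open>Exclusion of \<open>u\<close> and of further points at which \<open>f\<close> vanishes; below, \<open>u\<close> is the color of one neighbor
  of an insertion point, and \<open>V\<close> consists of the color of the other, if there is one.\<close>
lemma sum_minus_two:
  fixes f :: "nat \<Rightarrow> real"
  assumes "finite A" "u \<in> A" "B = A - ({u} \<union> V)" "V \<subseteq> A" "\<And>v. v \<in> V \<Longrightarrow> f v = 0"
  shows "sum f B = sum f A - f u"
proof -
  have "sum f A = sum f (A - ({u} \<union> V)) + sum f ({u} \<union> V)"
    using assms by (intro sum.subset_diff) auto
  also have "sum f ({u} \<union> V) = sum f {u}"
    using assms by (intro sum.mono_neutral_right) (auto intro: finite_subset)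
  finally show ?thesis using assms(3) by simp
qed

text \<open>Summing out one letter makes the two sides independent. In the induction the letter \<open>c\<close> is
  deleted (\<open>mid\<close>), or a letter of \<open>x\<close> (\<open>left\<close>), or one of \<open>y\<close> (\<open>right\<close>).
  After the deletion of a neighbor of \<open>c\<close> the condition that \<open>c\<close> differs from it remains, which contributes
  \<open>- color_prob (x @ y)\<close>; these terms cancel against \<open>mid\<close>, where two choices of \<open>c\<close> remain if
  \<open>x\<close> and \<open>y\<close> are nonempty.\<close>
lemma color_prob_indep:
  assumes "set x \<subseteq> {1..4}" "set y \<subseteq> {1..4}"
  shows "(\<Sum>c\<in>{1..4}. color_prob (x @ c # y)) = color_prob x * color_prob y"
  using assms
proof (induction "length x + length y" arbitrary: x y rule: less_induct)
  case less
  show ?case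
  proof (cases "distinct_adj x \<and> distinct_adj y")
    case False
    then have "color_prob (x @ c # y) = 0" for c
      by (intro color_prob_eq_0) (auto simp: distinct_adj_append_iff distinct_adj_Cons)
    then show ?thesis using False by (auto simp: color_prob_eq_0)
  next
    case True
    define X where "X = (if x = [] then {} else {last x})"
    define Y where "Y = (if y = [] then {} else {hd y})"
    define OK where "OK = {1..4} - (X \<union> Y)"
    define m n where "m = length x" and "n = length y"
    have XY: "X \<subseteq> {1..4}" "Y \<subseteq> {1..4}"
      using less.prems last_in_set[of x] hd_in_set[of y] by (auto simp: X_def Y_def simp del: last_in_set hd_in_set)
    have proper: "distinct_adj (x @ c # y) \<longleftrightarrow> c \<in> OK" if "c \<in> {1..4}" for c
      using True that by (auto simp: OK_def X_def Y_def distinct_adj_append_iff distinct_adj_Cons)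
    have single: "2 * (real (m + n) + 2) * color_prob (x @ c # y) = (\<Sum>i<m. color_prob (delete_at i x @ c # y)) + color_prob (x @ y)
        + (\<Sum>i<n. color_prob (x @ c # delete_at i y))" if c: "c \<in> OK" for c
    proof -
      have "2 * (real (m + n) + 2) * color_prob (x @ c # y) = (\<Sum>i<Suc (m + n). color_prob (delete_at i (x @ c # y)))"
        using color_prob_rec[of "x @ c # y"] proper[of c] c by (simp add: OK_def m_def n_def algebra_simps)
      also have "{..<Suc (m + n)} = {..<m} \<union> {m} \<union> {Suc m..<Suc (m + n)}" by auto
      also have "(\<Sum>i\<in>\<dots>. color_prob (delete_at i (x @ c # y))) = (\<Sum>i<m. color_prob (delete_at i (x @ c # y))) + color_prob (delete_at m (x @ c # y))
          + (\<Sum>i=Suc m..<Suc (m + n). color_prob (delete_at i (x @ c # y)))"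
        by (subst sum.union_disjoint) auto
      also have "(\<Sum>i<m. color_prob (delete_at i (x @ c # y))) = (\<Sum>i<m. color_prob (delete_at i x @ c # y))"
        by (intro sum.cong refl) (simp add: m_def delete_at_append1)
      also have "color_prob (delete_at m (x @ c # y)) = color_prob (x @ y)"
        by (simp add: m_def delete_at_def)
      also have "(\<Sum>i=Suc m..<Suc (m + n). color_prob (delete_at i (x @ c # y))) = (\<Sum>i<n. color_prob (delete_at (m + Suc i) (x @ c # y)))"
        by (rule sum.reindex_bij_witness[of _ "\<lambda>i. m + Suc i" "\<lambda>i. i - Suc m"]) auto
      also have "\<dots> = (\<Sum>i<n. color_prob (x @ c # delete_at i y))"
        unfolding m_def delete_at_append2 by (simp add: delete_at_def)
      finally show ?thesis .
    qed
    have left: "(\<Sum>c\<in>OK. color_prob (delete_at i x @ c # y)) = color_prob (delete_at i x) * color_prob y - of_bool (i = m - 1) * color_prob (x @ y)"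
      if i: "i < m" for i
    proof -
      have ne: "x \<noteq> []" using i by (auto simp: m_def)
      have "(\<Sum>c\<in>OK. color_prob (delete_at i x @ c # y)) = (\<Sum>c\<in>{1..4}. color_prob (delete_at i x @ c # y)) - color_prob (delete_at i x @ last x # y)"
        using XY ne by (intro sum_minus_two[of _ _ _ Y])
          (auto simp: OK_def X_def Y_def distinct_adj_append_iff distinct_adj_Cons split: if_splits intro!: color_prob_eq_0)
      also have "(\<Sum>c\<in>{1..4}. color_prob (delete_at i x @ c # y)) = color_prob (delete_at i x) * color_prob y"
        using i less.prems set_delete_at[of i x] by (intro less.hyps) (auto simp: m_def)
      also have "color_prob (delete_at i x @ last x # y) = of_bool (i = m - 1) * color_prob (x @ y)"
      proof (cases "i = m - 1")
        case True
        then have "delete_at i x @ [last x] = x" using ne delete_at_last[OF ne] by (simp add: m_def)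
        then have "delete_at i x @ last x # y = x @ y" by (metis append.assoc append_Cons append_Nil)
        then show ?thesis using True by (simp only: simp_thms of_bool_eq mult_1)
      next
        case False
        then have "Suc i < length x" using i by (auto simp: m_def)
        from last_delete_at[OF this] show ?thesis using False
          by (auto intro!: color_prob_eq_0 simp: distinct_adj_append_iff)
      qed
      finally show ?thesis .
    qed
    have right: "(\<Sum>c\<in>OK. color_prob (x @ c # delete_at i y)) = color_prob x * color_prob (delete_at i y) - of_bool (i = 0) * color_prob (x @ y)"
      if i: "i < n" for i
    proof -
      have ne: "y \<noteq> []" using i by (auto simp: n_def)
      have "(\<Sum>c\<in>OK. color_prob (x @ c # delete_at i y)) = (\<Sum>c\<in>{1..4}. color_prob (x @ c # delete_at i y)) - color_prob (x @ hd y # delete_at i y)"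
        using XY ne by (intro sum_minus_two[of _ _ _ X])
          (auto simp: OK_def X_def Y_def distinct_adj_append_iff distinct_adj_Cons split: if_splits intro!: color_prob_eq_0)
      also have "(\<Sum>c\<in>{1..4}. color_prob (x @ c # delete_at i y)) = color_prob x * color_prob (delete_at i y)"
        using i less.prems set_delete_at[of i y] by (intro less.hyps) (auto simp: n_def)
      also have "color_prob (x @ hd y # delete_at i y) = of_bool (i = 0) * color_prob (x @ y)"
      proof (cases "i = 0")
        case True
        then show ?thesis using ne by (simp add: delete_at_0)
      next
        case False
        then have "0 < i" "i < length y" using i by (auto simp: n_def)
        from hd_delete_at[OF this] show ?thesis using False
          by (auto intro!: color_prob_eq_0 simp: distinct_adj_append_iff distinct_adj_Cons)
      qed
      finally show ?thesis .
    qed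
    have suml: "(\<Sum>i<m. \<Sum>c\<in>OK. color_prob (delete_at i x @ c # y)) = (2 * (real m + 1) * color_prob x - 2 * of_bool (x = [])) * color_prob y - of_bool (x \<noteq> []) * color_prob (x @ y)"
    proof (cases "x = []")
      case False
      have "(\<Sum>i<m. \<Sum>c\<in>OK. color_prob (delete_at i x @ c # y)) = (\<Sum>i<m. color_prob (delete_at i x) * color_prob y) - (\<Sum>i<m. of_bool (i = m - 1) * color_prob (x @ y))"
        using left by (simp add: sum_subtractf)
      also have "(\<Sum>i<m. of_bool (i = m - 1) * color_prob (x @ y)) = (\<Sum>i<m. if i = m - 1 then color_prob (x @ y) else 0)"
        by (intro sum.cong) auto
      also have "\<dots> = color_prob (x @ y)" using False by (simp add: m_def)
      also have "(\<Sum>i<m. color_prob (delete_at i x) * color_prob y) = 2 * (real m + 1) * color_prob x * color_prob y"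
        using color_prob_rec[of x] False True by (simp add: m_def sum_distrib_right)
      finally show ?thesis using False by simp
    qed (simp add: m_def)
    have sumr: "(\<Sum>i<n. \<Sum>c\<in>OK. color_prob (x @ c # delete_at i y)) = color_prob x * (2 * (real n + 1) * color_prob y - 2 * of_bool (y = [])) - of_bool (y \<noteq> []) * color_prob (x @ y)"
    proof (cases "y = []")
      case False
      have "(\<Sum>i<n. \<Sum>c\<in>OK. color_prob (x @ c # delete_at i y)) = (\<Sum>i<n. color_prob x * color_prob (delete_at i y)) - (\<Sum>i<n. of_bool (i = 0) * color_prob (x @ y))"
        using right by (simp add: sum_subtractf)
      also have "(\<Sum>i<n. of_bool (i = 0) * color_prob (x @ y)) = (\<Sum>i<n. if i = 0 then color_prob (x @ y) else 0)"
        by (intro sum.cong) auto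
      also have "\<dots> = color_prob (x @ y)" using False by (simp add: n_def)
      also have "(\<Sum>i<n. color_prob x * color_prob (delete_at i y)) = color_prob x * (2 * (real n + 1) * color_prob y)"
        using color_prob_rec[of y] False True by (simp add: n_def sum_distrib_left)
      finally show ?thesis using False by simp
    qed (simp add: n_def)
    have mid: "(\<Sum>c\<in>OK. color_prob (x @ y)) = (4 - of_bool (x \<noteq> []) - of_bool (y \<noteq> [])) * color_prob (x @ y)"
    proof (cases "x \<noteq> [] \<and> y \<noteq> [] \<and> last x = hd y")
      case True
      then have "color_prob (x @ y) = 0" by (intro color_prob_eq_0) (auto simp: distinct_adj_append_iff)
      then show ?thesis by simp
    next
      case False
      have "card OK = 4 - card (X \<union> Y)"
        unfolding OK_def using XY by (subst card_Diff_subset) (auto intro: finite_subset)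
      also have "card (X \<union> Y) = of_bool (x \<noteq> []) + of_bool (y \<noteq> [])"
        using False by (auto simp: X_def Y_def)
      finally show ?thesis by (auto simp: of_bool_def)
    qed
    have "2 * (real (m + n) + 2) * (\<Sum>c\<in>{1..4}. color_prob (x @ c # y)) = 2 * (real (m + n) + 2) * (\<Sum>c\<in>OK. color_prob (x @ c # y))"
      using proper by (intro arg_cong2[where f = "(*)"] refl sum.mono_neutral_right) (auto simp: OK_def intro!: color_prob_eq_0)
    also have "\<dots> = (\<Sum>c\<in>OK. (\<Sum>i<m. color_prob (delete_at i x @ c # y)) + color_prob (x @ y) + (\<Sum>i<n. color_prob (x @ c # delete_at i y)))"
      unfolding sum_distrib_left using single by (intro sum.cong) auto
    also have "\<dots> = (\<Sum>i<m. \<Sum>c\<in>OK. color_prob (delete_at i x @ c # y)) + (\<Sum>c\<in>OK. color_prob (x @ y)) + (\<Sum>i<n. \<Sum>c\<in>OK. color_prob (x @ c # delete_at i y))"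
      unfolding sum.distrib by (simp add: sum.swap[of _ OK])
    also have "\<dots> = 2 * (real (m + n) + 2) * (color_prob x * color_prob y)"
      unfolding suml sumr mid by (cases "x = []"; cases "y = []") (simp_all add: m_def n_def algebra_simps)
    finally show ?thesis by (simp add: add_nonneg_eq_0_iff)
  qed
qed

lemma sum_word_prob:
  assumes ab: "a \<noteq> b" "a \<in> {1..4}" "b \<in> {1..4}"
  shows "(\<Sum>w\<in>words n. word_prob a w b) = 1"
proof (induction n)
  case 0
  have "words 0 = {[]}" by (auto simp: words_def)
  then show ?case by simp
next
  case (Suc n)
  have "2 * real (Suc n) * (\<Sum>w\<in>words (Suc n). word_prob a w b * 1) =
    (\<Sum>w\<in>words n. word_prob a w b * (\<Sum>i\<le>n. \<Sum>c\<in>avail a i w b. 1))"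
    by (rule word_prob_sum_insert[OF ab(1)])
  also have "\<dots> = (\<Sum>w\<in>words n. word_prob a w b * (2 * real (Suc n)))"
  proof (rule sum.cong[OF refl], goal_cases)
    case (1 w)
    then have lw: "length w = n" by (auto simp: words_def)
    show ?case
    proof (cases "distinct_adj (a # w @ [b])")
      case True
      then show ?thesis using card_avail[OF _ True 1 ab(2,3)] lw by simp
    next
      case False
      then have "w \<noteq> []" using ab by (intro notI) auto
      then have "word_prob a w b = 0" using False by (rule word_prob_eq_0)
      then show ?thesis by simp
    qed
  qed
  also have "\<dots> = 2 * real (Suc n)"
    using Suc by (simp flip: sum_distrib_right)
  finally show ?case by simp
qed

lemma window_prob_bounds:
  assumes ab: "a \<noteq> b" "a \<in> {1..4}" "b \<in> {1..4}"
  shows "0 \<le> window_prob a b j x k \<and> window_prob a b j x k \<le> 1"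
proof
  show "0 \<le> window_prob a b j x k"
    unfolding window_prob_def by (intro sum_nonneg mult_nonneg_nonneg word_prob_nonneg) auto
  have "window_prob a b j x k \<le> (\<Sum>w\<in>words (j + length x + k). word_prob a w b)"
    unfolding window_prob_def by (intro sum_mono) (auto simp: word_prob_nonneg)
  then show "window_prob a b j x k \<le> 1" using sum_word_prob[OF ab] by simp
qed

text \<open>The difference of the two sides satisfies the homogeneous form of \<open>window_prob_rec\<close>, for which
  \<open>1/(j+1) + 1/(k+1)\<close> is a supersolution. At \<open>j = 0\<close> and \<open>k = 0\<close> this function is at least \<open>1\<close>, so the trivial
  bound suffices there, and no recursion at the ends of the interval is needed.\<close>
lemma window_prob_approx:
  assumes ab: "a \<noteq> b" "a \<in> {1..4}" "b \<in> {1..4}" and x: "x \<in> words n"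
  shows "\<bar>window_prob a b j x k - color_prob x\<bar> \<le> 1 / (real j + 1) + 1 / (real k + 1)"
  using x
proof (induction "j + n + k" arbitrary: j n k x rule: less_induct)
  case less
  have lx: "length x = n" using less.prems by (auto simp: words_def)
  have triv: "\<bar>window_prob a b j x k - color_prob x\<bar> \<le> 1"
    using window_prob_bounds[OF ab, of j x k] color_prob_bounds[of x] by (auto simp: abs_le_iff)
  consider "n = 0" | "j = 0" | "k = 0" | "\<not> distinct_adj x"
    | "0 < n" "0 < j" "0 < k" "distinct_adj x" by blast
  then show ?case
  proof cases
    case 1
    then have "x = []" using lx by simp
    then have "window_prob a b j x k = 1" using sum_word_prob[OF ab] by (simp add: window_prob_def window_def)
    then show ?thesis using \<open>x = []\<close> by simp
  next
    case 2
    have "1 \<le> 1 / (real j + 1) + 1 / (real k + 1)" using 2 by simp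
    with triv show ?thesis by linarith
  next
    case 3
    have "1 \<le> 1 / (real j + 1) + 1 / (real k + 1)" using 3 by simp
    with triv show ?thesis by linarith
  next
    case 4
    have "window_prob a b j x k = 0"
      unfolding window_prob_def
    proof (intro sum.neutral ballI, goal_cases)
      case (1 w)
      show ?case
      proof (cases "window j (length x) w = x")
        case True
        have "w = take j w @ window j (length x) w @ drop (length x) (drop j w)"
          by (simp add: window_def del: drop_drop)
        then have "a # w @ [b] = (a # take j w) @ x @ (drop (length x) (drop j w) @ [b])"
          using True by simp
        then have "\<not> distinct_adj (a # w @ [b])"
          using 4 by (auto simp only: distinct_adj_append_iff)
        moreover have "w \<noteq> []" using True 4 by (auto simp: window_def)
        ultimately show ?thesis using word_prob_eq_0 by simp
      qed simp
    qed
    then show ?thesis using 4 by (simp add: color_prob_eq_0)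
  next
    case 5
    define e where "e j x k = window_prob a b j x k - color_prob x" for j x k
    define B where "B j k = 1 / (real j + 1) + 1 / (real k + 1)" for j k
    have e1: "\<bar>e (j - 1) x k\<bar> \<le> B (j - 1) k" and e2: "\<bar>e j x (k - 1)\<bar> \<le> B j (k - 1)"
      unfolding e_def B_def
      using less.hyps[of "j - 1" n k x] less.hyps[of j n "k - 1" x] less.prems 5 by (auto simp: of_nat_diff)
    have e3: "\<bar>e j (delete_at p x) k\<bar> \<le> B j k" if "p < n" for p
      unfolding e_def B_def
    proof (rule less.hyps[of j "n - 1" k])
      show "delete_at p x \<in> words (n - 1)"
        using that less.prems set_delete_at[of p x] lx by (auto simp: words_def)
    qed (use 5 in auto)
    have "2 * real (j + n + k) * e j x k = (2 * real j - 1) * e (j - 1) x k + (2 * real k - 1) * e j x (k - 1)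
        + (\<Sum>p<n. e j (delete_at p x) k)"
      using window_prob_rec[OF 5(4) less.prems 5(1-3) ab] color_prob_rec[of x] 5 lx
      by (auto simp: e_def algebra_simps sum_subtractf)
    then have "2 * real (j + n + k) * \<bar>e j x k\<bar> = \<bar>(2 * real j - 1) * e (j - 1) x k + (2 * real k - 1) * e j x (k - 1)
        + (\<Sum>p<n. e j (delete_at p x) k)\<bar>"
      by (metis abs_mult abs_of_nonneg of_nat_0_le_iff mult_nonneg_nonneg zero_le_numeral)
    also have "\<dots> \<le> \<bar>(2 * real j - 1) * e (j - 1) x k\<bar> + \<bar>(2 * real k - 1) * e j x (k - 1)\<bar> + \<bar>\<Sum>p<n. e j (delete_at p x) k\<bar>"
      by linarith
    also have "\<bar>(2 * real j - 1) * e (j - 1) x k\<bar> \<le> (2 * real j - 1) * B (j - 1) k"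
      using e1 5 by (simp add: abs_mult mult_left_mono)
    also have "\<bar>(2 * real k - 1) * e j x (k - 1)\<bar> \<le> (2 * real k - 1) * B j (k - 1)"
      using e2 5 by (simp add: abs_mult mult_left_mono)
    also have "\<bar>\<Sum>p<n. e j (delete_at p x) k\<bar> \<le> (\<Sum>p<n. B j k)"
      using e3 by (intro order_trans[OF sum_abs] sum_mono) auto
    finally have "2 * real (j + n + k) * \<bar>e j x k\<bar> \<le>
        (2 * real j - 1) * B (j - 1) k + (2 * real k - 1) * B j (k - 1) + real n * B j k"
      by simp
    also have "\<dots> \<le> 2 * real (j + n + k) * B j k"
    proof -
        \<comment> \<open>The contribution of each side is treated separately, with \<open>u\<close> the distance to that side.\<close>
    have a: "(2 * u - 1) / u + (2 * v - 1) / (u + 1) + w / (u + 1) \<le> 2 * (u + w + v) / (u + 1)"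
        if "1 \<le> u" "0 \<le> w" for u v w :: real
      proof -
        have "(2 * u - 1) / u \<le> (2 * u + 1) / (u + 1)" using that by (simp add: field_simps)
        then have "(2 * u - 1) / u + (2 * v - 1) / (u + 1) + w / (u + 1) \<le> (2 * u + 1 + (2 * v - 1) + w) / (u + 1)"
          by (simp only: add_divide_distrib)
        also have "\<dots> \<le> 2 * (u + w + v) / (u + 1)" using that by (intro divide_right_mono) auto
        finally show ?thesis .
      qed
      show ?thesis
        using a[of "real j" "real n" "real k"] a[of "real k" "real n" "real j"] 5
        by (simp add: B_def of_nat_diff algebra_simps add_divide_distrib diff_divide_distrib)
    qed
    finally have "\<bar>e j x k\<bar> \<le> B j k" using 5 by simp
    then show ?thesis by (simp add: e_def B_def)
  qed
qed

section \<open>Random marks\<close>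

text \<open>A mark is a sequence of independent uniform numbers, of which only the entries \<open>0\<close> (the arrival time)
  and \<open>1\<close> (which gives the coin) are used. The space of marks includes sequences
  with negative entries; they form a null set.\<close>
abbreviation unif :: "real measure" where
  "unif \<equiv> uniform_measure lborel {0..1}"

definition mark :: "(nat \<Rightarrow> real) measure" where
  "mark = PiM UNIV (\<lambda>_. unif)"

text \<open>The probability space on which everything takes place: independent marks at all integers.\<close>
abbreviation S :: "(int \<Rightarrow> nat \<Rightarrow> real) measure" where
  "S \<equiv> seq_space mark"

lemma prob_space_unif: "prob_space unif"
  by (rule prob_space_uniform_measure) auto

lemma prob_space_mark: "prob_space mark"
  unfolding mark_def by (intro prob_space_PiM prob_space_unif)

lemma prob_space_S: "prob_space S"
  by (intro prob_space_PiM prob_space_mark)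

interpretation U: prob_space unif by (rule prob_space_unif)
interpretation N: prob_space mark by (rule prob_space_mark)
interpretation S: prob_space S by (rule prob_space_S)

lemma space_mark [simp]: "space mark = UNIV"
  by (simp add: mark_def space_PiM)

lemma space_S [simp]: "space S = UNIV"
  by (simp add: space_PiM)

text \<open>One coordinate may be redrawn independently of all the others.\<close>
lemma nn_integral_resample:
  fixes Q :: "'a measure" and m :: 'i
  assumes Q: "prob_space Q" and f [measurable]: "f \<in> borel_measurable (PiM UNIV (\<lambda>_. Q))"
  shows "(\<integral>\<^sup>+\<omega>. f \<omega> \<partial>PiM UNIV (\<lambda>_. Q)) = (\<integral>\<^sup>+y. \<integral>\<^sup>+\<omega>. f (fun_upd \<omega> m y) \<partial>PiM UNIV (\<lambda>_. Q) \<partial>Q)"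
proof -
  interpret P: prob_space "PiM (UNIV :: 'i set) (\<lambda>_. Q)" by (intro prob_space_PiM Q)
  have "PiM UNIV (\<lambda>_. Q) = distr (Q \<Otimes>\<^sub>M PiM UNIV (\<lambda>_. Q)) (PiM UNIV (\<lambda>_. Q)) (\<lambda>(y, \<omega>). fun_upd \<omega> m y)"
    using distr_pair_PiM_eq_PiM[of UNIV "\<lambda>_. Q" m] Q by simp
  then have "(\<integral>\<^sup>+\<omega>. f \<omega> \<partial>PiM UNIV (\<lambda>_. Q)) =
      (\<integral>\<^sup>+\<omega>. f \<omega> \<partial>distr (Q \<Otimes>\<^sub>M PiM UNIV (\<lambda>_. Q)) (PiM UNIV (\<lambda>_. Q)) (\<lambda>(y, \<omega>). fun_upd \<omega> m y))"
    by simp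
  also have "\<dots> = (\<integral>\<^sup>+(y, \<omega>). f (fun_upd \<omega> m y) \<partial>(Q \<Otimes>\<^sub>M PiM UNIV (\<lambda>_. Q)))"
  proof (subst nn_integral_distr)
    show "(\<lambda>(y, \<omega>). fun_upd \<omega> m y) \<in> Q \<Otimes>\<^sub>M PiM UNIV (\<lambda>_. Q) \<rightarrow>\<^sub>M PiM UNIV (\<lambda>_. Q)"
      unfolding case_prod_beta by (rule measurable_fun_upd[where J = UNIV]) auto
  qed (auto simp: case_prod_beta')
  also have "\<dots> = (\<integral>\<^sup>+y. \<integral>\<^sup>+\<omega>. f (fun_upd \<omega> m y) \<partial>PiM UNIV (\<lambda>_. Q) \<partial>Q)"
  proof (subst P.nn_integral_fst[symmetric])
    have "(\<lambda>z. fun_upd (snd z) m (fst z)) \<in> Q \<Otimes>\<^sub>M PiM UNIV (\<lambda>_. Q) \<rightarrow>\<^sub>M PiM UNIV (\<lambda>_. Q)"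
      by (rule measurable_fun_upd[where J = UNIV]) auto
    from measurable_compose[OF this f]
    show "(\<lambda>(y, \<omega>). f (fun_upd \<omega> m y)) \<in> borel_measurable (Q \<Otimes>\<^sub>M PiM UNIV (\<lambda>_. Q))"
      by (simp add: case_prod_beta)
  qed simp
  finally show ?thesis .
qed

lemma measurable_mark_component [measurable]: "(\<lambda>y. y k) \<in> borel_measurable mark"
proof -
  have "(\<lambda>y. y k) \<in> mark \<rightarrow>\<^sub>M unif"
    unfolding mark_def by (rule measurable_component_singleton) simp
  then show ?thesis by (simp cong: measurable_cong_sets)
qed

lemma measurable_S_component [measurable]: "(\<lambda>\<omega>. \<omega> i k) \<in> borel_measurable S"
  by (rule measurable_compose[OF measurable_component_singleton[of i UNIV "\<lambda>_. mark"]]) auto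

lemma measurable_S_coord: "(\<lambda>\<omega>. \<omega> i) \<in> S \<rightarrow>\<^sub>M mark"
  by (rule measurable_component_singleton) simp

lemma measurable_S_upd: "(\<lambda>\<omega>. fun_upd \<omega> m y) \<in> S \<rightarrow>\<^sub>M S"
  by (rule measurable_fun_upd[where J = UNIV]) auto

lemma emeasure_resample:
  assumes A: "A \<in> sets S"
  shows "emeasure S A = (\<integral>\<^sup>+y. emeasure S {\<omega>. fun_upd \<omega> m y \<in> A} \<partial>mark)"
proof -
  have "emeasure S A = (\<integral>\<^sup>+\<omega>. indicator A \<omega> \<partial>S)"
    using A by simp
  also have "\<dots> = (\<integral>\<^sup>+y. \<integral>\<^sup>+\<omega>. indicator A (fun_upd \<omega> m y) \<partial>S \<partial>mark)"
    using A by (intro nn_integral_resample prob_space_mark) auto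
  also have "\<dots> = (\<integral>\<^sup>+y. emeasure S {\<omega>. fun_upd \<omega> m y \<in> A} \<partial>mark)"
  proof (intro nn_integral_cong)
    fix y
    have "{\<omega>. fun_upd \<omega> m y \<in> A} \<in> sets S"
      using measurable_sets[OF measurable_S_upd A, of m y] by (simp add: vimage_def)
    then have "(\<integral>\<^sup>+\<omega>. indicator {\<omega>. fun_upd \<omega> m y \<in> A} \<omega> \<partial>S) = emeasure S {\<omega>. fun_upd \<omega> m y \<in> A}"
      by simp
    then show "(\<integral>\<^sup>+\<omega>. indicator A (fun_upd \<omega> m y) \<partial>S) = emeasure S {\<omega>. fun_upd \<omega> m y \<in> A}"
      by (simp add: indicator_def)
  qed
  finally show ?thesis .
qed

definition coin :: "(nat \<Rightarrow> real) \<Rightarrow> bool" where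
  "coin y \<longleftrightarrow> y 1 \<le> 1/2"

lemma measurable_coin [measurable]: "Measurable.pred mark coin"
  unfolding coin_def by measurable

lemma sets_coin [measurable]: "{y. coin y = v} \<in> sets mark"
proof -
  have "{y \<in> space mark. coin y = v} \<in> sets mark" by measurable
  then show ?thesis by simp
qed

lemma unif_coin: "emeasure unif {x. (x \<le> 1/2) = v} = 1/2"
proof -
  have "{0..1} \<inter> {x. (x \<le> 1/2) = v} = (if v then {0..1/2} else {1/2<..1::real})"
    by auto
  then show ?thesis
    by (subst emeasure_uniform_measure) (auto simp: divide_ennreal[of 1 2, simplified] divide_ennreal_def)
qed

lemma nn_integral_mark:
  assumes f [measurable]: "f \<in> borel_measurable borel"
  shows "(\<integral>\<^sup>+y. f (y 0) * indicator {y. coin y = v} y \<partial>mark) = (\<integral>\<^sup>+x. f x \<partial>unif) / 2"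
proof -
  have "(\<integral>\<^sup>+y. f (y 0) * indicator {y. coin y = v} y \<partial>mark) =
    (\<integral>\<^sup>+x. \<integral>\<^sup>+y. f x * indicator {y. coin y = v} y \<partial>mark \<partial>unif)"
    unfolding mark_def
    by (subst nn_integral_resample[where m = 0, OF prob_space_unif])
       (auto simp: coin_def indicator_def simp flip: mark_def)
  also have "(\<lambda>x. \<integral>\<^sup>+y. f x * indicator {y. coin y = v} y \<partial>mark) = (\<lambda>x. f x * (1/2))"
  proof
    fix x
    have "(\<integral>\<^sup>+y. f x * indicator {y. coin y = v} y \<partial>mark) = f x * emeasure mark {y. coin y = v}"
      by (subst nn_integral_cmult_indicator) auto
    also have "emeasure mark {y. coin y = v} = emeasure (distr mark unif (\<lambda>y. y 1)) {x. (x \<le> 1/2) = v}"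
      by (subst emeasure_distr) (auto simp: coin_def vimage_def cong: measurable_cong_sets)
    also have "distr mark unif (\<lambda>y. y 1) = unif"
      unfolding mark_def by (rule distr_PiM_component) (auto intro: prob_space_unif)
    finally show "(\<integral>\<^sup>+y. f x * indicator {y. coin y = v} y \<partial>mark) = f x * (1/2)"
      unfolding unif_coin .
  qed
  also have "(\<integral>\<^sup>+x. f x * (1/2) \<partial>unif) = (\<integral>\<^sup>+x. f x \<partial>unif) / 2"
  proof (subst nn_integral_multc)
    show "f \<in> borel_measurable unif" using f by (simp cong: measurable_cong_sets)
  qed (auto simp: divide_ennreal_def)
  finally show ?thesis .
qed

lemma indep_coords: "S.indep_vars (\<lambda>_. mark) (\<lambda>i \<omega>. \<omega> i) UNIV"
proof (subst S.indep_vars_iff_distr_eq_PiM)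
  show "distr S (PiM UNIV (\<lambda>_. mark)) (\<lambda>x. \<lambda>i\<in>UNIV. x i) = PiM UNIV (\<lambda>i. distr S mark (\<lambda>\<omega>. \<omega> i))"
    using distr_PiM_component[of "UNIV :: int set" "\<lambda>_. mark"] by (simp add: prob_space_mark distr_id2 restrict_def)
qed (auto intro: measurable_S_coord)

text \<open>Membership in \<open>A\<close> is decided by the coordinates in \<open>I\<close>.\<close>
definition dep_on :: "'i set \<Rightarrow> ('i \<Rightarrow> 'a) set \<Rightarrow> bool" where
  "dep_on I A \<longleftrightarrow> (\<forall>\<omega> \<omega>'. (\<forall>i\<in>I. \<omega> i = \<omega>' i) \<longrightarrow> (\<omega> \<in> A \<longleftrightarrow> \<omega>' \<in> A))"

lemma dep_on_preimage:
  assumes A: "A \<in> sets S" "dep_on I A"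
  obtains A' where "A' \<in> sets (PiM I (\<lambda>_. mark))" "A = {\<omega>. restrict \<omega> I \<in> A'}"
proof
  define ext where "ext x = (\<lambda>i. if i \<in> I then x i else (\<lambda>_. 0))" for x :: "int \<Rightarrow> nat \<Rightarrow> real"
  have m: "ext \<in> PiM I (\<lambda>_. mark) \<rightarrow>\<^sub>M S"
  proof (unfold ext_def, rule measurable_PiM_single')
    fix i
    show "(\<lambda>\<omega>. if i \<in> I then \<omega> i else (\<lambda>_. 0)) \<in> Pi\<^sub>M I (\<lambda>_. mark) \<rightarrow>\<^sub>M mark"
      by (cases "i \<in> I") auto
  qed (auto simp: space_PiM)
  show "ext -` A \<inter> space (PiM I (\<lambda>_. mark)) \<in> sets (PiM I (\<lambda>_. mark))"
    using m A(1) by (rule measurable_sets)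
  show "A = {\<omega>. restrict \<omega> I \<in> ext -` A \<inter> space (PiM I (\<lambda>_. mark))}"
  proof -
    have "\<omega> \<in> A \<longleftrightarrow> ext (restrict \<omega> I) \<in> A" for \<omega>
      using A(2) unfolding dep_on_def by (auto simp: ext_def)
    then show ?thesis by (auto simp: space_PiM)
  qed
qed

lemma indep_dep_on:
  assumes A: "A \<in> sets S" "dep_on I A" and B: "B \<in> sets S" "dep_on J B" and IJ: "I \<inter> J = {}"
  shows "measure S (A \<inter> B) = measure S A * measure S B"
proof -
  obtain A' where A': "A' \<in> sets (PiM I (\<lambda>_. mark))" "A = {\<omega>. restrict \<omega> I \<in> A'}"
    using dep_on_preimage[OF A] .
  obtain B' where B': "B' \<in> sets (PiM J (\<lambda>_. mark))" "B = {\<omega>. restrict \<omega> J \<in> B'}"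
    using dep_on_preimage[OF B] .
  have "S.indep_var (PiM I (\<lambda>_. mark)) (\<lambda>\<omega>. restrict (\<lambda>i. \<omega> i) I) (PiM J (\<lambda>_. mark)) (\<lambda>\<omega>. restrict (\<lambda>i. \<omega> i) J)"
    using S.indep_var_restrict[OF indep_coords IJ] by simp
  from S.indep_varD[OF this A'(1) B'(1)] show ?thesis
    by (simp add: A'(2) B'(2) vimage_def Int_def)
qed

lemma distr_S_reindex:
  assumes "inj f"
  shows "distr S S (\<lambda>\<omega> i. \<omega> (f i)) = S"
  using distr_PiM_reindex[of UNIV "\<lambda>_. mark" f UNIV] assms by (simp add: prob_space_mark restrict_def)

lemma measurable_S_reindex: "(\<lambda>\<omega> i. \<omega> (f i)) \<in> S \<rightarrow>\<^sub>M S"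
  by (rule measurable_PiM_single') (auto simp: space_PiM)

lemma measure_S_reindex:
  assumes "inj f" "A \<in> sets S"
  shows "measure S {\<omega>. (\<lambda>i. \<omega> (f i)) \<in> A} = measure S A"
proof -
  have "measure S A = measure (distr S S (\<lambda>\<omega> i. \<omega> (f i))) A"
    using distr_S_reindex[OF assms(1)] by simp
  also have "\<dots> = measure S {\<omega>. (\<lambda>i. \<omega> (f i)) \<in> A}"
    using assms(2) by (subst measure_distr) (auto simp: vimage_def measurable_S_reindex)
  finally show ?thesis ..
qed

text \<open>The form in which resampling is used below: given the arrival time and the coin at \<open>m\<close>, the
  conditional probability of \<open>A\<close> is \<open>f\<close> of the arrival time for one value of the coin and zero for the other.\<close>
lemma emeasure_slice:
  assumes f [measurable]: "f \<in> borel_measurable borel" and A: "A \<in> sets S"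
    and h: "\<And>y. coin y = v \<Longrightarrow> y 0 \<in> {0..1} \<Longrightarrow> emeasure S {\<omega>. fun_upd \<omega> m y \<in> A} = f (y 0)"
    and h': "\<And>y. coin y \<noteq> v \<Longrightarrow> emeasure S {\<omega>. fun_upd \<omega> m y \<in> A} = 0"
  shows "emeasure S A = (\<integral>\<^sup>+x. f x \<partial>unif) / 2"
proof -
  have "AE x in unif. x \<in> {0..1::real}"
    by (intro AE_uniform_measureI) auto
  then have "AE y in mark. y 0 \<in> {0..1::real}"
    unfolding mark_def by (intro AE_PiM_component prob_space_unif) auto
  then have "emeasure S A = (\<integral>\<^sup>+y. f (y 0) * indicator {y. coin y = v} y \<partial>mark)"
    unfolding emeasure_resample[OF A, of m]
    by (intro nn_integral_cong_AE, elim eventually_mono) (auto simp: indicator_def h h')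
  then show ?thesis by (simp add: nn_integral_mark)
qed

section \<open>Coloring an interval in the order of arrival\<close>

text \<open>The earliest site strictly between \<open>l\<close> and \<open>r\<close>; ties, which have probability zero, are resolved in favor of
  the leftmost.\<close>
definition first_arrival :: "(int \<Rightarrow> nat \<Rightarrow> real) \<Rightarrow> int \<Rightarrow> int \<Rightarrow> int" where
  "first_arrival y l r = Min {m \<in> {l<..<r}. \<forall>j\<in>{l<..<r}. y m 0 \<le> y j 0}"

lemma first_arrival_props:
  assumes "l < i" "i < r"
  shows "l < first_arrival y l r" "first_arrival y l r < r" "\<forall>j\<in>{l<..<r}. y (first_arrival y l r) 0 \<le> y j 0"
    "\<forall>j\<in>{l<..<first_arrival y l r}. y (first_arrival y l r) 0 < y j 0"
proof -
  let ?A = "{m \<in> {l<..<r}. \<forall>j\<in>{l<..<r}. y m 0 \<le> y j 0}"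
  define v where "v = Min ((\<lambda>j. y j 0) ` {l<..<r})"
  have ne: "(\<lambda>j. y j 0) ` {l<..<r} \<noteq> {}" using assms by auto
  have "v \<in> (\<lambda>j. y j 0) ` {l<..<r}" unfolding v_def by (rule Min_in) (use ne in auto)
  then obtain m where m: "m \<in> {l<..<r}" "y m 0 = v" by auto
  have "y m 0 \<le> y j 0" if "j \<in> {l<..<r}" for j
    unfolding m(2) v_def using that by (intro Min_le) auto
  then have nonempty: "?A \<noteq> {}" using m by auto
  have fin: "finite ?A" by (rule finite_subset[of _ "{l<..<r}"]) auto
  have A: "first_arrival y l r \<in> ?A" unfolding first_arrival_def using Min_in[OF fin nonempty] .
  then show 1: "l < first_arrival y l r" "first_arrival y l r < r" "\<forall>j\<in>{l<..<r}. y (first_arrival y l r) 0 \<le> y j 0"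
    by auto
  show "\<forall>j\<in>{l<..<first_arrival y l r}. y (first_arrival y l r) 0 < y j 0"
  proof (intro ballI, rule ccontr)
    fix j assume j: "j \<in> {l<..<first_arrival y l r}"
    assume "\<not> y (first_arrival y l r) 0 < y j 0"
    then have "j \<in> ?A" using j 1 A by force
    then have "first_arrival y l r \<le> j" unfolding first_arrival_def using fin by (intro Min_le)
    then show False using j by simp
  qed
qed

lemma first_arrival_eq_iff:
  assumes "l < m" "m < r"
  shows "first_arrival y l r = m \<longleftrightarrow> (\<forall>j\<in>{l<..<m}. y m 0 < y j 0) \<and> (\<forall>j\<in>{m<..<r}. y m 0 \<le> y j 0)"
proof
  assume "first_arrival y l r = m"
  then show "(\<forall>j\<in>{l<..<m}. y m 0 < y j 0) \<and> (\<forall>j\<in>{m<..<r}. y m 0 \<le> y j 0)"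
    using first_arrival_props[OF assms, of y] assms by auto
next
  assume h: "(\<forall>j\<in>{l<..<m}. y m 0 < y j 0) \<and> (\<forall>j\<in>{m<..<r}. y m 0 \<le> y j 0)"
  let ?m = "first_arrival y l r"
  note p = first_arrival_props[OF assms, of y]
  show "?m = m"
  proof (rule linorder_cases[of ?m m])
    assume "?m < m"
    then have "y m 0 < y ?m 0" using h p by auto
    then show ?thesis using p(3)[rule_format, of m] assms by simp
  next
    assume "m < ?m"
    then have "y m 0 \<le> y ?m 0" using h p by auto
    then show ?thesis using p(4)[rule_format, of m] assms \<open>m < ?m\<close> by simp
  qed simp
qed

text \<open>The color of a new site between neighbors of colors \<open>a\<close> and \<open>b\<close>: the smaller or the larger of the
  two remaining colors.\<close>
definition pick :: "bool \<Rightarrow> nat \<Rightarrow> nat \<Rightarrow> nat" where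
  "pick v a b = (if v then Min ({1..4} - {a, b}) else Max ({1..4} - {a, b}))"

lemma colors4: "{1..4::nat} = {1, 2, 3, 4}"
  by auto

lemma pick_in: "pick v a b \<in> {1..4} - {a, b}"
proof -
  have "card {1..4::nat} \<le> card {a, b}" if "{1..4} \<subseteq> {a, b}"
    using that by (intro card_mono) auto
  moreover have "card {a, b} \<le> 2" by (simp add: card_insert_le_m1)
  ultimately have "{1..4} - {a, b} \<noteq> {}" by auto
  then show ?thesis unfolding pick_def
    using Min_in[of "{1..4} - {a, b}"] Max_in[of "{1..4} - {a, b}"] by auto
qed

lemma pick_unique:
  assumes "a \<noteq> b" "a \<in> {1..4}" "b \<in> {1..4}" "c \<in> {1..4}" "c \<noteq> a" "c \<noteq> b"
  obtains v where "\<And>u. pick u a b = c \<longleftrightarrow> u = v"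
proof -
  let ?R = "{1..4} - {a, b}"
  have "card ?R = 2" using assms by (subst card_Diff_subset) auto
  then obtain p q where pq: "?R = {p, q}" "p \<noteq> q" by (meson card_2_iff)
  have "c \<in> ?R" using assms by auto
  then have "c = p \<or> c = q" unfolding pq by simp
  then have "pick u a b = c \<longleftrightarrow> u = (c = min p q)" for u
    using pq(2) unfolding pick_def pq by (cases u; cases "p \<le> q") (auto simp: min_def max_def)
  then show ?thesis by (rule that)
qed

text \<open>The coloring of the sites in \<open>(l, r)\<close> that starts with colors \<open>a\<close> at \<open>l\<close> and \<open>b\<close> at \<open>r\<close>, regardless
  of the arrival times of \<open>l\<close> and \<open>r\<close>. It is extended by the constants \<open>a\<close> and \<open>b\<close> outside.\<close>
function col :: "(int \<Rightarrow> nat \<Rightarrow> real) \<Rightarrow> int \<Rightarrow> int \<Rightarrow> nat \<Rightarrow> nat \<Rightarrow> int \<Rightarrow> nat" where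
  "col y l r a b i = (if i \<le> l then a else if r \<le> i then b else
     let m = first_arrival y l r; c = pick (coin (y m)) a b in
       if i = m then c else if i < m then col y l m a c i else col y m r c b i)"
  by pat_completeness auto
termination
proof (relation "Wellfounded.measure (\<lambda>(y, l, r, a, b, i). nat (r - l))", goal_cases)
  case (2 y l r a b i x xa)
  then show ?case using first_arrival_props[of l i r y] by auto
next
  case (3 y l r a b i x xa)
  then show ?case using first_arrival_props[of l i r y] by auto
qed auto

declare col.simps [simp del]

lemma col_left [simp]: "i \<le> l \<Longrightarrow> col y l r a b i = a"
  by (simp add: col.simps)

lemma col_right [simp]: "l < r \<Longrightarrow> r \<le> i \<Longrightarrow> col y l r a b i = b"
  by (simp add: col.simps)

lemma col_rec:
  assumes "l < m" "m < r" "first_arrival y l r = m" "c = pick (coin (y m)) a b"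
  shows "col y l r a b i = (if i \<le> m then col y l m a c i else col y m r c b i)"
proof -
  consider "i \<le> l" | "l < i" "i < r" | "r \<le> i" by linarith
  then show ?thesis
  proof cases
    case 2
    then show ?thesis using assms by (subst col.simps) (auto simp: Let_def)
  qed (use assms in auto)
qed

lemma col_in:
  assumes "a \<in> {1..4}" "b \<in> {1..4}"
  shows "col y l r a b i \<in> {1..4}"
  using assms
proof (induction y l r a b i rule: col.induct)
  case (1 y l r a b i)
  consider "i \<le> l" | "l < i" "i < r" | "r \<le> i" by linarith
  then show ?case
  proof cases
    case 2
    then show ?thesis using 1 pick_in[of "coin (y (first_arrival y l r))" a b]
      by (subst col.simps) (auto simp: Let_def)
  qed (use 1 in \<open>auto simp: col.simps\<close>)
qed

lemma col_cong:
  assumes "\<And>j. l < j \<Longrightarrow> j < r \<Longrightarrow> y j = y' j"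
  shows "col y l r a b i = col y' l r a b i"
  using assms
proof (induction y l r a b i rule: col.induct)
  case (1 y l r a b i)
  consider "i \<le> l" | "l < i" "i < r" | "r \<le> i" by linarith
  then show ?case
  proof cases
    case 2
    define m where "m = first_arrival y l r"
    have m: "l < m" "m < r" using first_arrival_props[OF 2] by (auto simp: m_def)
    have "first_arrival y' l r = m"
      using first_arrival_eq_iff[OF m, of y] first_arrival_eq_iff[OF m, of y'] 1(3) m by (auto simp: m_def)
    then show ?thesis
      using 1(1)[OF _ _ m_def refl] 1(2)[OF _ _ m_def refl] 1(3) m 2
      by (subst (1 2) col.simps) (auto simp: Let_def m_def[symmetric])
  qed (auto simp: col.simps)
qed

lemma first_arrival_shift:
  assumes "l < i" "i < r"
  shows "first_arrival (shift n y) l r = first_arrival y (l + n) (r + n) - n"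
proof -
  let ?m = "first_arrival y (l + n) (r + n)"
  have p: "l + n < ?m" "?m < r + n" using first_arrival_props[of "l + n" "i + n" "r + n" y] assms by auto
  have q: "l < ?m - n" "?m - n < r" using p by auto
  show ?thesis
    unfolding first_arrival_eq_iff[OF q]
    using iffD1[OF first_arrival_eq_iff[OF p] refl] by (auto simp: shift_def)
qed

lemma col_shift: "col (shift n y) l r a b i = col y (l + n) (r + n) a b (i + n)"
proof (induction "shift n y" l r a b i rule: col.induct)
  case (1 l r a b i)
  consider "i \<le> l" | "l < i" "i < r" | "r \<le> i" by linarith
  then show ?case
  proof cases
    case 2
    define m where "m = first_arrival (shift n y) l r"
    have m': "first_arrival y (l + n) (r + n) = m + n"
      using first_arrival_shift[OF 2, of n y] by (simp add: m_def)
    have "shift n y m = y (m + n)" by (simp add: shift_def)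
    then show ?thesis
      using 1(1)[OF _ _ m_def refl] 1(2)[OF _ _ m_def refl] 2
      by (subst (1 2) col.simps) (auto simp: Let_def m_def[symmetric] m')
  qed (auto simp: col.simps)
qed

text \<open>An interval whose interior arrives after both of its ends is colored by itself, and its ends
  have different colors because they are neighbors when its first interior site arrives.\<close>
lemma col_frame:
  assumes "l \<le> l'" "l' < r'" "r' \<le> r"
    and "\<And>j. l' < j \<Longrightarrow> j < r' \<Longrightarrow> y l' 0 < y j 0 \<and> y r' 0 < y j 0"
  shows "l' \<le> i \<Longrightarrow> i \<le> r' \<Longrightarrow> col y l r a b i = col y l' r' (col y l r a b l') (col y l r a b r') i"
    and "a \<noteq> b \<Longrightarrow> col y l r a b l' \<noteq> col y l r a b r'"
proof -
  have "(\<forall>i\<in>{l'..r'}. col y l r a b i = col y l' r' (col y l r a b l') (col y l r a b r') i) \<and>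
     (a \<noteq> b \<longrightarrow> col y l r a b l' \<noteq> col y l r a b r')"
    using assms(1,3)
  proof (induction "nat (r - l)" arbitrary: l r a b rule: less_induct)
    case less
    show ?case
    proof (cases "l = l' \<and> r = r'")
      case True
      then show ?thesis using assms by simp
    next
      case False
      have "\<exists>i. l < i \<and> i < r"
        using less.prems assms(2) False by (cases "l = l'") (auto intro: exI[of _ l'] exI[of _ r'])
      then obtain j0 where j0: "l < j0" "j0 < r" by auto
      define m where "m = first_arrival y l r"
      define c where "c = pick (coin (y m)) a b"
      note p = first_arrival_props[OF j0, of y, folded m_def]
      have c: "a \<noteq> c" "c \<noteq> b" using pick_in[of "coin (y m)" a b] by (auto simp: c_def)
      have "m \<le> l' \<or> r' \<le> m"
      proof (rule ccontr)
        assume "\<not> (m \<le> l' \<or> r' \<le> m)"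
        then have "y l' 0 < y m 0 \<and> y r' 0 < y m 0" using assms(4) by auto
        moreover have "y m 0 \<le> y l' 0 \<or> y m 0 \<le> y r' 0"
          using p(3)[rule_format, of l'] p(3)[rule_format, of r'] False less.prems assms(2) by auto
        ultimately show False by auto
      qed
      then show ?thesis
      proof
        assume m: "m \<le> l'"
        have *: "col y l r a b k = col y m r c b k" if "l' \<le> k" for k
          using col_rec[OF p(1,2) m_def[symmetric] c_def] p that m by (cases "k = m") auto
        have ih: "(\<forall>i\<in>{l'..r'}. col y m r c b i = col y l' r' (col y m r c b l') (col y m r c b r') i) \<and>
            (c \<noteq> b \<longrightarrow> col y m r c b l' \<noteq> col y m r c b r')"
          by (rule less.hyps) (use p m less.prems assms(2) in auto)
        have ends: "col y l r a b l' = col y m r c b l'" "col y l r a b r' = col y m r c b r'"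
          using * assms(2) by auto
        show ?thesis
        proof (intro conjI ballI impI)
          fix i assume i: "i \<in> {l'..r'}"
          then have "col y l r a b i = col y m r c b i" using * by auto
          then show "col y l r a b i = col y l' r' (col y l r a b l') (col y l r a b r') i"
            unfolding ends using bspec[OF conjunct1[OF ih] i] by (rule trans)
        next
          show "col y l r a b l' \<noteq> col y l r a b r'" unfolding ends using ih c by blast
        qed
      next
        assume m: "r' \<le> m"
        have *: "col y l r a b k = col y l m a c k" if "k \<le> r'" for k
          using col_rec[OF p(1,2) m_def[symmetric] c_def, of k] p that m by auto
        have ih: "(\<forall>i\<in>{l'..r'}. col y l m a c i = col y l' r' (col y l m a c l') (col y l m a c r') i) \<and>
            (a \<noteq> c \<longrightarrow> col y l m a c l' \<noteq> col y l m a c r')"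
          by (rule less.hyps) (use p m less.prems assms(2) in auto)
        have ends: "col y l r a b l' = col y l m a c l'" "col y l r a b r' = col y l m a c r'"
          using * assms(2) by auto
        show ?thesis
        proof (intro conjI ballI impI)
          fix i assume i: "i \<in> {l'..r'}"
          then have "col y l r a b i = col y l m a c i" using * by auto
          then show "col y l r a b i = col y l' r' (col y l r a b l') (col y l r a b r') i"
            unfolding ends using bspec[OF conjunct1[OF ih] i] by (rule trans)
        next
          show "col y l r a b l' \<noteq> col y l r a b r'" unfolding ends using ih c by blast
        qed
      qed
    qed
  qed
  note main = this
  show "l' \<le> i \<Longrightarrow> i \<le> r' \<Longrightarrow> col y l r a b i = col y l' r' (col y l r a b l') (col y l r a b r') i"
    by (rule bspec[OF conjunct1[OF main]]) simp
  show "a \<noteq> b \<Longrightarrow> col y l r a b l' \<noteq> col y l r a b r'"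
    by (rule mp[OF conjunct2[OF main]])
qed

lemma col_proper:
  assumes "a \<noteq> b" "l \<le> i" "i < r"
  shows "col y l r a b i \<noteq> col y l r a b (i + 1)"
  using assms
proof (induction "nat (r - l)" arbitrary: l r a b rule: less_induct)
  case less
  show ?case
  proof (cases "r = l + 1")
    case True
    then show ?thesis using less.prems by auto
  next
    case False
    then have j0: "l < l + 1" "l + 1 < r" using less.prems by auto
    define m where "m = first_arrival y l r"
    define c where "c = pick (coin (y m)) a b"
    note p = first_arrival_props[OF j0, of y, folded m_def]
    note rec = col_rec[OF p(1,2) m_def[symmetric] c_def]
    have c: "a \<noteq> c" "c \<noteq> b" using pick_in[of "coin (y m)" a b] by (auto simp: c_def)
    show ?thesis
    proof (cases "i < m")
      case True
      then show ?thesis using less.hyps[of m l a c] c p less.prems rec[of i] rec[of "i + 1"] by auto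
    next
      case False
      have "col y l r a b i = col y m r c b i" using rec[of i] p False by (cases "i = m") auto
      then show ?thesis using less.hyps[of r m c b] c p less.prems rec[of "i + 1"] False by auto
    qed
  qed
qed

lemma measurable_first_arrival [measurable]: "(\<lambda>\<omega>. first_arrival \<omega> l r) \<in> S \<rightarrow>\<^sub>M count_space UNIV"
proof (cases "\<exists>i. l < i \<and> i < r")
  case False
  then have "{l<..<r} = {}" by auto
  then show ?thesis by (simp add: first_arrival_def)
next
  case True
  then obtain i where i: "l < i" "i < r" by auto
  show ?thesis
  proof (subst measurable_count_space_eq2_countable, intro conjI ballI)
    fix m :: int
    show "(\<lambda>\<omega>. first_arrival \<omega> l r) -` {m} \<inter> space S \<in> sets S"
    proof (cases "l < m \<and> m < r")
      case True
      then have "(\<lambda>\<omega>. first_arrival \<omega> l r) -` {m} \<inter> space S =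
        {\<omega>\<in>space S. (\<forall>j\<in>{l<..<m}. \<omega> m 0 < \<omega> j 0) \<and> (\<forall>j\<in>{m<..<r}. \<not> \<omega> j 0 < \<omega> m 0)}"
        using first_arrival_eq_iff[of l m r] by (auto simp: not_less)
      also have "\<dots> \<in> sets S" by measurable
      finally show ?thesis .
    next
      case False
      then have "(\<lambda>\<omega>. first_arrival \<omega> l r) -` {m} \<inter> space S = {}"
        using first_arrival_props(1,2)[OF i] by blast
      then show ?thesis by simp
    qed
  qed auto
qed

lemma measurable_coin_S [measurable]: "Measurable.pred S (\<lambda>\<omega>. coin (\<omega> m))"
  by (rule measurable_compose[OF measurable_S_coord measurable_coin])

lemma measurable_col [measurable]: "(\<lambda>\<omega>. col \<omega> l r a b i) \<in> S \<rightarrow>\<^sub>M count_space UNIV"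
proof (induction "nat (r - l)" arbitrary: l r a b rule: less_induct)
  case less
  consider "i \<le> l" | "l < i" "i < r" | "r \<le> i" by linarith
  then show ?case
  proof cases
    case 1
    then show ?thesis by simp
  next
    case 3
    then have "(\<lambda>\<omega>. col \<omega> l r a b i) = (\<lambda>\<omega>. if i \<le> l then a else b)"
      by (simp add: col.simps fun_eq_iff)
    then show ?thesis by simp
  next
    case 2
    define G where "G m c \<omega> = (if i \<le> m then col \<omega> l m a c i else col \<omega> m r c b i)" for m c \<omega>
    have G: "G m c \<in> S \<rightarrow>\<^sub>M count_space UNIV" if "l < m" "m < r" for m c
      using less(1)[of m l a c] less(1)[of r m c b] that
      by (cases "i \<le> m") (simp_all add: G_def[abs_def])
    define K where "K m \<omega> = (if l < m \<and> m < r then G m (pick (coin (\<omega> m)) a b) \<omega> else 0)" for m \<omega>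
    have K: "K m \<in> S \<rightarrow>\<^sub>M count_space UNIV" for m
    proof (cases "l < m \<and> m < r")
      case True
      have "(\<lambda>\<omega>. G m (pick (coin (\<omega> m)) a b) \<omega>) \<in> S \<rightarrow>\<^sub>M count_space UNIV"
        by (rule measurable_compose_countable[of "G m"]) (use G True in auto)
      then show ?thesis using True by (simp add: K_def[abs_def])
    next
      case False
      then have "K m = (\<lambda>_. 0)" by (auto simp: K_def)
      then show ?thesis by simp
    qed
    have "(\<lambda>\<omega>. K (first_arrival \<omega> l r) \<omega>) \<in> S \<rightarrow>\<^sub>M count_space UNIV"
      by (rule measurable_compose_countable[of K]) (use K in auto)
    also have "(\<lambda>\<omega>. K (first_arrival \<omega> l r) \<omega>) = (\<lambda>\<omega>. col \<omega> l r a b i)"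
      using first_arrival_props(1,2)[OF 2] col_rec[OF first_arrival_props(1,2)[OF 2] refl refl]
      by (simp add: K_def G_def fun_eq_iff)
    finally show ?thesis .
  qed
qed

text \<open>The colors strictly between \<open>l\<close> and \<open>r\<close>.\<close>
definition word :: "(int \<Rightarrow> nat \<Rightarrow> real) \<Rightarrow> int \<Rightarrow> int \<Rightarrow> nat \<Rightarrow> nat \<Rightarrow> nat list" where
  "word y l r a b = map (col y l r a b) [l + 1..r - 1]"

lemma length_word [simp]: "length (word y l r a b) = nat (r - l - 1)"
  by (simp add: word_def)

lemma word_rec:
  assumes "l < m" "m < r" "first_arrival y l r = m" "c = pick (coin (y m)) a b"
  shows "word y l r a b = word y l m a c @ c # word y m r c b"
proof -
  have "[l + 1..r - 1] = [l + 1..m - 1] @ m # [m + 1..r - 1]"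
    using assms upto_split3[of "l + 1" m "r - 1"] by simp
  moreover have "map (col y l r a b) [l + 1..m - 1] = map (col y l m a c) [l + 1..m - 1]"
    using col_rec[OF assms] by auto
  moreover have "map (col y l r a b) [m + 1..r - 1] = map (col y m r c b) [m + 1..r - 1]"
    using col_rec[OF assms] by auto
  moreover have "col y l r a b m = c"
    using col_rec[OF assms, of m] assms by simp
  ultimately show ?thesis by (simp add: word_def)
qed

lemma word_cong: "(\<And>j. l < j \<Longrightarrow> j < r \<Longrightarrow> y j = y' j) \<Longrightarrow> word y l r a b = word y' l r a b"
  unfolding word_def by (intro map_cong refl col_cong)

lemma sets_word [measurable]: "{\<omega>. word \<omega> l r a b = w} \<in> sets S"
proof -
  have "{\<omega>. word \<omega> l r a b = w} = {\<omega>\<in>space S. length w = nat (r - l - 1) \<and>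
     (\<forall>k\<in>{..<length w}. col \<omega> l r a b (l + 1 + int k) = w ! k)}"
    by (auto simp: list_eq_iff_nth_eq word_def)
  also have "\<dots> \<in> sets S" by measurable
  finally show ?thesis .
qed

lemma nn_integral_unif_power:
  assumes s: "0 \<le> s" "s \<le> 1" and K: "0 \<le> K"
  shows "(\<integral>\<^sup>+u. ennreal (K * (1 - u) ^ n) * indicator {s<..1} u \<partial>unif) = ennreal (K * (1 - s) ^ Suc n / real (Suc n))"
proof -
  have "(\<integral>\<^sup>+u. ennreal (K * (1 - u) ^ n) * indicator {s<..1} u \<partial>unif)
      = (\<integral>\<^sup>+u. (ennreal (K * (1 - u) ^ n) * indicator {s<..1} u) * indicator {0..1} u \<partial>lborel)"
    by (subst nn_integral_uniform_measure) (auto simp: divide_ennreal_def)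
  also have "\<dots> = (\<integral>\<^sup>+u. ennreal (K * (1 - u) ^ n) * indicator {s..1} u \<partial>lborel)"
  proof (rule nn_integral_cong_AE)
    have "AE u in lborel. u \<noteq> s" by (rule AE_lborel_singleton)
    then show "AE u in lborel. ennreal (K * (1 - u) ^ n) * indicator {s<..1} u * indicator {0..1} u
        = ennreal (K * (1 - u) ^ n) * indicator {s..1} u"
      by eventually_elim (use s in \<open>auto simp: indicator_def\<close>)
  qed
  also have "\<dots> = ennreal (- K * (1 - 1) ^ Suc n / real (Suc n) - (- K * (1 - s) ^ Suc n / real (Suc n)))"
  proof (rule nn_integral_FTC_Icc[where F = "\<lambda>u. - K * (1 - u) ^ Suc n / real (Suc n)"])
    fix x assume x: "x \<in> {s..1}"
    show "((\<lambda>u. - K * (1 - u) ^ Suc n / real (Suc n)) has_real_derivative K * (1 - x) ^ n) (at x)"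
      by (auto intro!: derivative_eq_intros simp del: power_Suc)
    show "0 \<le> K * (1 - x) ^ n" using K x by simp
  qed (use s in auto)
  finally show ?thesis by simp
qed

lemma AE_neq: "AE \<omega> in S. \<omega> j 0 \<noteq> s"
proof -
  have "AE x in unif. x \<noteq> s"
    by (intro AE_uniform_measureI) (auto intro: AE_mp[OF AE_lborel_singleton[of s]])
  then have "AE y in mark. y 0 \<noteq> s"
    unfolding mark_def by (intro AE_PiM_component prob_space_unif) auto
  then show ?thesis
    by (intro AE_PiM_component prob_space_mark) auto
qed

text \<open>All sites strictly between \<open>l\<close> and \<open>r\<close> arrive after time \<open>s\<close>, or not before it. Both are
  needed, because the earliest arrival is the leftmost in the case of a tie.\<close>
definition all_above :: "real \<Rightarrow> int \<Rightarrow> int \<Rightarrow> (int \<Rightarrow> nat \<Rightarrow> real) set" where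
  "all_above s l r = {\<omega>. \<forall>j\<in>{l<..<r}. s < \<omega> j 0}"

definition all_above_weak :: "real \<Rightarrow> int \<Rightarrow> int \<Rightarrow> (int \<Rightarrow> nat \<Rightarrow> real) set" where
  "all_above_weak s l r = {\<omega>. \<forall>j\<in>{l<..<r}. \<not> \<omega> j 0 < s}"

lemma sets_all_above [measurable]: "all_above s l r \<in> sets S" "all_above_weak s l r \<in> sets S"
proof -
  have "{\<omega>\<in>space S. \<forall>j\<in>{l<..<r}. s < \<omega> j 0} \<in> sets S"
    "{\<omega>\<in>space S. \<forall>j\<in>{l<..<r}. \<not> \<omega> j 0 < s} \<in> sets S" by measurable
  then show "all_above s l r \<in> sets S" "all_above_weak s l r \<in> sets S"
    by (simp_all add: all_above_def all_above_weak_def)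
qed

lemma emeasure_all_above_weak: 
  assumes "A \<in> sets S"
  shows "emeasure S (all_above_weak s l r \<inter> A) = emeasure S (all_above s l r \<inter> A)"
proof (rule emeasure_eq_AE)
  have "AE \<omega> in S. \<forall>j. \<omega> j 0 \<noteq> s" using AE_neq by (simp add: AE_all_countable)
  then show "AE \<omega> in S. \<omega> \<in> all_above_weak s l r \<inter> A \<longleftrightarrow> \<omega> \<in> all_above s l r \<inter> A"
    by eventually_elim (auto simp: all_above_def all_above_weak_def not_less order_le_less)
qed (use assms in auto)

text \<open>The word is independent of the event that all arrivals are later than \<open>s\<close>. This stronger
  statement is what the induction needs: given that the earliest site \<open>m\<close> arrives at time \<open>u\<close>, both
  sides consist of sites that arrive after \<open>u\<close>.\<close>
lemma emeasure_word:
  assumes "a \<noteq> b" "a \<in> {1..4}" "b \<in> {1..4}" "l < r" "0 \<le> s" "s \<le> 1"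
    "set w \<subseteq> {1..4}" "length w = nat (r - l - 1)"
  shows "emeasure S (all_above s l r \<inter> {\<omega>. word \<omega> l r a b = w}) = ennreal ((1 - s) ^ length w * word_prob a w b)"
  using assms
proof (induction "length w" arbitrary: a b l r s w rule: less_induct)
  case less
  show ?case
  proof (cases "w = []")
    case True
    then have "all_above s l r \<inter> {\<omega>. word \<omega> l r a b = w} = UNIV"
      using less.prems by (auto simp: all_above_def word_def)
    then show ?thesis using True S.emeasure_space_1 by simp
  next
    case False
    define n where "n = length w - 1"
    have N: "length w = Suc n" using False by (simp add: n_def)
    have r: "r = l + 2 + int n" using less.prems N by auto
    define ok where "ok q \<longleftrightarrow> w ! q \<noteq> a \<and> w ! q \<noteq> b" for q
    define K where "K q = word_prob a (take q w) (w ! q) * word_prob (w ! q) (drop (Suc q) w) b" for q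
    define E where "E q = all_above s l r \<inter> {\<omega>. word \<omega> l r a b = w} \<inter> {\<omega>. first_arrival \<omega> l r = l + 1 + int q}" for q
    have am [measurable]: "{\<omega>. first_arrival \<omega> l r = m} \<in> sets S" for m
      using measurable_sets[OF measurable_first_arrival[of l r], of "{m}"] by (simp add: vimage_def)
    have E_sets [measurable]: "E q \<in> sets S" for q
      unfolding E_def by measurable
    have E: "emeasure S (E q) = ennreal (if ok q then K q * (1 - s) ^ Suc n / real (Suc n) / 2 else 0)" if q: "q < Suc n" for q
    proof -
      define m where "m = l + 1 + int q"
      have m: "l < m" "m < r" using q r by (auto simp: m_def)
      define c where "c = w ! q"
      have c4: "c \<in> {1..4}" using less.prems(7) q N nth_mem[of q w] unfolding c_def by (metis subsetD)
      have wsplit: "w = take q w @ c # drop (Suc q) w"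
        using q N by (simp add: c_def id_take_nth_drop)
      have lens: "length (take q w) = nat (m - l - 1)" "length (drop (Suc q) w) = nat (r - m - 1)"
        using q N r by (auto simp: m_def)
      define Lv where "Lv u = all_above u l m \<inter> {\<omega>. word \<omega> l m a c = take q w}" for u
      define Rv where "Rv u = all_above_weak u m r \<inter> {\<omega>. word \<omega> m r c b = drop (Suc q) w}" for u
      have slice: "{\<omega>. fun_upd \<omega> m y \<in> E q} = (if s < y 0 \<and> pick (coin y) a b = c then Lv (y 0) \<inter> Rv (y 0) else {})" for y
      proof -
        have "fun_upd \<omega> m y \<in> E q \<longleftrightarrow> s < y 0 \<and> pick (coin y) a b = c \<and> \<omega> \<in> Lv (y 0) \<and> \<omega> \<in> Rv (y 0)" for \<omega>
        proof -
          let ?z = "fun_upd \<omega> m y"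
          have A: "first_arrival ?z l r = m \<longleftrightarrow> \<omega> \<in> all_above (y 0) l m \<and> \<omega> \<in> all_above_weak (y 0) m r"
            unfolding first_arrival_eq_iff[OF m] by (auto simp: all_above_def all_above_weak_def not_less)
          have B: "?z \<in> all_above s l r \<longleftrightarrow> s < y 0" if "\<omega> \<in> all_above (y 0) l m \<and> \<omega> \<in> all_above_weak (y 0) m r"
          proof
            assume "?z \<in> all_above s l r"
            then show "s < y 0" using m unfolding all_above_def
              by (metis (no_types, lifting) fun_upd_same greaterThanLessThan_iff mem_Collect_eq)
          next
            assume "s < y 0"
            have "s < ?z j 0" if j: "l < j" "j < r" for j
            proof -
              consider "j < m" | "j = m" | "m < j" by linarith
              then show ?thesis
              proof cases
                case 1
                then have "y 0 < \<omega> j 0" using \<open>\<omega> \<in> all_above (y 0) l m \<and> _\<close> j by (auto simp: all_above_def)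
                then show ?thesis using \<open>s < y 0\<close> 1 by simp
              next
                case 3
                then have "\<not> \<omega> j 0 < y 0" using \<open>\<omega> \<in> all_above (y 0) l m \<and> _\<close> j by (auto simp: all_above_weak_def)
                then show ?thesis using \<open>s < y 0\<close> 3 by simp
              qed (use \<open>s < y 0\<close> in simp)
            qed
            then show "?z \<in> all_above s l r" by (simp add: all_above_def)
          qed
          have C: "word ?z l r a b = w \<longleftrightarrow> pick (coin y) a b = c \<and> word \<omega> l m a c = take q w \<and> word \<omega> m r c b = drop (Suc q) w"
            if "first_arrival ?z l r = m"
          proof -
            have "word ?z l r a b = word ?z l m a (pick (coin y) a b) @ pick (coin y) a b # word ?z m r (pick (coin y) a b) b"
              using word_rec[OF m that, of "pick (coin y) a b" a b] by simp
            also have "word ?z l m a (pick (coin y) a b) = word \<omega> l m a (pick (coin y) a b)"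
              by (rule word_cong) auto
            also have "word ?z m r (pick (coin y) a b) b = word \<omega> m r (pick (coin y) a b) b"
              by (rule word_cong) auto
            finally show ?thesis
              using lens wsplit
              by (metis append_eq_append_conv length_word list.inject)
          qed
          show ?thesis
            unfolding E_def m_def[symmetric] Int_iff mem_Collect_eq Lv_def Rv_def using A B C by blast
        qed
        then show ?thesis by auto
      qed
      show ?thesis
      proof (cases "ok q")
        case False
        have "word y l r a b \<noteq> w" if "first_arrival y l r = m" for y
        proof
          assume "word y l r a b = w"
          then have "word y l m a (pick (coin (y m)) a b) @ pick (coin (y m)) a b # word y m r (pick (coin (y m)) a b) b = take q w @ c # drop (Suc q) w"
            using word_rec[OF m that refl, of a b] wsplit by simp
          then have "pick (coin (y m)) a b = c"
            using lens by (metis append_eq_append_conv length_word list.inject)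
          then show False using pick_in[of "coin (y m)" a b] False by (auto simp: ok_def c_def)
        qed
        then have "E q = {}" by (auto simp: E_def m_def)
        then show ?thesis using False by simp
      next
        case True
        then obtain v where v: "\<And>u. pick u a b = c \<longleftrightarrow> u = v"
          using pick_unique[of a b c] less.prems c4 by (auto simp: ok_def c_def)
        have Lm: "emeasure S (Lv u \<inter> Rv u) = ennreal (K q * (1 - u) ^ n)" if u: "u \<in> {0..1}" for u
        proof -
          have dL: "dep_on {l<..<m} (Lv u)"
            unfolding dep_on_def
          proof (intro allI impI)
            fix \<omega> \<omega>' :: "int \<Rightarrow> nat \<Rightarrow> real"
            assume eq: "\<forall>i\<in>{l<..<m}. \<omega> i = \<omega>' i"
            then have "word \<omega> l m a c = word \<omega>' l m a c" by (intro word_cong) auto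
            then show "\<omega> \<in> Lv u \<longleftrightarrow> \<omega>' \<in> Lv u" using eq by (auto simp: Lv_def all_above_def)
          qed
          have dR: "dep_on {m<..<r} (Rv u)"
            unfolding dep_on_def
          proof (intro allI impI)
            fix \<omega> \<omega>' :: "int \<Rightarrow> nat \<Rightarrow> real"
            assume eq: "\<forall>i\<in>{m<..<r}. \<omega> i = \<omega>' i"
            then have "word \<omega> m r c b = word \<omega>' m r c b" by (intro word_cong) auto
            then show "\<omega> \<in> Rv u \<longleftrightarrow> \<omega>' \<in> Rv u" using eq by (auto simp: Rv_def all_above_weak_def)
          qed
          have ms: "Lv u \<in> sets S" "Rv u \<in> sets S" by (auto simp: Lv_def Rv_def)
          have sub: "set (take q w) \<subseteq> {1..4}" "set (drop (Suc q) w) \<subseteq> {1..4}"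
            using less.prems(7) by (auto dest: in_set_takeD in_set_dropD)
          have ac: "a \<noteq> c" "c \<noteq> b" using True by (auto simp: ok_def c_def)
          have lt: "length (take q w) < length w" "length (drop (Suc q) w) < length w" using q N by auto
          have "emeasure S (Lv u) = ennreal ((1 - u) ^ length (take q w) * word_prob a (take q w) c)"
            unfolding Lv_def
            by (rule less.hyps[OF lt(1) ac(1) less.prems(2) c4 m(1) _ _ sub(1) lens(1)]) (use u in auto)
          then have L: "measure S (Lv u) = (1 - u) ^ q * word_prob a (take q w) c"
            using u q N by (simp add: measure_def word_prob_nonneg min_def)
          have "emeasure S (Rv u) = ennreal ((1 - u) ^ length (drop (Suc q) w) * word_prob c (drop (Suc q) w) b)"
            unfolding Rv_def emeasure_all_above_weak[OF sets_word]
            by (rule less.hyps[OF lt(2) ac(2) c4 less.prems(3) m(2) _ _ sub(2) lens(2)]) (use u in auto)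
          then have R: "measure S (Rv u) = (1 - u) ^ (n - q) * word_prob c (drop (Suc q) w) b"
            using u q N by (simp add: measure_def word_prob_nonneg)
          have "(1 - u) ^ n = (1 - u) ^ q * (1 - u) ^ (n - q)"
            using q by (simp flip: power_add)
          then have "measure S (Lv u \<inter> Rv u) = K q * (1 - u) ^ n"
            using indep_dep_on[OF ms(1) dL ms(2) dR] L R by (simp add: K_def c_def ac_simps)
          then show ?thesis by (simp add: S.emeasure_eq_measure)
        qed
        have "emeasure S (E q) = (\<integral>\<^sup>+u. ennreal (K q * (1 - u) ^ n) * indicator {s<..1} u \<partial>unif) / 2"
        proof (rule emeasure_slice[of _ _ v m])
          fix y :: "nat \<Rightarrow> real"
          assume "coin y = v" "y 0 \<in> {0..1}"
          then show "emeasure S {\<omega>. fun_upd \<omega> m y \<in> E q} = ennreal (K q * (1 - y 0) ^ n) * indicator {s<..1} (y 0)"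
            unfolding slice using v Lm[of "y 0"] by (auto simp: indicator_def)
        next
          fix y :: "nat \<Rightarrow> real"
          assume "coin y \<noteq> v"
          then show "emeasure S {\<omega>. fun_upd \<omega> m y \<in> E q} = 0"
            unfolding slice using v by auto
        qed auto
        also have "\<dots> = ennreal (K q * (1 - s) ^ Suc n / real (Suc n)) / 2"
          using less.prems by (subst nn_integral_unif_power) (auto simp: K_def word_prob_nonneg)
        also have "\<dots> = ennreal (K q * (1 - s) ^ Suc n / real (Suc n) / 2)"
          using less.prems by (subst divide_ennreal[symmetric]) (auto simp: K_def word_prob_nonneg)
        finally show ?thesis using True by simp
      qed
    qed
    have "all_above s l r \<inter> {\<omega>. word \<omega> l r a b = w} = (\<Union>q<Suc n. E q)"
    proof -
      have "\<exists>q<Suc n. first_arrival \<omega> l r = l + 1 + int q" for \<omega>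
        using first_arrival_props(1,2)[of l "l + 1" r \<omega>] r by (intro exI[of _ "nat (first_arrival \<omega> l r - l - 1)"]) auto
      then show ?thesis by (auto simp: E_def)
    qed
    moreover have "emeasure S (\<Union>q<Suc n. E q) = (\<Sum>q<Suc n. emeasure S (E q))"
      by (intro sum_emeasure[symmetric]) (auto simp: E_def disjoint_family_on_def)
    moreover have "\<dots> = (\<Sum>q<Suc n. ennreal (if ok q then K q * (1 - s) ^ Suc n / real (Suc n) / 2 else 0))"
      using E by (intro sum.cong) auto
    moreover have "\<dots> = ennreal (\<Sum>q<Suc n. if ok q then K q * (1 - s) ^ Suc n / real (Suc n) / 2 else 0)"
      using less.prems by (intro sum_ennreal) (auto simp: K_def word_prob_nonneg)
    moreover have "(\<Sum>q<Suc n. if ok q then K q * (1 - s) ^ Suc n / real (Suc n) / 2 else 0) = (1 - s) ^ length w * word_prob a w b"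
    proof -
      have "(\<Sum>q<Suc n. if ok q then K q * (1 - s) ^ Suc n / real (Suc n) / 2 else 0)
        = (\<Sum>q<Suc n. (1 - s) ^ Suc n / (2 * real (Suc n)) * (if ok q then K q else 0))"
        by (intro sum.cong) (auto simp del: power_Suc of_nat_Suc simp: field_simps)
      also have "\<dots> = (1 - s) ^ Suc n / (2 * real (Suc n)) * (\<Sum>q<Suc n. if ok q then K q else 0)"
        by (simp only: sum_distrib_left)
      also have "(\<Sum>q<Suc n. if ok q then K q else 0) = 2 * real (Suc n) * word_prob a w b"
        using False by (subst word_prob.simps) (simp add: N ok_def K_def del: sum.lessThan_Suc cong: if_cong)
      finally show ?thesis by (simp add: N del: sum.lessThan_Suc)
    qed
    ultimately show ?thesis by simp
  qed
qed

lemma AE_unit: "AE \<omega> in S. \<forall>j. \<omega> j 0 \<in> {0..1}"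
proof -
  have "AE y in mark. y 0 \<in> {0..1::real}"
    unfolding mark_def by (intro AE_PiM_component prob_space_unif AE_uniform_measureI) auto
  then have "AE \<omega> in S. \<omega> j 0 \<in> {0..1}" for j
    by (intro AE_PiM_component prob_space_mark) auto
  then show ?thesis by (simp add: AE_all_countable)
qed

lemma measure_word:
  assumes "a \<noteq> b" "a \<in> {1..4}" "b \<in> {1..4}" "l < r" "w \<in> words (nat (r - l - 1))"
  shows "measure S {\<omega>. word \<omega> l r a b = w} = word_prob a w b"
proof -
  have *: "AE \<omega> in S. \<omega> \<in> all_above_weak 0 l r"
    using AE_unit by eventually_elim (auto simp: all_above_weak_def not_less)
  have "emeasure S {\<omega>. word \<omega> l r a b = w} = emeasure S (all_above_weak 0 l r \<inter> {\<omega>. word \<omega> l r a b = w})"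
  proof (rule emeasure_eq_AE)
    show "AE \<omega> in S. \<omega> \<in> {\<omega>. word \<omega> l r a b = w} \<longleftrightarrow> \<omega> \<in> all_above_weak 0 l r \<inter> {\<omega>. word \<omega> l r a b = w}"
      using * by eventually_elim auto
  qed auto
  also have "\<dots> = ennreal (word_prob a w b)"
    unfolding emeasure_all_above_weak[OF sets_word]
    using emeasure_word[of a b l r 0 w] assms by (simp add: words_def)
  finally show ?thesis by (simp add: measure_def word_prob_nonneg)
qed

lemma measure_window:
  assumes ab: "a \<noteq> b" "a \<in> {1..4}" "b \<in> {1..4}" and x: "x \<in> words n"
    and l: "l + 1 + int j = i" and r: "r = i + int n + int k"
  shows "measure S {\<omega>. map (col \<omega> l r a b) [i..i + int n - 1] = x} = window_prob a b j x k"
proof -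
  have lr: "l < r" "nat (r - l - 1) = j + n + k" using l r by auto
  have lx: "length x = n" using x by (auto simp: words_def)
  have window_word: "map (col \<omega> l r a b) [i..i + int n - 1] = window j n (word \<omega> l r a b)" for \<omega>
    using l r by (intro nth_equalityI) (auto simp: window_def word_def algebra_simps)
  have wd: "word \<omega> l r a b \<in> words (j + n + k)" for \<omega>
    using lr col_in[OF ab(2,3)] by (auto simp: words_def word_def)
  have "{\<omega>. map (col \<omega> l r a b) [i..i + int n - 1] = x} =
      (\<Union>w\<in>{w \<in> words (j + n + k). window j n w = x}. {\<omega>. word \<omega> l r a b = w})"
    using wd by (auto simp: window_word)
  then have "measure S {\<omega>. map (col \<omega> l r a b) [i..i + int n - 1] = x} =
      (\<Sum>w\<in>{w \<in> words (j + n + k). window j n w = x}. measure S {\<omega>. word \<omega> l r a b = w})"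
    by (simp only:) (intro S.finite_measure_finite_Union, auto simp: disjoint_family_on_def)
  also have "\<dots> = (\<Sum>w\<in>{w \<in> words (j + n + k). window j n w = x}. word_prob a w b)"
    using ab lr by (intro sum.cong refl measure_word) auto
  also have "\<dots> = window_prob a b j x k"
    unfolding window_prob_def lx by (auto simp: sum.inter_filter of_bool_def if_distrib cong: if_cong)
  finally show ?thesis .
qed

section \<open>The finitary factor\<close>

text \<open>The interior of \<open>(l, r)\<close> is younger than its ends, and the origin receives the color \<open>c\<close> whatever two different
  colors the ends have.\<close>
definition coalesced :: "(int \<Rightarrow> nat \<Rightarrow> real) \<Rightarrow> int \<Rightarrow> int \<Rightarrow> nat \<Rightarrow> bool" where
  "coalesced y l r c \<longleftrightarrow> (\<forall>j\<in>{l<..<r}. y l 0 < y j 0 \<and> y r 0 < y j 0) \<and>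
     (\<forall>a\<in>{1..4}. \<forall>b\<in>{1..4} - {a}. col y l r a b 0 = c)"

text \<open>A site at distance \<open>t\<close> has a negative arrival time. This happens with probability zero only. It is a device that makes
  the coding radius explicit: beyond any radius at which the color of the origin has not been fixed, a configuration can be
  continued in two ways that force different colors (\<open>determined_within_iff\<close>). So the coding radius is a
  stopping time, and in particular measurable.\<close>
definition special :: "(int \<Rightarrow> nat \<Rightarrow> real) \<Rightarrow> nat \<Rightarrow> bool" where
  "special y t \<longleftrightarrow> y (int t) 0 < 0 \<or> y (- int t) 0 < 0"

text \<open>The marks within distance \<open>t\<close> propose the color \<open>c\<close> for the origin. A special site has priority; the choice between the colors \<open>1\<close>
  and \<open>2\<close> by the value \<open>-1\<close> is arbitrary.\<close>
definition decides :: "(int \<Rightarrow> nat \<Rightarrow> real) \<Rightarrow> nat \<Rightarrow> nat \<Rightarrow> bool" where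
  "decides y t c \<longleftrightarrow> (if special y t then c = (if y (int t) 0 = -1 \<or> y (- int t) 0 = -1 then 1 else 2)
     else \<exists>l\<in>{- int t..<0}. \<exists>r\<in>{0<..int t}. coalesced y l r c)"

definition stop :: "(int \<Rightarrow> nat \<Rightarrow> real) \<Rightarrow> nat \<Rightarrow> bool" where
  "stop y t \<longleftrightarrow> (\<exists>c. decides y t c)"

text \<open>The color proposed at the first radius with a proposal. The least color is taken only to have a
  definite value; the proposal is in fact unique. The value \<open>1\<close> is a default.\<close>
definition origin_color :: "(int \<Rightarrow> nat \<Rightarrow> real) \<Rightarrow> nat" where
  "origin_color y = (if \<exists>t. stop y t then LEAST c. decides y (LEAST t. stop y t) c else 1)"

definition factor :: "(int \<Rightarrow> nat \<Rightarrow> real) \<Rightarrow> int \<Rightarrow> nat" where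
  "factor y i = origin_color (shift i y)"

lemma coalesced_in: "coalesced y l r c \<Longrightarrow> c \<in> {1..4}"
  using col_in[of 1 2 y l r 0] by (auto simp: coalesced_def)

lemma decides_in: "decides y t c \<Longrightarrow> c \<in> {1..4}"
  by (auto simp: decides_def dest!: coalesced_in split: if_splits)

lemma origin_color_decides:
  assumes "stop y t"
  shows "decides y (LEAST t. stop y t) (origin_color y)" "(LEAST t. stop y t) \<le> t"
proof -
  have "stop y (LEAST t. stop y t)" using assms by (rule LeastI)
  then obtain c where "decides y (LEAST t. stop y t) c" by (auto simp: stop_def)
  then have "decides y (LEAST t. stop y t) (LEAST c. decides y (LEAST t. stop y t) c)" by (rule LeastI)
  then show "decides y (LEAST t. stop y t) (origin_color y)" using assms by (auto simp: origin_color_def)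
  show "(LEAST t. stop y t) \<le> t" using assms by (rule Least_le)
qed

lemma origin_color_in: "origin_color y \<in> {1..4}"
proof (cases "\<exists>t. stop y t")
  case True
  then show ?thesis using origin_color_decides decides_in by blast
qed (simp add: origin_color_def)

lemma factor_in: "factor y i \<in> {1..4}"
  unfolding factor_def by (rule origin_color_in)

lemma decides_cong:
  assumes "\<And>i. i \<in> {- int t..int t} \<Longrightarrow> y' i = y i"
  shows "decides y' t c = decides y t c"
proof -
  have "coalesced y' l r c = coalesced y l r c" if "l \<in> {- int t..<0}" "r \<in> {0<..int t}" for l r
  proof -
    have "col y' l r a b 0 = col y l r a b 0" for a b
      using that by (intro col_cong assms) auto
    then show ?thesis using that assms by (auto simp: coalesced_def)
  qed
  moreover have "y' (int t) = y (int t)" "y' (- int t) = y (- int t)" by (auto intro: assms)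
  ultimately show ?thesis by (auto simp: decides_def special_def)
qed

lemma stop_cong:
  assumes "\<And>i. i \<in> {- int t..int t} \<Longrightarrow> y' i = y i"
  shows "stop y' t = stop y t"
  using decides_cong[OF assms] by (simp add: stop_def)

lemma Least_cong_upto:
  fixes P Q :: "nat \<Rightarrow> bool"
  assumes "P t" "\<And>s. s \<le> t \<Longrightarrow> P s = Q s"
  shows "(LEAST s. Q s) = (LEAST s. P s)"
proof (rule Least_equality)
  have "(LEAST s. P s) \<le> t" using assms(1) by (rule Least_le)
  moreover have "P (LEAST s. P s)" using assms(1) by (rule LeastI)
  ultimately show "Q (LEAST s. P s)" using assms(2) by blast
  fix s assume "Q s"
  show "(LEAST s. P s) \<le> s"
  proof (cases "s \<le> t")
    case True
    then show ?thesis using \<open>Q s\<close> assms(2) by (auto intro: Least_le)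
  next
    case False
    then show ?thesis using \<open>(LEAST s. P s) \<le> t\<close> by simp
  qed
qed

lemma shift_0 [simp]: "shift 0 y = y"
  by (simp add: shift_def)

text \<open>If nothing is fixed within distance \<open>t\<close>, special sites at distance \<open>t + 1\<close> determine the color.\<close>
lemma origin_color_special:
  assumes "\<And>s. s \<le> t \<Longrightarrow> \<not> stop y s" "special y (Suc t)"
  shows "origin_color y = (if y (int (Suc t)) 0 = -1 \<or> y (- int (Suc t)) 0 = -1 then 1 else 2)"
proof -
  have s: "stop y (Suc t)" using assms(2) by (auto simp: stop_def decides_def)
  have "(LEAST t. stop y t) = Suc t"
    using s assms(1) by (intro Least_equality) (auto simp: not_less_eq_eq[symmetric])
  then show ?thesis
    using origin_color_decides(1)[OF s] assms(2) by (simp add: decides_def)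
qed

lemma determined_within_iff: "determined_within mark factor y t \<longleftrightarrow> (\<exists>s\<le>t. stop y s)"
proof
  assume "\<exists>s\<le>t. stop y s"
  then obtain s where s: "s \<le> t" "stop y s" by auto
  show "determined_within mark factor y t"
    unfolding determined_within_def
  proof (intro ballI impI)
    fix y' :: "int \<Rightarrow> nat \<Rightarrow> real"
    assume "\<forall>i\<in>{- int t..int t}. y' i = y i"
    then have c: "decides y' u c = decides y u c" if "u \<le> t" for u c
      using that by (intro decides_cong) auto
    then have st: "stop y u = stop y' u" if "u \<le> s" for u
      using that s by (auto simp: stop_def)
    have L: "(LEAST t. stop y' t) = (LEAST t. stop y t)"
      by (rule Least_cong_upto[of "stop y" s]) (use s(2) st in auto)
    moreover have "(LEAST t. stop y t) \<le> t" using origin_color_decides(2)[OF s(2)] s by simp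
    ultimately have "origin_color y' = origin_color y"
      using s(2) st[of s] c by (auto simp: origin_color_def)
    then show "factor y' 0 = factor y 0" by (simp add: factor_def)
  qed
next
  assume det: "determined_within mark factor y t"
  show "\<exists>s\<le>t. stop y s"
  proof (rule ccontr)
    assume never: "\<not> (\<exists>s\<le>t. stop y s)"
    define z where "z v = (\<lambda>i. if i \<in> {- int t..int t} then y i else (\<lambda>_. v))" for v :: real
    have agree: "z v i = y i" if "i \<in> {- int t..int t}" for i v using that by (simp add: z_def)
    have ns: "\<not> stop (z v) s" if "s \<le> t" for v s
      using never that stop_cong[of s "z v" y] agree by auto
    have same: "factor (z v) 0 = factor y 0" for v
      by (rule det[unfolded determined_within_def, rule_format]) (use agree in auto)
    have out: "z v (int (Suc t)) 0 = v" "z v (- int (Suc t)) 0 = v" for v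
      by (simp_all add: z_def)
    have sp: "special (z v) (Suc t)" if "v < 0" for v
      using that by (simp only: special_def out simp_thms)
    have "origin_color (z (-1)) = 1"
      using origin_color_special[OF ns sp, of "-1"] by (simp only: out) simp
    moreover have "origin_color (z (-2)) = 2"
      using origin_color_special[OF ns sp, of "-2"] by (simp only: out) simp
    ultimately have "factor (z (-1)) 0 = 1" "factor (z (-2)) 0 = 2" by (simp_all add: factor_def)
    with same[of "-1"] same[of "-2"] show False by simp
  qed
qed

text \<open>The first radius with a proposal, which is the coding radius (\<open>coding_radius_eq\<close>).\<close>
definition radius :: "(int \<Rightarrow> nat \<Rightarrow> real) \<Rightarrow> enat" where
  "radius y = (if \<exists>t. stop y t then enat (LEAST t. stop y t) else \<infinity>)"

lemma coding_radius_eq: "coding_radius mark factor y = radius y"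
proof (cases "\<exists>t. stop y t")
  case True
  then obtain t where t: "stop y t" by auto
  have 1: "stop y (LEAST t. stop y t)" using t by (rule LeastI)
  have "Inf (enat ` {t. \<exists>s\<le>t. stop y s}) = enat (LEAST t. stop y t)"
  proof (rule antisym)
    show "Inf (enat ` {t. \<exists>s\<le>t. stop y s}) \<le> enat (LEAST t. stop y t)"
      using 1 by (intro Inf_lower) auto
    show "enat (LEAST t. stop y t) \<le> Inf (enat ` {t. \<exists>s\<le>t. stop y s})"
      by (intro Inf_greatest) (auto intro: order_trans[OF Least_le])
  qed
  then show ?thesis using True by (simp add: coding_radius_def determined_within_iff radius_def)
next
  case False
  then show ?thesis by (simp add: coding_radius_def determined_within_iff radius_def top_enat_def)
qed

lemma equivariant_factor: "equivariant mark factor"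
  by (auto simp: equivariant_def factor_def shift_def fun_eq_iff add_ac)

lemma measurable_special [measurable]: "Measurable.pred S (\<lambda>\<omega>. special \<omega> t)"
  unfolding special_def by measurable

lemma measurable_coalesced [measurable]: "Measurable.pred S (\<lambda>\<omega>. coalesced \<omega> l r c)"
  unfolding coalesced_def by measurable

lemma measurable_decides [measurable]: "Measurable.pred S (\<lambda>\<omega>. decides \<omega> t c)"
  unfolding decides_def by measurable

lemma measurable_stop [measurable]: "Measurable.pred S (\<lambda>\<omega>. stop \<omega> t)"
  unfolding stop_def by measurable

lemma measurable_radius [measurable]: "radius \<in> S \<rightarrow>\<^sub>M count_space UNIV"
  unfolding radius_def[abs_def] by measurable

lemma measurable_origin_color [measurable]: "origin_color \<in> S \<rightarrow>\<^sub>M count_space UNIV"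
proof -
  have "(\<lambda>\<omega>. LEAST c. decides \<omega> (LEAST t. stop \<omega> t) c) \<in> S \<rightarrow>\<^sub>M count_space UNIV"
    by (rule measurable_compose_countable[of "\<lambda>t \<omega>. LEAST c. decides \<omega> t c"]) measurable
  then show ?thesis unfolding origin_color_def[abs_def] by measurable
qed

lemma measurable_shift: "shift n \<in> S \<rightarrow>\<^sub>M S"
  using measurable_S_reindex[of "\<lambda>i. i + n"] by (simp add: shift_def[abs_def])

lemma measurable_factor_component [measurable]: "(\<lambda>\<omega>. factor \<omega> i) \<in> S \<rightarrow>\<^sub>M count_space UNIV"
  unfolding factor_def by (rule measurable_compose[OF measurable_shift measurable_origin_color])

lemma measurable_factor_colors: "(\<lambda>\<omega>. factor \<omega> i) \<in> S \<rightarrow>\<^sub>M colors 4"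
proof -
  have "(\<lambda>\<omega>. factor \<omega> i) -` {c} \<inter> space S \<in> sets S" for c
    by (rule measurable_sets[OF measurable_factor_component]) auto
  then show ?thesis
    unfolding colors_def using factor_in by (subst measurable_count_space_eq2) auto
qed

lemma measurable_factor: "factor \<in> S \<rightarrow>\<^sub>M seq_space (colors 4)"
  by (rule measurable_PiM_single') (use measurable_factor_colors factor_in in \<open>auto simp: colors_def\<close>)

text \<open>The probability that the color of the origin is not fixed by the marks within distance \<open>J\<close>.\<close>
definition late :: "nat \<Rightarrow> real" where
  "late J = measure S {\<omega>. \<forall>t\<le>J. \<not> stop \<omega> t}"

lemma measure_shift: "A \<in> sets S \<Longrightarrow> measure S {\<omega>. shift n \<omega> \<in> A} = measure S A"
  using measure_S_reindex[of "\<lambda>i. i + n" A] by (simp add: shift_def inj_def)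

lemma sets_late [measurable]: "{\<omega>. \<forall>t\<le>J. \<not> stop \<omega> t} \<in> sets S"
proof -
  have "{\<omega>\<in>space S. \<forall>t\<in>{..J}. \<not> stop \<omega> t} \<in> sets S" by measurable
  moreover have "{\<omega>\<in>space S. \<forall>t\<in>{..J}. \<not> stop \<omega> t} = {\<omega>. \<forall>t\<le>J. \<not> stop \<omega> t}" by auto
  ultimately show ?thesis by simp
qed

lemma late_shift: "measure S {\<omega>. \<forall>t\<le>J. \<not> stop (shift i \<omega>) t} = late J"
  using measure_shift[OF sets_late, of i J] by (simp add: late_def)

lemma sets_late_shift: "{\<omega>. \<forall>t\<le>J. \<not> stop (shift i \<omega>) t} \<in> sets S"
  using measurable_sets[OF measurable_shift sets_late, of i J] by (simp add: vimage_def)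

text \<open>In any interval that contains the coding window of \<open>i\<close>, the coloring with arbitrary different
  end colors agrees with the factor at \<open>i\<close>.\<close>
lemma factor_eq_col:
  assumes pos: "\<And>j. 0 \<le> y j 0" and t: "t \<le> J" "stop (shift i y) t"
    and lr: "l \<le> i - int J" "i + int J \<le> r" and ab: "a \<noteq> b" "a \<in> {1..4}" "b \<in> {1..4}"
  shows "factor y i = col y l r a b i"
proof -
  let ?z = "shift i y"
  let ?T = "LEAST t. stop ?z t"
  have d: "decides ?z ?T (factor y i)" and T: "?T \<le> J"
    using origin_color_decides[OF t(2)] t(1) by (auto simp: factor_def)
  have "\<not> special ?z ?T" using pos by (auto simp: special_def shift_def not_less)
  then obtain l' r' where l'r': "- int ?T \<le> l'" "l' < 0" "0 < r'" "r' \<le> int ?T" and g: "coalesced ?z l' r' (factor y i)"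
    using d by (auto simp: decides_def)
  have fr: "y (l' + i) 0 < y j 0 \<and> y (r' + i) 0 < y j 0" if "l' + i < j" "j < r' + i" for j
    using g that unfolding coalesced_def by (auto simp: shift_def dest!: bspec[where x = "j - i"])
  have bd: "l \<le> l' + i" "r' + i \<le> r" "l' + i < r' + i" "l' + i \<le> i" "i \<le> r' + i" using l'r' lr T by linarith+
  let ?p = "col y l r a b (l' + i)" and ?q = "col y l r a b (r' + i)"
  have neq: "?p \<noteq> ?q" using ab(1) bd fr by (intro col_frame(2)) auto
  have "col y l r a b i = col y (l' + i) (r' + i) ?p ?q i"
    using bd fr by (intro col_frame(1)) auto
  also have "\<dots> = col ?z l' r' ?p ?q 0" by (simp add: col_shift)
  also have "\<dots> = factor y i"
    using g col_in[OF ab(2,3)] neq unfolding coalesced_def by auto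
  finally show ?thesis ..
qed

text \<open>The factor and the coloring of a large interval show the same word in the window, unless
  one of the sites of the window has a coding radius larger than \<open>J\<close>.\<close>
lemma window_approx:
  assumes x: "x \<in> words n"
  shows "\<bar>measure S {\<omega>. map (factor \<omega>) [i..i + int n - 1] = x} - color_prob x\<bar> \<le> real n * late J + 2 / (real J + 1)"
proof -
  \<comment> \<open>A reference interval with \<open>J\<close> sites on both sides of the window; its end colors \<open>1\<close> and \<open>2\<close> are arbitrary.\<close>
  let ?l = "i - 1 - int J" and ?r = "i + int n + int J"
  define W where "W = {\<omega>. map (factor \<omega>) [i..i + int n - 1] = x}"
  define C where "C = {\<omega>. map (col \<omega> ?l ?r 1 2) [i..i + int n - 1] = x}"
  define Bq where "Bq q = {\<omega>. \<forall>t\<le>J. \<not> stop (shift q \<omega>) t}" for q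
  define B where "B = (\<Union>q\<in>{i..i + int n - 1}. Bq q)"
  have map_set: "{\<omega>. map (f \<omega>) [i..i + int n - 1] = x} \<in> sets S"
    if f: "\<And>q. (\<lambda>\<omega>. f \<omega> q) \<in> S \<rightarrow>\<^sub>M count_space UNIV" for f :: "(int \<Rightarrow> nat \<Rightarrow> real) \<Rightarrow> int \<Rightarrow> nat"
  proof -
    have "{\<omega>. map (f \<omega>) [i..i + int n - 1] = x} = {\<omega>\<in>space S. \<forall>k\<in>{..<n}. f \<omega> (i + int k) = x ! k}"
      using x by (auto simp: list_eq_iff_nth_eq words_def)
    also have "\<dots> \<in> sets S" using f by measurable
    finally show ?thesis .
  qed
  have sW [measurable]: "W \<in> sets S" unfolding W_def by (rule map_set) measurable
  have sC [measurable]: "C \<in> sets S" unfolding C_def by (rule map_set) measurable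
  have sBq [measurable]: "Bq q \<in> sets S" for q unfolding Bq_def by (rule sets_late_shift)
  have sB [measurable]: "B \<in> sets S" unfolding B_def by measurable
  have eq: "\<omega> \<in> W \<longleftrightarrow> \<omega> \<in> C" if "\<forall>j. \<omega> j 0 \<in> {0..1}" "\<omega> \<notin> B" for \<omega>
  proof -
    have "factor \<omega> q = col \<omega> ?l ?r 1 2 q" if q: "q \<in> {i..i + int n - 1}" for q
    proof -
      obtain t where "t \<le> J" "stop (shift q \<omega>) t" using \<open>\<omega> \<notin> B\<close> q unfolding B_def Bq_def by blast
      then show ?thesis using \<open>\<forall>j. \<omega> j 0 \<in> {0..1}\<close> q by (intro factor_eq_col) auto
    qed
    then have "map (factor \<omega>) [i..i + int n - 1] = map (col \<omega> ?l ?r 1 2) [i..i + int n - 1]" by auto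
    then show ?thesis by (simp only: W_def C_def mem_Collect_eq)
  qed
  have "measure S B \<le> (\<Sum>q\<in>{i..i + int n - 1}. measure S (Bq q))"
    unfolding B_def by (intro S.finite_measure_subadditive_finite) auto
  also have "\<dots> = real n * late J" using late_shift by (simp add: Bq_def)
  finally have B: "measure S B \<le> real n * late J" .
  have 1: "measure S W \<le> measure S C + measure S B"
  proof -
    have "measure S W \<le> measure S (C \<union> B)"
      using AE_unit eq by (intro S.finite_measure_mono_AE) (auto elim!: eventually_mono)
    also have "\<dots> \<le> measure S C + measure S B" by (intro measure_Un_le) auto
    finally show ?thesis .
  qed
  have 2: "measure S C \<le> measure S W + measure S B"
  proof -
    have "measure S C \<le> measure S (W \<union> B)"
      using AE_unit eq by (intro S.finite_measure_mono_AE) (auto elim!: eventually_mono)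
    also have "\<dots> \<le> measure S W + measure S B" by (intro measure_Un_le) auto
    finally show ?thesis .
  qed
  have "measure S C = window_prob 1 2 J x J"
    unfolding C_def using x by (intro measure_window) auto
  then have "\<bar>measure S C - color_prob x\<bar> \<le> 2 / (real J + 1)"
    using window_prob_approx[of 1 2 x n J J] x by simp
  then show ?thesis using 1 2 B unfolding W_def by linarith
qed

lemma measure_factor_window:
  assumes late: "late \<longlonglongrightarrow> 0" and x: "x \<in> words n"
  shows "measure S {\<omega>. map (factor \<omega>) [i..i + int n - 1] = x} = color_prob x"
proof -
  let ?d = "\<bar>measure S {\<omega>. map (factor \<omega>) [i..i + int n - 1] = x} - color_prob x\<bar>"
  have "(\<lambda>J. 2 / (real J + 1)) \<longlonglongrightarrow> 0" by real_asymp
  then have "(\<lambda>J. real n * late J + 2 / (real J + 1)) \<longlonglongrightarrow> real n * 0 + 0"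
    by (intro tendsto_add tendsto_mult tendsto_const late)
  then have "?d \<le> real n * 0 + 0"
    by (rule LIMSEQ_le_const) (use window_approx[OF x, of i] in auto)
  then show ?thesis by simp
qed

section \<open>One-dependence\<close>

text \<open>Words whose letters lie in prescribed sets, and the probability of finding such a word. The set
  \<open>{1..4}\<close> imposes no constraint.\<close>
definition words_in :: "nat set list \<Rightarrow> nat list set" where
  "words_in Es = {x. list_all2 (\<in>) x Es}"

definition pattern_prob :: "nat set list \<Rightarrow> real" where
  "pattern_prob Es = (\<Sum>x\<in>words_in Es. color_prob x)"

lemma words_in_words: "\<forall>E\<in>set Es. E \<subseteq> {1..4} \<Longrightarrow> words_in Es \<subseteq> words (length Es)"
  by (fastforce simp: words_in_def words_def list_all2_conv_all_nth in_set_conv_nth)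

lemma finite_words_in: "\<forall>E\<in>set Es. E \<subseteq> {1..4} \<Longrightarrow> finite (words_in Es)"
  using finite_subset[OF words_in_words finite_words] .

lemma pattern_prob_Nil [simp]: "pattern_prob [] = 1"
  by (simp add: pattern_prob_def words_in_def)

lemma pattern_prob_split:
  assumes "\<forall>E\<in>set Es. E \<subseteq> {1..4}" "\<forall>E\<in>set Fs. E \<subseteq> {1..4}"
  shows "pattern_prob (Es @ {1..4} # Fs) = pattern_prob Es * pattern_prob Fs"
proof -
  let ?n = "length Es"
  have "pattern_prob (Es @ {1..4} # Fs) = (\<Sum>(u, v, c)\<in>words_in Es \<times> words_in Fs \<times> {1..4}. color_prob (u @ c # v))"
    unfolding pattern_prob_def
  proof (rule sum.reindex_bij_witness[of _ "\<lambda>(u, v, c). u @ c # v" "\<lambda>x. (take ?n x, drop (Suc ?n) x, x ! ?n)"], goal_cases)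
    case (1 x)
    then have "?n < length x" by (auto simp: words_in_def dest: list_all2_lengthD)
    then show ?case by (simp add: id_take_nth_drop[symmetric])
  next
    case (2 x)
    then obtain u c v where x: "x = u @ c # v" "list_all2 (\<in>) u Es" "c \<in> {1..4}" "list_all2 (\<in>) v Fs"
      by (auto simp: words_in_def list_all2_append2 list_all2_Cons2)
    then have "length u = ?n" by (auto dest: list_all2_lengthD)
    then show ?case using x nth_append_length[of u c v] by (auto simp: words_in_def)
  next
    case (3 b)
    obtain u v c where b: "b = (u, v, c)" by (cases b)
    have "length u = ?n" using 3 b by (auto simp: words_in_def dest: list_all2_lengthD)
    then show ?case using b nth_append_length[of u c v] by simp
  next
    case (4 b)
    then show ?case by (auto simp: words_in_def intro!: list_all2_appendI)
  next
    case (5 x)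
    then have "?n < length x" by (auto simp: words_in_def dest: list_all2_lengthD)
    then show ?case by (simp add: id_take_nth_drop[symmetric])
  qed
  also have "\<dots> = (\<Sum>u\<in>words_in Es. \<Sum>v\<in>words_in Fs. \<Sum>c\<in>{1..4}. color_prob (u @ c # v))"
    using assms by (simp add: sum.cartesian_product[symmetric] finite_words_in)
  also have "\<dots> = (\<Sum>u\<in>words_in Es. \<Sum>v\<in>words_in Fs. color_prob u * color_prob v)"
    using words_in_words[OF assms(1)] words_in_words[OF assms(2)]
    by (intro sum.cong refl color_prob_indep) (auto simp: words_def)
  also have "\<dots> = pattern_prob Es * pattern_prob Fs"
    by (simp add: pattern_prob_def sum_product)
  finally show ?thesis .
qed

lemma pattern_prob_full: "\<forall>E\<in>set Es. E = {1..4} \<Longrightarrow> pattern_prob Es = 1"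
proof (induction Es)
  case (Cons E Es)
  then show ?case using pattern_prob_split[of "[]" Es] by auto
qed simp

text \<open>Two patterns with separated constraints. At a position where neither of them has a
  constraint both sides factorize; if there is no such position, then only one of the
  patterns has any constraint, since consecutive positions cannot be constrained by
  different patterns.\<close>
lemma pattern_prob_separated:
  assumes "length As = length Bs" "\<forall>E\<in>set As. E \<subseteq> {1..4}" "\<forall>E\<in>set Bs. E \<subseteq> {1..4}"
    and "\<And>i. i < length As \<Longrightarrow> As ! i = {1..4} \<or> Bs ! i = {1..4}"
    and "\<And>i. Suc i < length As \<Longrightarrow> As ! i = {1..4} \<or> Bs ! Suc i = {1..4}"
    and "\<And>i. Suc i < length As \<Longrightarrow> Bs ! i = {1..4} \<or> As ! Suc i = {1..4}"
  shows "pattern_prob (map2 (\<inter>) As Bs) = pattern_prob As * pattern_prob Bs"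
  using assms
proof (induction "length As" arbitrary: As Bs rule: less_induct)
  case less
  show ?case
  proof (cases "\<exists>p<length As. As ! p = {1..4} \<and> Bs ! p = {1..4}")
    case True
    then obtain p where p: "p < length As" "As ! p = {1..4}" "Bs ! p = {1..4}" by auto
    define A1 A2 B1 B2 where "A1 = take p As" and "A2 = drop (Suc p) As"
      and "B1 = take p Bs" and "B2 = drop (Suc p) Bs"
    have A: "As = A1 @ {1..4} # A2" and B: "Bs = B1 @ {1..4} # B2"
      using p less.prems(1) id_take_nth_drop[of p As] id_take_nth_drop[of p Bs]
      by (simp_all add: A1_def A2_def B1_def B2_def)
    have l: "length A1 = length B1" "length A2 = length B2" "length A1 = p"
      using p less.prems(1) by (auto simp: A1_def A2_def B1_def B2_def)
    have sub: "\<forall>E\<in>set A1. E \<subseteq> {1..4}" "\<forall>E\<in>set A2. E \<subseteq> {1..4}" "\<forall>E\<in>set B1. E \<subseteq> {1..4}" "\<forall>E\<in>set B2. E \<subseteq> {1..4}"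
      using less.prems(2,3) unfolding A B by auto
    have sub2: "\<forall>E\<in>set (map2 (\<inter>) A1 B1). E \<subseteq> {1..4}" "\<forall>E\<in>set (map2 (\<inter>) A2 B2). E \<subseteq> {1..4}"
      using sub by (auto dest!: set_zip_leftD)
    have 1: "pattern_prob (map2 (\<inter>) A1 B1) = pattern_prob A1 * pattern_prob B1"
    proof (rule less.hyps)
      fix i
      show "i < length A1 \<Longrightarrow> A1 ! i = {1..4} \<or> B1 ! i = {1..4}"
        using less.prems(4)[of i] l p by (simp add: A1_def B1_def)
      show "Suc i < length A1 \<Longrightarrow> A1 ! i = {1..4} \<or> B1 ! Suc i = {1..4}"
        using less.prems(5)[of i] l p by (simp add: A1_def B1_def)
      show "Suc i < length A1 \<Longrightarrow> B1 ! i = {1..4} \<or> A1 ! Suc i = {1..4}"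
        using less.prems(6)[of i] l p by (simp add: A1_def B1_def)
    qed (use p l sub in auto)
    have 2: "pattern_prob (map2 (\<inter>) A2 B2) = pattern_prob A2 * pattern_prob B2"
    proof (rule less.hyps)
      fix i
      show "i < length A2 \<Longrightarrow> A2 ! i = {1..4} \<or> B2 ! i = {1..4}"
        using less.prems(4)[of "Suc p + i"] l p less.prems(1) by (simp add: A2_def B2_def)
      show "Suc i < length A2 \<Longrightarrow> A2 ! i = {1..4} \<or> B2 ! Suc i = {1..4}"
        using less.prems(5)[of "Suc p + i"] l p less.prems(1) by (simp add: A2_def B2_def)
      show "Suc i < length A2 \<Longrightarrow> B2 ! i = {1..4} \<or> A2 ! Suc i = {1..4}"
        using less.prems(6)[of "Suc p + i"] l p less.prems(1) by (simp add: A2_def B2_def)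
      show "length A2 < length As" using p by (simp add: A2_def)
    qed (use p l sub in auto)
    have "map2 (\<inter>) As Bs = map2 (\<inter>) A1 B1 @ {1..4} # map2 (\<inter>) A2 B2"
      unfolding A B using l by simp
    then have "pattern_prob (map2 (\<inter>) As Bs) = pattern_prob A1 * pattern_prob B1 * (pattern_prob A2 * pattern_prob B2)"
      using pattern_prob_split[OF sub2] 1 2 by simp
    also have "\<dots> = pattern_prob As * pattern_prob Bs"
      unfolding A B using pattern_prob_split sub by simp
    finally show ?thesis .
  next
    case False
    have same: "As ! i = {1..4} \<longleftrightarrow> As ! 0 = {1..4}" if "i < length As" for i
      using that
    proof (induction i)
      case (Suc i)
      then show ?case using less.prems(4)[of i] less.prems(4)[of "Suc i"] less.prems(5)[of i] less.prems(6)[of i] False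
        by (metis Suc_lessD)
    qed simp
    show ?thesis
    proof (cases "As ! 0 = {1..4}")
      case True
      then have a: "\<forall>E\<in>set As. E = {1..4}" using same by (auto simp: in_set_conv_nth)
      have "As ! i \<inter> Bs ! i = Bs ! i" if "i < length Bs" for i
        proof -
        have "As ! i = {1..4}" using a less.prems(1) that by simp
        moreover have "Bs ! i \<subseteq> {1..4}" using less.prems(3) that by simp
        ultimately show ?thesis by blast
      qed
      then have "map2 (\<inter>) As Bs = Bs"
        using less.prems(1) by (intro nth_equalityI) auto
      then show ?thesis using pattern_prob_full[OF a] by simp
    next
      case F: False
      then have b: "\<forall>E\<in>set Bs. E = {1..4}" using same less.prems(1,4) by (metis in_set_conv_nth)
      have "As ! i \<inter> Bs ! i = As ! i" if "i < length As" for i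
        proof -
        have "Bs ! i = {1..4}" using b less.prems(1) that by simp
        moreover have "As ! i \<subseteq> {1..4}" using less.prems(2) that by simp
        ultimately show ?thesis by blast
      qed
      then have "map2 (\<inter>) As Bs = As"
        using less.prems(1) by (intro nth_equalityI) auto
      then show ?thesis using pattern_prob_full[OF b] by simp
    qed
  qed
qed

text \<open>The coloring obeys the constraints \<open>E\<close>.\<close>
definition pattern :: "(int \<Rightarrow> nat set) \<Rightarrow> (int \<Rightarrow> nat \<Rightarrow> real) set" where
  "pattern E = {\<omega>. \<forall>j. factor \<omega> j \<in> E j}"

lemma measure_pattern:
  assumes late: "late \<longlonglongrightarrow> 0" and E: "\<And>j. E j \<subseteq> {1..4}" and supp: "\<And>j. j \<notin> {lo..hi} \<Longrightarrow> E j = {1..4}"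
  shows "measure S (pattern E) = pattern_prob (map E [lo..hi])"
proof -
  define n where "n = length [lo..hi]"
  have hi: "[lo..hi] = [lo..lo + int n - 1]" by (simp add: n_def)
  have sub: "\<forall>e\<in>set (map E [lo..hi]). e \<subseteq> {1..4}" using E by auto
  have outside: "factor \<omega> j \<in> E j" if "j \<notin> {lo..hi}" for \<omega> j using supp[OF that] factor_in by simp
  have "pattern E = (\<Union>x\<in>words_in (map E [lo..hi]). {\<omega>. map (factor \<omega>) [lo..lo + int n - 1] = x})"
  proof -
    have "\<omega> \<in> pattern E \<longleftrightarrow> (\<forall>j\<in>set [lo..hi]. factor \<omega> j \<in> E j)" for \<omega>
      using outside by (auto simp: pattern_def)
    then show ?thesis
      unfolding hi[symmetric] by (auto simp: words_in_def list_all2_map1 list_all2_map2 list_all2_same)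
  qed
  also have "measure S \<dots> = (\<Sum>x\<in>words_in (map E [lo..hi]). measure S {\<omega>. map (factor \<omega>) [lo..lo + int n - 1] = x})"
  proof (rule S.finite_measure_finite_Union)
    show "finite (words_in (map E [lo..hi]))" using finite_words_in[OF sub] .
    have "{\<omega>. map (factor \<omega>) L = x} \<in> sets S" for x and L :: "int list"
    proof -
      have "{\<omega>. map (factor \<omega>) L = x} = {\<omega>\<in>space S. length x = length L \<and> (\<forall>k\<in>{..<length L}. factor \<omega> (L ! k) = x ! k)}"
        by (auto simp: list_eq_iff_nth_eq)
      also have "\<dots> \<in> sets S" by measurable
      finally show ?thesis .
    qed
    then show "(\<lambda>x. {\<omega>. map (factor \<omega>) [lo..lo + int n - 1] = x}) ` words_in (map E [lo..hi]) \<subseteq> sets S" by auto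
  qed (auto simp: disjoint_family_on_def)
  also have "\<dots> = pattern_prob (map E [lo..hi])"
    unfolding pattern_prob_def using words_in_words[OF sub]
    by (intro sum.cong refl measure_factor_window[OF late]) (auto simp: n_def)
  finally show ?thesis .
qed

lemma measure_pattern_indep:
  assumes late: "late \<longlonglongrightarrow> 0" and sep: "\<And>a b. a \<in> A \<Longrightarrow> b \<in> B \<Longrightarrow> \<bar>a - b\<bar> > 1"
    and E: "\<And>j. E j \<subseteq> {1..4}" "finite {j. E j \<noteq> {1..4}}" "{j. E j \<noteq> {1..4}} \<subseteq> A"
    and E': "\<And>j. E' j \<subseteq> {1..4}" "finite {j. E' j \<noteq> {1..4}}" "{j. E' j \<noteq> {1..4}} \<subseteq> B"
  shows "measure S (pattern E \<inter> pattern E') = measure S (pattern E) * measure S (pattern E')"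
proof -
  let ?K = "{j. E j \<noteq> {1..4}} \<union> {j. E' j \<noteq> {1..4}} \<union> {0}"
  have fin: "finite ?K" using E E' by simp
  define lo hi where "lo = Min ?K" and "hi = Max ?K"
  have K: "j \<in> {lo..hi}" if "j \<in> ?K" for j
    using fin that by (simp add: lo_def hi_def del: Un_iff Un_insert_right)
  have s1: "E j = {1..4}" "E' j = {1..4}" if "j \<notin> {lo..hi}" for j
    using K[of j] that by auto
  have "pattern E \<inter> pattern E' = pattern (\<lambda>j. E j \<inter> E' j)" by (auto simp: pattern_def)
  then have "measure S (pattern E \<inter> pattern E') = pattern_prob (map (\<lambda>j. E j \<inter> E' j) [lo..hi])"
    using measure_pattern[OF late, of "\<lambda>j. E j \<inter> E' j" lo hi] E E' s1 by auto
  also have "map (\<lambda>j. E j \<inter> E' j) [lo..hi] = map2 (\<inter>) (map E [lo..hi]) (map E' [lo..hi])"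
    by (intro nth_equalityI) auto
  also have "pattern_prob \<dots> = pattern_prob (map E [lo..hi]) * pattern_prob (map E' [lo..hi])"
  proof (rule pattern_prob_separated)
    have cross: "E j = {1..4} \<or> E' j' = {1..4}" if "\<bar>j - j'\<bar> \<le> 1" for j j'
      using sep[of j j'] E(3) E'(3) that by fastforce
    fix i
    show "i < length (map E [lo..hi]) \<Longrightarrow> map E [lo..hi] ! i = {1..4} \<or> map E' [lo..hi] ! i = {1..4}"
      using cross by simp
    show "Suc i < length (map E [lo..hi]) \<Longrightarrow> map E [lo..hi] ! i = {1..4} \<or> map E' [lo..hi] ! Suc i = {1..4}"
      using cross by simp
    show "Suc i < length (map E [lo..hi]) \<Longrightarrow> map E' [lo..hi] ! i = {1..4} \<or> map E [lo..hi] ! Suc i = {1..4}"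
      using cross[of "lo + int (Suc i)" "lo + int i"] by auto
  qed (use E E' in auto)
  also have "\<dots> = measure S (pattern E) * measure S (pattern E')"
    using measure_pattern[OF late, of E lo hi] measure_pattern[OF late, of E' lo hi] E E' s1 by auto
  finally show ?thesis .
qed

text \<open>Finitely many constraints at sites of \<open>A\<close>: a \<open>\<pi>\<close>-system that generates the information in the colors on \<open>A\<close>.\<close>
definition cylinders :: "int set \<Rightarrow> (int \<Rightarrow> nat \<Rightarrow> real) set set" where
  "cylinders A = pattern ` {E. (\<forall>j. E j \<subseteq> {1..4}) \<and> finite {j. E j \<noteq> {1..4}} \<and> {j. E j \<noteq> {1..4}} \<subseteq> A}"

lemma Int_stable_cylinders: "Int_stable (cylinders A)"
proof (rule Int_stableI)
  fix a b assume "a \<in> cylinders A" "b \<in> cylinders A"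
  then obtain E E' where E: "a = pattern E" "\<forall>j. E j \<subseteq> {1..4}" "finite {j. E j \<noteq> {1..4}}" "{j. E j \<noteq> {1..4}} \<subseteq> A"
    and E': "b = pattern E'" "\<forall>j. E' j \<subseteq> {1..4}" "finite {j. E' j \<noteq> {1..4}}" "{j. E' j \<noteq> {1..4}} \<subseteq> A"
    by (auto simp: cylinders_def)
  have "a \<inter> b = pattern (\<lambda>j. E j \<inter> E' j)" by (auto simp: pattern_def E E')
  moreover have sub: "{j. E j \<inter> E' j \<noteq> {1..4}} \<subseteq> {j. E j \<noteq> {1..4}} \<union> {j. E' j \<noteq> {1..4}}" by auto
  moreover have "finite {j. E j \<inter> E' j \<noteq> {1..4}}" using E E' by (intro finite_subset[OF sub]) auto
  ultimately show "a \<inter> b \<in> cylinders A" unfolding cylinders_def using E E'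
    by (intro image_eqI[of _ _ "\<lambda>j. E j \<inter> E' j"]) auto
qed

lemma cylinders_sets: "cylinders A \<subseteq> sets S"
proof
  fix a assume "a \<in> cylinders A"
  then obtain E where "a = pattern E" by (auto simp: cylinders_def)
  then have "a = {\<omega>\<in>space S. \<forall>j. factor \<omega> j \<in> E j}" by (simp add: pattern_def)
  also have "\<dots> \<in> sets S" by measurable
  finally show "a \<in> sets S" .
qed

lemma sigma_cylinders:
  assumes "Z \<in> sets (PiM A (\<lambda>_. colors 4))"
  shows "{\<omega>. (\<lambda>i\<in>A. factor \<omega> i) \<in> Z} \<in> sigma_sets UNIV (cylinders A)"
proof -
  have "(\<lambda>\<omega>. \<lambda>i\<in>A. factor \<omega> i) \<in> sigma UNIV (cylinders A) \<rightarrow>\<^sub>M PiM A (\<lambda>_. colors 4)"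
  proof (rule measurable_restrict)
    fix i assume i: "i \<in> A"
    have "{\<omega>. factor \<omega> i = c} \<in> sigma_sets UNIV (cylinders A)" if c: "c \<in> {1..4}" for c
    proof (rule sigma_sets.Basic)
      let ?E = "\<lambda>j. if j = i then {c} else {1..4}"
      have "{\<omega>. factor \<omega> i = c} = pattern ?E" using factor_in by (auto simp: pattern_def)
      moreover have sub: "{j. ?E j \<noteq> {1..4}} \<subseteq> {i}" by auto
      moreover have "finite {j. ?E j \<noteq> {1..4}}" by (rule finite_subset[OF sub]) simp
      ultimately show "{\<omega>. factor \<omega> i = c} \<in> cylinders A"
        unfolding cylinders_def using c i by (intro image_eqI[of _ _ ?E]) auto
    qed
    then show "(\<lambda>\<omega>. factor \<omega> i) \<in> sigma UNIV (cylinders A) \<rightarrow>\<^sub>M colors 4"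
      unfolding colors_def using factor_in
      by (subst measurable_count_space_eq2) (auto simp: vimage_def)
  qed
  from measurable_sets[OF this assms] show ?thesis
    by (simp add: vimage_def)
qed

lemma indep_factor:
  assumes late: "late \<longlonglongrightarrow> 0" and sep: "\<And>a b. a \<in> A \<Longrightarrow> b \<in> B \<Longrightarrow> \<bar>a - b\<bar> > 1"
  shows "S.indep_var (PiM A (\<lambda>_. colors 4)) (\<lambda>\<omega>. \<lambda>i\<in>A. factor \<omega> i) (PiM B (\<lambda>_. colors 4)) (\<lambda>\<omega>. \<lambda>i\<in>B. factor \<omega> i)"
proof -
  have "S.indep_set (cylinders A) (cylinders B)"
  proof (rule S.indep_setI[OF cylinders_sets cylinders_sets])
    fix a b assume "a \<in> cylinders A" "b \<in> cylinders B"
    then show "S.prob (a \<inter> b) = S.prob a * S.prob b"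
      using measure_pattern_indep[OF late sep] by (auto simp: cylinders_def)
  qed
  then have ind: "S.indep_set (sigma_sets (space S) (cylinders A)) (sigma_sets (space S) (cylinders B))"
    by (rule S.indep_set_sigma_sets) (rule Int_stable_cylinders)+
  have sub: "sigma_sets (space S) {(\<lambda>\<omega>. \<lambda>i\<in>A. factor \<omega> i) -` Z \<inter> space S | Z. Z \<in> sets (PiM A (\<lambda>_. colors 4))}
     \<subseteq> sigma_sets (space S) (cylinders A)" for A
    using sigma_cylinders by (intro sigma_sets_mono) (auto simp: vimage_def)
  have rv: "(\<lambda>\<omega>. \<lambda>i\<in>A. factor \<omega> i) \<in> S \<rightarrow>\<^sub>M PiM A (\<lambda>_. colors 4)" for A
    by (rule measurable_restrict) (rule measurable_factor_colors)
  have events: "sigma_sets (space S) {(\<lambda>\<omega>. \<lambda>i\<in>A. factor \<omega> i) -` Z \<inter> space S | Z. Z \<in> sets (PiM A (\<lambda>_. colors 4))} \<subseteq> sets S" for A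
    using sub[of A] sets.sigma_sets_subset[OF cylinders_sets, of A] by auto
  show ?thesis
    unfolding S.indep_var_eq
  proof (intro conjI rv S.indep_setI events)
    fix a b
    assume "a \<in> sigma_sets (space S) {(\<lambda>\<omega>. \<lambda>i\<in>A. factor \<omega> i) -` Z \<inter> space S | Z. Z \<in> sets (PiM A (\<lambda>_. colors 4))}"
      "b \<in> sigma_sets (space S) {(\<lambda>\<omega>. \<lambda>i\<in>B. factor \<omega> i) -` Z \<inter> space S | Z. Z \<in> sets (PiM B (\<lambda>_. colors 4))}"
    then show "S.prob (a \<inter> b) = S.prob a * S.prob b"
      using sub[of A] sub[of B] by (intro S.indep_setD[OF ind]) auto
  qed
qed

section \<open>Visible arrivals in dyadic time slots\<close>

text \<open>Slot \<open>k\<close> is the time interval from \<open>level (Suc k)\<close> to \<open>level k\<close>.\<close>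
definition level :: "nat \<Rightarrow> real" where
  "level k = (1/2) ^ k"

lemma level_props: "0 < level k" "level k \<le> 1" "level (Suc k) = level k / 2"
  by (auto simp: level_def power_le_one)

lemma level_mono: "k \<le> m \<Longrightarrow> level m \<le> level k"
  by (simp add: level_def power_decreasing)

text \<open>Deletion of the site next to the origin on the side \<open>e\<close>, where \<open>e\<close> is \<open>1\<close> or \<open>-1\<close>.\<close>
definition drop_first :: "int \<Rightarrow> (int \<Rightarrow> 'a) \<Rightarrow> int \<Rightarrow> 'a" where
  "drop_first e \<omega> = (\<lambda>j. \<omega> (if 0 < e * j then j + e else j))"

abbreviation dir :: "int \<Rightarrow> bool" where
  "dir e \<equiv> e = 1 \<or> e = -1"

lemma drop_first_nth: "dir e \<Longrightarrow> 0 < n \<Longrightarrow> drop_first e \<omega> (e * n) = \<omega> (e * (n + 1))"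
  by (auto simp: drop_first_def algebra_simps)

lemma drop_first_opp: "dir e \<Longrightarrow> 0 < n \<Longrightarrow> drop_first e \<omega> (- e * n) = \<omega> (- e * n)"
  by (auto simp: drop_first_def)

lemma measurable_drop_first: "drop_first e \<in> S \<rightarrow>\<^sub>M S"
  using measurable_S_reindex[of "\<lambda>j. if 0 < e * j then j + e else j"] by (simp add: drop_first_def[abs_def])

lemma sets_drop_first: "A \<in> sets S \<Longrightarrow> {\<omega>. drop_first e \<omega> \<in> A} \<in> sets S"
  using measurable_sets[OF measurable_drop_first, of A e] by (simp add: vimage_def)

lemma sets_coord: "B \<in> sets mark \<Longrightarrow> {\<omega>. \<omega> i \<in> B} \<in> sets S"
  using measurable_sets[OF measurable_S_coord, of B i] by (simp add: vimage_def)

lemma measure_coord: "B \<in> sets mark \<Longrightarrow> measure S {\<omega>. \<omega> i \<in> B} = measure mark B"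
proof -
  assume B: "B \<in> sets mark"
  have "measure mark B = measure (distr S mark (\<lambda>\<omega>. \<omega> i)) B"
    using distr_PiM_component[of "UNIV :: int set" "\<lambda>_. mark" i] by (simp add: prob_space_mark)
  also have "\<dots> = measure S {\<omega>. \<omega> i \<in> B}"
    using B by (subst measure_distr) (auto simp: vimage_def measurable_S_coord)
  finally show ?thesis ..
qed

lemma measure_drop_first:
  assumes e: "dir e" and B: "B \<in> sets mark" and A: "A \<in> sets S"
  shows "measure S {\<omega>. \<omega> e \<in> B \<and> drop_first e \<omega> \<in> A} = measure mark B * measure S A"
proof -
  have "measure S ({\<omega>. \<omega> e \<in> B} \<inter> {\<omega>. drop_first e \<omega> \<in> A}) = measure S {\<omega>. \<omega> e \<in> B} * measure S {\<omega>. drop_first e \<omega> \<in> A}"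
  proof (rule indep_dep_on[of _ "{e}" _ "- {e}"])
    show "dep_on (- {e}) {\<omega>. drop_first e \<omega> \<in> A}"
      unfolding dep_on_def
    proof (intro allI impI)
      fix \<omega> \<omega>' :: "int \<Rightarrow> nat \<Rightarrow> real"
      assume "\<forall>i\<in>- {e}. \<omega> i = \<omega>' i"
      then have "drop_first e \<omega> = drop_first e \<omega>'" using e by (auto simp: drop_first_def fun_eq_iff)
      then show "\<omega> \<in> {\<omega>. drop_first e \<omega> \<in> A} \<longleftrightarrow> \<omega>' \<in> {\<omega>. drop_first e \<omega> \<in> A}" by simp
    qed
  qed (use A B in \<open>auto simp: dep_on_def intro: sets_drop_first sets_coord\<close>)
  also have "measure S {\<omega>. drop_first e \<omega> \<in> A} = measure S A"
    unfolding drop_first_def using e A by (intro measure_S_reindex) (auto simp: inj_def split: if_splits)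
  finally show ?thesis using measure_coord[OF B] by (simp add: Int_def)
qed

lemma measure_mark_interval:
  assumes "0 \<le> s" "s \<le> s'" "s' \<le> 1"
  shows "measure mark {y. s < y 0 \<and> y 0 \<le> s' \<and> coin y = v} = (s' - s) / 2"
proof -
  have st: "{y. s < y 0 \<and> y 0 \<le> s' \<and> coin y = v} \<in> sets mark"
  proof -
    have "{y\<in>space mark. s < y 0 \<and> y 0 \<le> s' \<and> coin y = v} \<in> sets mark" by measurable
    then show ?thesis by simp
  qed
  have "emeasure mark {y. s < y 0 \<and> y 0 \<le> s' \<and> coin y = v} =
      (\<integral>\<^sup>+y. indicator {s<..s'} (y 0) * indicator {y. coin y = v} y \<partial>mark)"
    using st by (subst nn_integral_indicator[symmetric]) (auto intro!: nn_integral_cong simp del: nn_integral_indicator simp: indicator_def)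
  also have "\<dots> = (\<integral>\<^sup>+x. indicator {s<..s'} x \<partial>unif) / 2"
    by (rule nn_integral_mark) measurable
  also have "(\<integral>\<^sup>+x. indicator {s<..s'} x \<partial>unif) = emeasure unif {s<..s'}"
    by (rule nn_integral_indicator) simp
  also have "\<dots> = ennreal (s' - s)"
  proof -
    have "{0..1} \<inter> {s<..s'} = {s<..s'}" using assms by auto
    then show ?thesis using assms by (subst emeasure_uniform_measure) (auto simp: divide_ennreal_def)
  qed
  also have "ennreal (s' - s) / 2 = ennreal ((s' - s) / 2)"
    using assms by (subst divide_ennreal[symmetric]) auto
  finally show ?thesis using assms by (simp add: measure_def)
qed

lemma measure_mark_above:
  assumes "0 \<le> s" "s \<le> 1"
  shows "measure mark {y. s < y 0} = 1 - s"
proof -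
  have st: "{y. s < y 0 \<and> y 0 \<le> 1 \<and> coin y = v} \<in> sets mark" "{y. s < y 0} \<in> sets mark" for v
  proof -
    have "{y\<in>space mark. s < y 0 \<and> y 0 \<le> 1 \<and> coin y = v} \<in> sets mark" "{y\<in>space mark. s < y 0} \<in> sets mark" by measurable
    then show "{y. s < y 0 \<and> y 0 \<le> 1 \<and> coin y = v} \<in> sets mark" "{y. s < y 0} \<in> sets mark" by simp_all
  qed
  have "AE y in mark. y 0 \<in> {0..1::real}"
    unfolding mark_def by (intro AE_PiM_component prob_space_unif AE_uniform_measureI) auto
  then have "measure mark {y. s < y 0} = measure mark ({y. s < y 0 \<and> y 0 \<le> 1 \<and> coin y = True} \<union> {y. s < y 0 \<and> y 0 \<le> 1 \<and> coin y = False})"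
    by (intro N.finite_measure_eq_AE sets.Un st) (elim eventually_mono, auto)
  also have "\<dots> = (1 - s) / 2 + (1 - s) / 2"
    using assms by (subst N.finite_measure_Union) (auto simp only: st measure_mark_interval)
  finally show ?thesis by simp
qed

lemma sets_mark_above [measurable]: "{y. s < y 0} \<in> sets mark"
proof -
  have "{y\<in>space mark. s < y 0} \<in> sets mark" by measurable
  then show ?thesis by simp
qed

lemma sets_mark_interval [measurable]: "{y. s < y 0 \<and> y 0 \<le> s' \<and> coin y = v} \<in> sets mark"
proof -
  have "{y\<in>space mark. s < y 0 \<and> y 0 \<le> s' \<and> coin y = v} \<in> sets mark" by measurable
  then show ?thesis by simp
qed

text \<open>On the side \<open>e\<close> the nearest site with arrival time at most \<open>level k\<close> is at distance \<open>n\<close>.\<close>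
definition first_hit :: "int \<Rightarrow> nat \<Rightarrow> int \<Rightarrow> (int \<Rightarrow> nat \<Rightarrow> real) \<Rightarrow> bool" where
  "first_hit e k n \<omega> \<longleftrightarrow> 1 \<le> n \<and> \<omega> (e * n) 0 \<le> level k \<and> (\<forall>j\<in>{1..<n}. level k < \<omega> (e * j) 0)"

text \<open>On the side \<open>e\<close> no site that is visible from the origin arrives in slot \<open>k\<close>: the nearest site that is older than the
  upper end of the slot is also older than its lower end. (A site is visible if it arrives before every site
  between it and the origin.)\<close>
definition no_point :: "int \<Rightarrow> nat \<Rightarrow> (int \<Rightarrow> nat \<Rightarrow> real) set" where
  "no_point e k = {\<omega>. \<exists>n. first_hit e k n \<omega> \<and> \<omega> (e * n) 0 \<le> level (Suc k)}"

text \<open>On the side \<open>e\<close> exactly one site arrives in slot \<open>k\<close> before the nearest one that is older than the slot,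
  and its coin is \<open>v\<close>.\<close>
definition one_point :: "int \<Rightarrow> nat \<Rightarrow> bool \<Rightarrow> (int \<Rightarrow> nat \<Rightarrow> real) set" where
  "one_point e k v = {\<omega>. \<exists>n. first_hit e k n \<omega> \<and> level (Suc k) < \<omega> (e * n) 0 \<and> coin (\<omega> (e * n)) = v \<and>
     (\<exists>n'>n. \<omega> (e * n') 0 \<le> level (Suc k) \<and> (\<forall>j\<in>{n<..<n'}. level k < \<omega> (e * j) 0))}"

lemma sets_no_point [measurable]: "no_point e k \<in> sets S"
proof -
  have "no_point e k = {\<omega>\<in>space S. \<exists>n. first_hit e k n \<omega> \<and> \<omega> (e * n) 0 \<le> level (Suc k)}"
    by (simp add: no_point_def)
  also have "\<dots> \<in> sets S" unfolding first_hit_def by measurable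
  finally show ?thesis .
qed

lemma sets_one_point [measurable]: "one_point e k v \<in> sets S"
proof -
  have "one_point e k v = {\<omega>\<in>space S. \<exists>n. first_hit e k n \<omega> \<and> level (Suc k) < \<omega> (e * n) 0 \<and> coin (\<omega> (e * n)) = v \<and>
     (\<exists>n'>n. \<omega> (e * n') 0 \<le> level (Suc k) \<and> (\<forall>j\<in>{n<..<n'}. level k < \<omega> (e * j) 0))}"
    by (simp add: one_point_def)
  also have "\<dots> \<in> sets S" unfolding first_hit_def by measurable
  finally show ?thesis .
qed

lemma first_hit_drop_first:
  assumes e: "dir e"
  shows "first_hit e k n \<omega> \<longleftrightarrow> (if level k < \<omega> e 0 then first_hit e k (n - 1) (drop_first e \<omega>) else n = 1)"
proof (cases "level k < \<omega> e 0")
  case False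
  have "n = 1" if "first_hit e k n \<omega>"
  proof (rule ccontr)
    assume "n \<noteq> 1"
    then have "1 \<in> {1..<n}" using that by (auto simp: first_hit_def)
    then have "level k < \<omega> (e * 1) 0" using that unfolding first_hit_def by blast
    then show False using False by simp
  qed
  moreover have "first_hit e k 1 \<omega>" using False by (auto simp: first_hit_def)
  ultimately show ?thesis using False by auto
next
  case True
  have "n \<noteq> 1" if "first_hit e k n \<omega>" using that True by (auto simp: first_hit_def)
  moreover have "first_hit e k n \<omega> \<longleftrightarrow> first_hit e k (n - 1) (drop_first e \<omega>)" if n: "2 \<le> n"
  proof -
    have 1: "drop_first e \<omega> (e * (n - 1)) = \<omega> (e * n)" using drop_first_nth[OF e, of "n - 1" \<omega>] n by simp
    have "(\<forall>j\<in>{1..<n}. level k < \<omega> (e * j) 0) \<longleftrightarrow> (\<forall>j\<in>{1..<n - 1}. level k < drop_first e \<omega> (e * j) 0)"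
    proof
      assume h: "\<forall>j\<in>{1..<n}. level k < \<omega> (e * j) 0"
      show "\<forall>j\<in>{1..<n - 1}. level k < drop_first e \<omega> (e * j) 0"
        using h by (auto simp: drop_first_nth[OF e])
    next
      assume h: "\<forall>j\<in>{1..<n - 1}. level k < drop_first e \<omega> (e * j) 0"
      show "\<forall>j\<in>{1..<n}. level k < \<omega> (e * j) 0"
      proof
        fix j assume j: "j \<in> {1..<n}"
        show "level k < \<omega> (e * j) 0"
        proof (cases "j = 1")
          case False
          then have "level k < drop_first e \<omega> (e * (j - 1)) 0" using h j by auto
          then show ?thesis using drop_first_nth[OF e, of "j - 1" \<omega>] j False by simp
        qed (use True in simp)
      qed
    qed
    then show ?thesis using n 1 by (auto simp: first_hit_def)
  qed
  moreover have "2 \<le> n" if "first_hit e k (n - 1) (drop_first e \<omega>)" using that by (auto simp: first_hit_def)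
  moreover have "1 \<le> n" if "first_hit e k n \<omega>" using that by (auto simp: first_hit_def)
  ultimately show ?thesis using True by (metis add1_zle_eq one_add_one order_le_less)
qed

lemma first_hit_pos: "first_hit e k n \<omega> \<Longrightarrow> 1 \<le> n"
  by (simp add: first_hit_def)

lemma no_point_drop_first:
  assumes e: "dir e"
  shows "\<omega> \<in> no_point e k \<longleftrightarrow> (if level k < \<omega> e 0 then drop_first e \<omega> \<in> no_point e k else \<omega> e 0 \<le> level (Suc k))"
proof (cases "level k < \<omega> e 0")
  case True
  have "(\<exists>n. first_hit e k (n - 1) (drop_first e \<omega>) \<and> \<omega> (e * n) 0 \<le> level (Suc k)) \<longleftrightarrow> drop_first e \<omega> \<in> no_point e k"
  proof
    assume "\<exists>n. first_hit e k (n - 1) (drop_first e \<omega>) \<and> \<omega> (e * n) 0 \<le> level (Suc k)"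
    then obtain n where n: "first_hit e k (n - 1) (drop_first e \<omega>)" "\<omega> (e * n) 0 \<le> level (Suc k)" by auto
    then show "drop_first e \<omega> \<in> no_point e k"
      using drop_first_nth[OF e, of "n - 1" \<omega>] first_hit_pos[OF n(1)] by (auto simp: no_point_def intro!: exI[of _ "n - 1"])
  next
    assume "drop_first e \<omega> \<in> no_point e k"
    then obtain n where n: "first_hit e k n (drop_first e \<omega>)" "drop_first e \<omega> (e * n) 0 \<le> level (Suc k)" by (auto simp: no_point_def)
    then show "\<exists>n. first_hit e k (n - 1) (drop_first e \<omega>) \<and> \<omega> (e * n) 0 \<le> level (Suc k)"
      using drop_first_nth[OF e, of n \<omega>] first_hit_pos[OF n(1)] by (intro exI[of _ "n + 1"]) auto
  qed
  then show ?thesis using True first_hit_drop_first[OF e, of k _ \<omega>] by (simp add: no_point_def)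
next
  case False
  then show ?thesis using first_hit_drop_first[OF e, of k _ \<omega>] by (simp add: no_point_def)
qed

lemma one_point_drop_first:
  assumes e: "dir e"
  shows "\<omega> \<in> one_point e k v \<longleftrightarrow> (if level k < \<omega> e 0 then drop_first e \<omega> \<in> one_point e k v
     else level (Suc k) < \<omega> e 0 \<and> coin (\<omega> e) = v \<and> drop_first e \<omega> \<in> no_point e k)"
proof (cases "level k < \<omega> e 0")
  case True
  let ?P = "\<lambda>n \<omega>. level (Suc k) < \<omega> (e * n) 0 \<and> coin (\<omega> (e * n)) = v \<and>
     (\<exists>n'>n. \<omega> (e * n') 0 \<le> level (Suc k) \<and> (\<forall>j\<in>{n<..<n'}. level k < \<omega> (e * j) 0))"
  have P: "?P n (drop_first e \<omega>) \<longleftrightarrow> ?P (n + 1) \<omega>" if n: "1 \<le> n" for n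
  proof -
    have "(\<exists>n'>n. drop_first e \<omega> (e * n') 0 \<le> level (Suc k) \<and> (\<forall>j\<in>{n<..<n'}. level k < drop_first e \<omega> (e * j) 0)) \<longleftrightarrow>
       (\<exists>n'>n + 1. \<omega> (e * n') 0 \<le> level (Suc k) \<and> (\<forall>j\<in>{n + 1<..<n'}. level k < \<omega> (e * j) 0))"
    proof
      assume "\<exists>n'>n. drop_first e \<omega> (e * n') 0 \<le> level (Suc k) \<and> (\<forall>j\<in>{n<..<n'}. level k < drop_first e \<omega> (e * j) 0)"
      then obtain n' where n': "n < n'" "drop_first e \<omega> (e * n') 0 \<le> level (Suc k)" "\<forall>j\<in>{n<..<n'}. level k < drop_first e \<omega> (e * j) 0" by blast
      have "level k < \<omega> (e * j) 0" if "j \<in> {n + 1<..<n' + 1}" for j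
        using n'(3)[rule_format, of "j - 1"] drop_first_nth[OF e, of "j - 1" \<omega>] that n by auto
      then show "\<exists>n'>n + 1. \<omega> (e * n') 0 \<le> level (Suc k) \<and> (\<forall>j\<in>{n + 1<..<n'}. level k < \<omega> (e * j) 0)"
        using n' drop_first_nth[OF e, of n' \<omega>] n by (intro exI[of _ "n' + 1"]) auto
    next
      assume "\<exists>n'>n + 1. \<omega> (e * n') 0 \<le> level (Suc k) \<and> (\<forall>j\<in>{n + 1<..<n'}. level k < \<omega> (e * j) 0)"
      then obtain n' where n': "n + 1 < n'" "\<omega> (e * n') 0 \<le> level (Suc k)" "\<forall>j\<in>{n + 1<..<n'}. level k < \<omega> (e * j) 0" by blast
      have "level k < drop_first e \<omega> (e * j) 0" if "j \<in> {n<..<n' - 1}" for j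
        using n'(3)[rule_format, of "j + 1"] drop_first_nth[OF e, of j \<omega>] that n by auto
      then show "\<exists>n'>n. drop_first e \<omega> (e * n') 0 \<le> level (Suc k) \<and> (\<forall>j\<in>{n<..<n'}. level k < drop_first e \<omega> (e * j) 0)"
        using n' drop_first_nth[OF e, of "n' - 1" \<omega>] n by (intro exI[of _ "n' - 1"]) auto
    qed
    then show ?thesis using drop_first_nth[OF e, of n \<omega>] n by simp
  qed
  have "(\<exists>n. first_hit e k (n - 1) (drop_first e \<omega>) \<and> ?P n \<omega>) \<longleftrightarrow> (\<exists>n. first_hit e k n (drop_first e \<omega>) \<and> ?P n (drop_first e \<omega>))"
  proof
    assume "\<exists>n. first_hit e k (n - 1) (drop_first e \<omega>) \<and> ?P n \<omega>"
    then obtain n where n: "first_hit e k (n - 1) (drop_first e \<omega>)" "?P n \<omega>" by blast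
    then have "?P (n - 1) (drop_first e \<omega>)" using P[OF first_hit_pos[OF n(1)]] by (simp only: diff_add_cancel)
    with n(1) show "\<exists>n. first_hit e k n (drop_first e \<omega>) \<and> ?P n (drop_first e \<omega>)" by blast
  next
    assume "\<exists>n. first_hit e k n (drop_first e \<omega>) \<and> ?P n (drop_first e \<omega>)"
    then obtain n where n: "first_hit e k n (drop_first e \<omega>)" "?P n (drop_first e \<omega>)" by blast
    then have "?P (n + 1) \<omega>" using P[OF first_hit_pos[OF n(1)]] by blast
    moreover have "first_hit e k (n + 1 - 1) (drop_first e \<omega>)" using n(1) by simp
    ultimately show "\<exists>n. first_hit e k (n - 1) (drop_first e \<omega>) \<and> ?P n \<omega>" by blast
  qed
  then show ?thesis using True first_hit_drop_first[OF e, of k _ \<omega>] by (simp add: one_point_def)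
next
  case False
  have "(\<exists>n'>1. \<omega> (e * n') 0 \<le> level (Suc k) \<and> (\<forall>j\<in>{1<..<n'}. level k < \<omega> (e * j) 0)) \<longleftrightarrow> drop_first e \<omega> \<in> no_point e k"
  proof
    assume "\<exists>n'>1. \<omega> (e * n') 0 \<le> level (Suc k) \<and> (\<forall>j\<in>{1<..<n'}. level k < \<omega> (e * j) 0)"
    then obtain n' where n': "1 < n'" "\<omega> (e * n') 0 \<le> level (Suc k)" "\<forall>j\<in>{1<..<n'}. level k < \<omega> (e * j) 0" by blast
    have "level k < drop_first e \<omega> (e * j) 0" if "j \<in> {1..<n' - 1}" for j
      using n'(3)[rule_format, of "j + 1"] drop_first_nth[OF e, of j \<omega>] that by auto
    then have "first_hit e k (n' - 1) (drop_first e \<omega>)"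
      using n' drop_first_nth[OF e, of "n' - 1" \<omega>] level_mono[of k "Suc k"] by (auto simp: first_hit_def)
    then show "drop_first e \<omega> \<in> no_point e k"
      using n' drop_first_nth[OF e, of "n' - 1" \<omega>] by (auto simp: no_point_def intro!: exI[of _ "n' - 1"])
  next
    assume "drop_first e \<omega> \<in> no_point e k"
    then obtain n where n: "first_hit e k n (drop_first e \<omega>)" "drop_first e \<omega> (e * n) 0 \<le> level (Suc k)" by (auto simp: no_point_def)
    have "level k < \<omega> (e * j) 0" if "j \<in> {1<..<n + 1}" for j
      using n(1) that drop_first_nth[OF e, of "j - 1" \<omega>] by (auto simp: first_hit_def dest!: bspec[where x = "j - 1"])
    then show "\<exists>n'>1. \<omega> (e * n') 0 \<le> level (Suc k) \<and> (\<forall>j\<in>{1<..<n'}. level k < \<omega> (e * j) 0)"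
      using n drop_first_nth[OF e, of n \<omega>] first_hit_pos[OF n(1)] by (intro exI[of _ "n + 1"]) auto
  qed
  then show ?thesis using False first_hit_drop_first[OF e, of k _ \<omega>] by (simp add: one_point_def)
qed

text \<open>The event \<open>A\<close> depends on the side \<open>e\<close> only through the sequence of those sites that arrive at or before time
  \<open>level k\<close>. It suffices to express this for the first site: if that site is too young, it
  may be deleted.\<close>
definition insensitive :: "int \<Rightarrow> nat \<Rightarrow> (int \<Rightarrow> nat \<Rightarrow> real) set \<Rightarrow> bool" where
  "insensitive e k A \<longleftrightarrow> (\<forall>\<omega>. level k < \<omega> e 0 \<longrightarrow> (\<omega> \<in> A \<longleftrightarrow> drop_first e \<omega> \<in> A))"

text \<open>The first site on the side \<open>e\<close> arrives after \<open>c = level k\<close> with probability \<open>1 - c\<close>, and then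
  deleting it reproduces the same event. This gives a linear equation for the probability, and the same
  device yields \<open>measure_one_point\<close>.\<close>
lemma measure_no_point:
  assumes e: "dir e" and A: "A \<in> sets S" "insensitive e (Suc k) A"
  shows "measure S (no_point e k \<inter> A) = measure S A / 2"
proof -
  define c where "c = level k"
  have c: "0 < c" "c \<le> 1" "level (Suc k) = c / 2" using level_props[of k] by (auto simp: c_def)
  define a where "a = measure S (no_point e k \<inter> A)"
  let ?E1 = "{\<omega>. \<omega> e \<in> {y. c < y 0} \<and> drop_first e \<omega> \<in> no_point e k \<inter> A}"
  let ?E2 = "{\<omega>. \<omega> e \<in> {y. c / 2 < y 0} \<and> drop_first e \<omega> \<in> A}"
  have s1: "?E1 \<in> sets S"
    using sets.Int[OF sets_coord[of "{y. c < y 0}" e] sets_drop_first[of "no_point e k \<inter> A" e]] A(1) by (simp add: Int_def)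
  have s2: "?E2 \<in> sets S"
    using sets.Int[OF sets_coord[of "{y. c / 2 < y 0}" e] sets_drop_first[of A e]] A(1) by (simp only: Int_def mem_Collect_eq sets_mark_above simp_thms)
  have split: "no_point e k \<inter> A = ?E1 \<union> (A - ?E2)" "?E1 \<inter> (A - ?E2) = {}" "?E2 \<subseteq> A"
  proof -
    have "\<omega> \<in> no_point e k \<inter> A \<longleftrightarrow> \<omega> \<in> ?E1 \<union> (A - ?E2)" for \<omega>
    proof -
      have 1: "\<omega> \<in> no_point e k \<longleftrightarrow> (if c < \<omega> e 0 then drop_first e \<omega> \<in> no_point e k else \<not> c / 2 < \<omega> e 0)"
        using no_point_drop_first[OF e, of \<omega> k] by (simp only: c(3) c_def[symmetric] not_less)
      have 2: "c / 2 < \<omega> e 0 \<Longrightarrow> \<omega> \<in> A \<longleftrightarrow> drop_first e \<omega> \<in> A"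
        using A(2) unfolding insensitive_def c(3) by blast
      have 3: "c < \<omega> e 0 \<Longrightarrow> c / 2 < \<omega> e 0" using c by simp
      show ?thesis
        unfolding Int_iff Un_iff Diff_iff mem_Collect_eq using 1 2 3 by (cases "c < \<omega> e 0") metis+
    qed
    then show "no_point e k \<inter> A = ?E1 \<union> (A - ?E2)" by blast
    show "?E2 \<subseteq> A" using A(2) c unfolding insensitive_def by auto
    show "?E1 \<inter> (A - ?E2) = {}" using c by auto
  qed
  have "a = measure S (?E1 \<union> (A - ?E2))"
    unfolding a_def by (rule arg_cong[OF split(1)])
  also have "\<dots> = measure S ?E1 + measure S (A - ?E2)"
    using s1 s2 A(1) split(2) by (intro S.finite_measure_Union) auto
  also have "measure S (A - ?E2) = measure S A - measure S ?E2"
    using s2 A(1) split(3) by (intro S.finite_measure_Diff) auto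
  also have "measure S ?E1 = (1 - c) * a"
    unfolding a_def using c A e by (subst measure_drop_first) (auto simp: measure_mark_above)
  also have "measure S ?E2 = (1 - c / 2) * measure S A"
    using c A e by (subst measure_drop_first) (auto simp: measure_mark_above)
  finally have "c * a = c * (measure S A / 2)" by (simp add: algebra_simps)
  then show ?thesis using c by (simp add: a_def)
qed

lemma measure_one_point:
  assumes e: "dir e" and A: "A \<in> sets S" "insensitive e (Suc k) A"
  shows "measure S (one_point e k v \<inter> A) = measure S A / 8"
proof -
  define c where "c = level k"
  have c: "0 < c" "c \<le> 1" "level (Suc k) = c / 2" using level_props[of k] by (auto simp: c_def)
  define b where "b = measure S (one_point e k v \<inter> A)"
  let ?E1 = "{\<omega>. \<omega> e \<in> {y. c < y 0} \<and> drop_first e \<omega> \<in> one_point e k v \<inter> A}"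
  let ?E2 = "{\<omega>. \<omega> e \<in> {y. c / 2 < y 0 \<and> y 0 \<le> c \<and> coin y = v} \<and> drop_first e \<omega> \<in> no_point e k \<inter> A}"
  have s1: "?E1 \<in> sets S"
    using sets.Int[OF sets_coord[of "{y. c < y 0}" e] sets_drop_first[of "one_point e k v \<inter> A" e]] A(1) by (simp add: Int_def)
  have s2: "?E2 \<in> sets S"
    using sets.Int[OF sets_coord[OF sets_mark_interval[of "c / 2" c v], of e] sets_drop_first[of "no_point e k \<inter> A" e]] A(1) by (simp add: Int_def)
  have split: "one_point e k v \<inter> A = ?E1 \<union> ?E2" "?E1 \<inter> ?E2 = {}"
  proof -
    have "\<omega> \<in> one_point e k v \<inter> A \<longleftrightarrow> \<omega> \<in> ?E1 \<union> ?E2" for \<omega>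
    proof -
      have 1: "\<omega> \<in> one_point e k v \<longleftrightarrow> (if c < \<omega> e 0 then drop_first e \<omega> \<in> one_point e k v
          else c / 2 < \<omega> e 0 \<and> coin (\<omega> e) = v \<and> drop_first e \<omega> \<in> no_point e k)"
        using one_point_drop_first[OF e, of \<omega> k v] by (simp only: c(3) c_def[symmetric])
      have 2: "c / 2 < \<omega> e 0 \<Longrightarrow> \<omega> \<in> A \<longleftrightarrow> drop_first e \<omega> \<in> A"
        using A(2) unfolding insensitive_def c(3) by blast
      have 3: "c < \<omega> e 0 \<Longrightarrow> c / 2 < \<omega> e 0" using c by simp
      show ?thesis
        unfolding Int_iff Un_iff mem_Collect_eq not_less[symmetric] using 1 2 3 by (cases "c < \<omega> e 0") (simp, metis)
    qed
    then show "one_point e k v \<inter> A = ?E1 \<union> ?E2" by blast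
    show "?E1 \<inter> ?E2 = {}" by auto
  qed
  have "b = measure S (?E1 \<union> ?E2)"
    unfolding b_def by (rule arg_cong[OF split(1)])
  also have "\<dots> = measure S ?E1 + measure S ?E2"
    using s1 s2 split(2) by (intro S.finite_measure_Union) auto
  also have "measure S ?E1 = (1 - c) * b"
    unfolding b_def using c A e by (subst measure_drop_first) (auto simp: measure_mark_above)
  also have "measure S ?E2 = (c - c / 2) / 2 * (measure S A / 2)"
    using c A e measure_no_point[OF e A] by (subst measure_drop_first) (auto simp: measure_mark_interval)
  finally have "c * b = c * (measure S A / 8)" by (simp add: algebra_simps)
  then show ?thesis using c by (simp add: b_def)
qed

text \<open>The visible arrivals in slot \<open>k\<close> are a single one, on the side \<open>e\<close> and with coin \<open>v\<close>.\<close>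
definition slot :: "nat \<Rightarrow> int \<times> bool \<Rightarrow> (int \<Rightarrow> nat \<Rightarrow> real) set" where
  "slot k = (\<lambda>(e, v). one_point e k v \<inter> no_point (- e) k)"

lemma first_hit_cong:
  assumes "\<And>n. 1 \<le> n \<Longrightarrow> \<omega> (e * n) = \<omega>' (e * n)"
  shows "first_hit e k n \<omega> = first_hit e k n \<omega>'"
  unfolding first_hit_def by (intro conj_cong ball_cong refl) (auto simp: assms)

lemma no_point_cong:
  assumes "\<And>n. 1 \<le> n \<Longrightarrow> \<omega> (e * n) = \<omega>' (e * n)"
  shows "\<omega> \<in> no_point e k \<longleftrightarrow> \<omega>' \<in> no_point e k"
proof -
  have "first_hit e k n \<omega> \<and> \<omega> (e * n) 0 \<le> level (Suc k) \<longleftrightarrow> first_hit e k n \<omega>' \<and> \<omega>' (e * n) 0 \<le> level (Suc k)" for n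
    using first_hit_cong[of \<omega> e \<omega>' k n] assms first_hit_pos[of e k n \<omega>'] by auto
  then show ?thesis by (simp add: no_point_def)
qed

lemma one_point_cong_imp:
  assumes "\<And>n. 1 \<le> n \<Longrightarrow> \<omega> (e * n) = \<omega>' (e * n)" "\<omega> \<in> one_point e k v"
  shows "\<omega>' \<in> one_point e k v"
proof -
  obtain n n' where n: "first_hit e k n \<omega>" "level (Suc k) < \<omega> (e * n) 0" "coin (\<omega> (e * n)) = v" "n < n'"
    "\<omega> (e * n') 0 \<le> level (Suc k)" "\<forall>j\<in>{n<..<n'}. level k < \<omega> (e * j) 0"
    using assms(2) unfolding one_point_def by blast
  have n1: "1 \<le> n" using first_hit_pos[OF n(1)] .
  have "\<forall>j\<in>{n<..<n'}. level k < \<omega>' (e * j) 0"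
  proof
    fix j assume j: "j \<in> {n<..<n'}"
    then have "level k < \<omega> (e * j) 0" using n(6) by blast
    then show "level k < \<omega>' (e * j) 0" using assms(1)[of j] n1 j by simp
  qed
  moreover have "first_hit e k n \<omega>'" using n(1) first_hit_cong[of \<omega> e \<omega>' k n] assms(1) by blast
  ultimately show ?thesis
    unfolding one_point_def mem_Collect_eq using n assms(1)[of n] assms(1)[of n'] n1
    by (intro exI[of _ n] conjI exI[of _ n']) auto
qed

lemma one_point_cong:
  assumes "\<And>n. 1 \<le> n \<Longrightarrow> \<omega> (e * n) = \<omega>' (e * n)"
  shows "\<omega> \<in> one_point e k v \<longleftrightarrow> \<omega>' \<in> one_point e k v"
  using one_point_cong_imp[of \<omega> e \<omega>'] one_point_cong_imp[of \<omega>' e \<omega>] assms by metis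

lemma no_point_opp: "dir e \<Longrightarrow> drop_first e \<omega> \<in> no_point (- e) k \<longleftrightarrow> \<omega> \<in> no_point (- e) k"
  by (rule no_point_cong, rule drop_first_opp) auto

lemma one_point_opp: "dir e \<Longrightarrow> drop_first e \<omega> \<in> one_point (- e) k v \<longleftrightarrow> \<omega> \<in> one_point (- e) k v"
  by (rule one_point_cong, rule drop_first_opp) auto

lemma insensitive_mono:
  assumes "insensitive e k' A" "k \<le> k'"
  shows "insensitive e k A"
  using assms level_mono[OF assms(2)] unfolding insensitive_def by (meson le_less_trans)

lemma insensitive_slot:
  assumes "dir e" "dir d" "insensitive d (Suc k) A"
  shows "insensitive d k (slot k (e, v) \<inter> A)"
proof -
  have A: "insensitive d k A" using insensitive_mono[OF assms(3)] by simp
  have "d = e \<or> d = - e" using assms by auto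
  then show ?thesis
  proof
    assume d: "d = e"
    show ?thesis using A one_point_drop_first[OF assms(1)] no_point_opp[OF assms(1)] unfolding insensitive_def d slot_def by auto
  next
    assume d: "d = - e"
    have "dir (- e)" using assms by auto
    then show ?thesis using A no_point_drop_first[of "- e"] one_point_opp[of "- e"] unfolding insensitive_def d slot_def by auto
  qed
qed

lemma sets_slot [measurable]: "slot k x \<in> sets S"
  by (cases x) (simp add: slot_def)

text \<open>The factor is \<open>1/8\<close> for the side \<open>e\<close> (one half for the presence of an arrival, one half for the absence of a second one, one half for the
  coin) and \<open>1/2\<close> for the other side.\<close>
lemma measure_slot:
  assumes e: "dir e" and A: "A \<in> sets S" "\<And>d. dir d \<Longrightarrow> insensitive d (Suc k) A"
  shows "measure S (slot k (e, v) \<inter> A) = measure S A / 16"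
proof -
  have e': "dir (- e)" using e by auto
  have "insensitive e (Suc k) (no_point (- e) k \<inter> A)"
    using A(2)[OF e] no_point_opp[OF e] unfolding insensitive_def by auto
  then have "measure S (one_point e k v \<inter> (no_point (- e) k \<inter> A)) = measure S (no_point (- e) k \<inter> A) / 8"
    using A(1) by (intro measure_one_point e) auto
  also have "\<dots> = measure S A / 16"
    using measure_no_point[OF e' A(1) A(2)[OF e']] by simp
  finally show ?thesis by (simp add: slot_def Int_assoc)
qed

section \<open>Coalescence and the tail of the coding radius\<close>

text \<open>Prescribed visible arrivals in consecutive slots, the head of the list belonging to the latest slot.\<close>
fun block :: "nat \<Rightarrow> (int \<times> bool) list \<Rightarrow> (int \<Rightarrow> nat \<Rightarrow> real) set" where
  "block k [] = UNIV"
| "block k (x # xs) = slot k x \<inter> block (Suc k) xs"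

text \<open>The effect of an arrival on the colors of the two sites that enclose the origin. The last element of
  the list of \<open>run_steps\<close> is the earliest arrival and acts first.\<close>
fun step :: "int \<times> bool \<Rightarrow> nat \<times> nat \<Rightarrow> nat \<times> nat" where
  "step (e, v) (a, b) = (if e = 1 then (a, pick v a b) else (pick v a b, b))"

fun run_steps :: "(int \<times> bool) list \<Rightarrow> nat \<times> nat \<Rightarrow> nat \<times> nat" where
  "run_steps [] s = s"
| "run_steps (x # xs) s = step x (run_steps xs s)"

lemma sets_block [measurable]: "block k xs \<in> sets S"
proof (induction xs arbitrary: k)
  case Nil
  show ?case using sets.top[of S] by simp
qed auto

lemma insensitive_block:
  assumes "\<forall>x\<in>set xs. dir (fst x)" "\<And>d. dir d \<Longrightarrow> insensitive d (k + length xs) A" "dir d"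
  shows "insensitive d k (block k xs \<inter> A)"
  using assms
proof (induction xs arbitrary: k d)
  case (Cons x xs)
  have "insensitive d' (Suc k) (block (Suc k) xs \<inter> A)" if "dir d'" for d'
    using Cons.prems that by (intro Cons.IH) auto
  then show ?case
    using insensitive_slot[of "fst x" d k "block (Suc k) xs \<inter> A" "snd x"] Cons.prems by (simp add: Int_assoc)
qed simp

lemma measure_block:
  assumes "\<forall>x\<in>set xs. dir (fst x)" "A \<in> sets S" "\<And>d. dir d \<Longrightarrow> insensitive d (k + length xs) A"
  shows "measure S (block k xs \<inter> A) = (1/16) ^ length xs * measure S A"
  using assms
proof (induction xs arbitrary: k)
  case (Cons x xs)
  have "measure S (slot k (fst x, snd x) \<inter> (block (Suc k) xs \<inter> A)) = measure S (block (Suc k) xs \<inter> A) / 16"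
    using Cons.prems by (intro measure_slot insensitive_block) auto
  then show ?case using Cons.IH[of "Suc k"] Cons.prems by (simp add: Int_assoc)
qed simp

text \<open>A shortest synchronizing word of the automaton on the twelve pairs of different colors.\<close>
definition sync_steps :: "(int \<times> bool) list" where
  "sync_steps = [(1, False), (-1, True), (1, False), (-1, False), (-1, True)]"

lemma pick_code:
  "pick v a b = (let L = filter (\<lambda>c. c \<noteq> a \<and> c \<noteq> b) [1, 2, 3, 4] in if v then hd L else last L)"
  if "a \<in> {1..4}" "b \<in> {1..4}"
proof -
  have "{1..4} - {a, b} = set (filter (\<lambda>c. c \<noteq> a \<and> c \<noteq> b) [1, 2, 3, 4])"
    unfolding colors4 by auto
  then have e: "pick v a b = (if v then Min (set (filter (\<lambda>c. c \<noteq> a \<and> c \<noteq> b) [1, 2, 3, 4]))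
      else Max (set (filter (\<lambda>c. c \<noteq> a \<and> c \<noteq> b) [1, 2, 3, 4])))"
    by (simp only: pick_def)
  have "a = 1 \<or> a = 2 \<or> a = 3 \<or> a = 4" "b = 1 \<or> b = 2 \<or> b = 3 \<or> b = 4" using that by auto
  then show ?thesis unfolding e by (elim disjE) (simp_all add: Let_def)
qed

lemma run_sync:
  assumes "a \<in> {1..4}" "b \<in> {1..4}" "a \<noteq> b"
  shows "run_steps sync_steps (a, b) = (1, 4)"
proof -
  have "a = 1 \<or> a = 2 \<or> a = 3 \<or> a = 4" "b = 1 \<or> b = 2 \<or> b = 3 \<or> b = 4" using assms by auto
  then show ?thesis using assms(3)
    by (elim disjE) (simp_all add: sync_steps_def pick_code Let_def)
qed

text \<open>None of \<open>n\<close> consecutive blocks of five slots, the latest one starting at slot \<open>k\<close>, is synchronizing.\<close>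
definition no_block :: "nat \<Rightarrow> nat \<Rightarrow> (int \<Rightarrow> nat \<Rightarrow> real) set" where
  "no_block k n = {\<omega>. \<forall>i<n. \<omega> \<notin> block (k + 5 * i) sync_steps}"

lemma no_block_Suc: "no_block k (Suc n) = no_block (k + 5) n - block k sync_steps"
  by (auto simp: no_block_def less_Suc_eq_0_disj add_ac)

lemma sets_no_block [measurable]: "no_block k n \<in> sets S"
proof (induction n arbitrary: k)
  case 0
  show ?case using sets.top[of S] by (simp add: no_block_def)
qed (simp add: no_block_Suc sets.Diff)

lemma dir_sync: "\<forall>x\<in>set sync_steps. dir (fst x)" "length sync_steps = 5"
  by (auto simp: sync_steps_def)

lemma insensitive_no_block: "dir d \<Longrightarrow> insensitive d k (no_block k n)"
proof (induction n arbitrary: k)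
  case 0
  show ?case by (simp add: no_block_def insensitive_def)
next
  case (Suc n)
  have 1: "insensitive d k (block k sync_steps \<inter> UNIV)"
    by (rule insensitive_block[OF dir_sync(1) _ Suc.prems]) (simp add: insensitive_def)
  have 2: "insensitive d k (no_block (k + 5) n)"
    by (rule insensitive_mono[OF Suc.IH[OF Suc.prems]]) simp
  show ?case
    unfolding no_block_Suc insensitive_def
  proof (intro allI impI)
    fix \<omega> :: "int \<Rightarrow> nat \<Rightarrow> real"
    assume h: "level k < \<omega> d 0"
    show "\<omega> \<in> no_block (k + 5) n - block k sync_steps \<longleftrightarrow> drop_first d \<omega> \<in> no_block (k + 5) n - block k sync_steps"
      using 1[unfolded insensitive_def, rule_format, of \<omega>] 2[unfolded insensitive_def, rule_format, of \<omega>] h by simp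
  qed
qed

lemma measure_no_block: "measure S (no_block k n) = (1 - (1/16) ^ 5) ^ n"
proof (induction n arbitrary: k)
  case 0
  show ?case using S.prob_space by (simp add: no_block_def)
next
  case (Suc n)
  have "measure S (block k sync_steps \<inter> no_block (k + 5) n) = (1/16) ^ 5 * measure S (no_block (k + 5) n)"
    using measure_block[OF dir_sync(1), of "no_block (k + 5) n" k] by (simp add: dir_sync insensitive_no_block)
  moreover have "no_block k (Suc n) = no_block (k + 5) n - (block k sync_steps \<inter> no_block (k + 5) n)"
    by (auto simp: no_block_Suc)
  ultimately show ?case
    using Suc[of "k + 5"] S.finite_measure_Diff[of "no_block (k + 5) n" "block k sync_steps \<inter> no_block (k + 5) n"]
    by (simp add: algebra_simps)
qed

lemma first_hit_unique: "first_hit e k n \<omega> \<Longrightarrow> 1 \<le> m \<Longrightarrow> \<omega> (e * m) 0 \<le> level k \<Longrightarrow> n \<le> m"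
  by (rule ccontr) (auto simp: first_hit_def not_le dest!: bspec[where x = m])

lemma no_point_hit:
  assumes "\<omega> \<in> no_point e k" "first_hit e (Suc k) n' \<omega>"
  shows "first_hit e k n' \<omega>"
proof -
  obtain n where n: "first_hit e k n \<omega>" "\<omega> (e * n) 0 \<le> level (Suc k)" using assms(1) by (auto simp: no_point_def)
  have "n' \<le> n" using first_hit_unique[OF assms(2) first_hit_pos[OF n(1)] n(2)] .
  moreover have "n \<le> n'"
    using assms(2) level_mono[of k "Suc k"] by (intro first_hit_unique[OF n(1)]) (auto simp: first_hit_def)
  ultimately show ?thesis using n(1) by simp
qed

lemma one_point_hit:
  assumes "\<omega> \<in> one_point e k v" "first_hit e (Suc k) n'' \<omega>"
  obtains n where "first_hit e k n \<omega>" "n < n''" "coin (\<omega> (e * n)) = v" "level (Suc k) < \<omega> (e * n) 0"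
    "\<forall>j\<in>{n<..<n''}. level k < \<omega> (e * j) 0"
proof -
  obtain n n' where n: "first_hit e k n \<omega>" "level (Suc k) < \<omega> (e * n) 0" "coin (\<omega> (e * n)) = v" "n < n'"
    "\<omega> (e * n') 0 \<le> level (Suc k)" "\<forall>j\<in>{n<..<n'}. level k < \<omega> (e * j) 0"
    using assms(1) unfolding one_point_def by blast
  have "n'' \<le> n'" using n first_hit_pos[OF n(1)] by (intro first_hit_unique[OF assms(2)]) auto
  moreover have "n \<le> n''"
    using assms(2) level_mono[of k "Suc k"] by (intro first_hit_unique[OF n(1)]) (auto simp: first_hit_def)
  moreover have "n \<noteq> n''" using n(2) assms(2) by (auto simp: first_hit_def)
  ultimately show ?thesis using n by (intro that[of n]) auto
qed

text \<open>If the slot contains a single visible arrival, then this arrival is the earliest site between the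
  two sites that enclose the origin at the beginning of the slot. It takes one step of the color pair.\<close>
lemma col_slot:
  assumes s: "\<omega> \<in> slot k (e, v)" and e: "dir e" and c: "level k < \<omega> 0 0"
    and h: "first_hit (-1) (Suc k) p' \<omega>" "first_hit 1 (Suc k) q' \<omega>"
  obtains p q where "first_hit (-1) k p \<omega>" "first_hit 1 k q \<omega>"
    "\<And>a b. col \<omega> (- p') q' a b 0 = col \<omega> (- p) q (fst (step (e, v) (a, b))) (snd (step (e, v) (a, b))) 0"
proof -
  have single: "\<omega> \<in> one_point e k v" and empty: "\<omega> \<in> no_point (- e) k" using s by (auto simp: slot_def)
  show ?thesis
  proof (cases "e = 1")
    case True
    have hp: "first_hit (-1) k p' \<omega>" using no_point_hit[of \<omega> "-1" k p'] empty True h(1) by simp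
    obtain q where q: "first_hit 1 k q \<omega>" "q < q'" "coin (\<omega> (1 * q)) = v" "level (Suc k) < \<omega> (1 * q) 0"
      "\<forall>j\<in>{q<..<q'}. level k < \<omega> (1 * j) 0"
      using one_point_hit[of \<omega> 1 k v q'] single True h(2) by blast
    have q0: "\<omega> q 0 \<le> level k" "1 \<le> q" "1 \<le> p'" using q(1) hp by (auto simp: first_hit_def)
    have lr: "- p' < q" "q < q'" using q q0 by auto
    have "first_arrival \<omega> (- p') q' = q"
      unfolding first_arrival_eq_iff[OF lr]
    proof (intro conjI ballI)
      fix j assume j: "j \<in> {- p'<..<q}"
      consider "j < 0" | "j = 0" | "0 < j" by linarith
      then have "level k < \<omega> j 0"
      proof cases
        case 1
        then show ?thesis using hp j by (auto simp: first_hit_def dest!: bspec[where x = "- j"])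
      next
        case 2
        then show ?thesis using c by simp
      next
        case 3
        then show ?thesis using q(1) j by (auto simp: first_hit_def)
      qed
      then show "\<omega> q 0 < \<omega> j 0" using q0 by simp
    next
      fix j assume "j \<in> {q<..<q'}"
      then have "level k < \<omega> j 0" using q(5) by auto
      then show "\<omega> q 0 \<le> \<omega> j 0" using q0 by simp
    qed
    from col_rec[OF lr this refl, of _ _ 0] show ?thesis
      using q q0 True by (intro that[OF hp q(1)]) simp
  next
    case False
    then have e1: "e = -1" using e by simp
    have hq: "first_hit 1 k q' \<omega>" using no_point_hit[of \<omega> 1 k q'] empty e1 h(2) by simp
    obtain p where p: "first_hit (-1) k p \<omega>" "p < p'" "coin (\<omega> (-1 * p)) = v" "level (Suc k) < \<omega> (-1 * p) 0"
      "\<forall>j\<in>{p<..<p'}. level k < \<omega> (-1 * j) 0"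
      using one_point_hit[of \<omega> "-1" k v p'] single e1 h(1) by blast
    have p0: "\<omega> (- p) 0 \<le> level k" "1 \<le> p" "1 \<le> q'" using p(1) hq by (auto simp: first_hit_def)
    have pn: "p \<noteq> p'" "level (Suc k) < \<omega> (- p) 0" using p by auto
    have far: "level k < \<omega> j 0" if "j \<in> {- p'<..<- p}" for j
      using p(5) that by (auto dest!: bspec[where x = "- j"])
    have lr: "- p' < - p" "- p < q'" using p p0 by auto
    have near: "level k < \<omega> j 0" if j: "j \<in> {- p<..<q'}" for j
    proof -
      consider "j < 0" | "j = 0" | "0 < j" by linarith
      then show ?thesis
      proof cases
        case 1
        then show ?thesis using p(1) j by (auto simp: first_hit_def dest!: bspec[where x = "- j"])
      next
        case 2
        then show ?thesis using c by simp
      next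
        case 3
        then show ?thesis using hq j by (auto simp: first_hit_def)
      qed
    qed
    have "first_arrival \<omega> (- p') q' = - p"
      unfolding first_arrival_eq_iff[OF lr] using p0 far near by force
    from col_rec[OF lr this refl, of _ _ 0] show ?thesis
      using p p0 e1 by (intro that[OF p(1) hq]) simp
  qed
qed

lemma col_block:
  assumes "\<omega> \<in> block k xs" "\<forall>x\<in>set xs. dir (fst x)" "level k < \<omega> 0 0"
    "first_hit (-1) (k + length xs) p' \<omega>" "first_hit 1 (k + length xs) q' \<omega>"
  shows "\<exists>p q. first_hit (-1) k p \<omega> \<and> first_hit 1 k q \<omega> \<and>
    (\<forall>a b. col \<omega> (- p') q' a b 0 = col \<omega> (- p) q (fst (run_steps xs (a, b))) (snd (run_steps xs (a, b))) 0)"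
  using assms
proof (induction xs arbitrary: k)
  case Nil
  then show ?case by auto
next
  case (Cons x xs)
  obtain e v where x: "x = (e, v)" by (cases x)
  have "level (Suc k) < \<omega> 0 0" using Cons.prems(3) level_mono[of k "Suc k"] by simp
  then obtain p1 q1 where h1: "first_hit (-1) (Suc k) p1 \<omega>" "first_hit 1 (Suc k) q1 \<omega>"
    and c1: "\<And>a b. col \<omega> (- p') q' a b 0 = col \<omega> (- p1) q1 (fst (run_steps xs (a, b))) (snd (run_steps xs (a, b))) 0"
    using Cons.IH[of "Suc k"] Cons.prems by auto
  obtain p q where pq: "first_hit (-1) k p \<omega>" "first_hit 1 k q \<omega>"
    "\<And>a b. col \<omega> (- p1) q1 a b 0 = col \<omega> (- p) q (fst (step (e, v) (a, b))) (snd (step (e, v) (a, b))) 0"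
    using col_slot[of \<omega> k e v p1 q1] Cons.prems h1 x by auto
  have "col \<omega> (- p') q' a b 0 = col \<omega> (- p) q (fst (run_steps (x # xs) (a, b))) (snd (run_steps (x # xs) (a, b))) 0" for a b
    unfolding c1 pq(3) x run_steps.simps prod.collapse ..
  then show ?case using pq by blast
qed

lemma first_hit_exists:
  assumes "1 \<le> m" "\<omega> (e * m) 0 \<le> level K" "k \<le> K"
  shows "\<exists>n\<le>m. first_hit e k n \<omega>"
proof -
  let ?P = "\<lambda>i. \<omega> (e * (1 + int i)) 0 \<le> level k"
  define i where "i = (LEAST i. ?P i)"
  have P: "?P (nat (m - 1))" using assms level_mono[OF assms(3)] by simp
  have i: "?P i" unfolding i_def using P by (rule LeastI)
  have le: "i \<le> nat (m - 1)" unfolding i_def using P by (rule Least_le)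
  have "level k < \<omega> (e * j) 0" if "j \<in> {1..<1 + int i}" for j
  proof -
    have "nat (j - 1) < i" using that by auto
    then have "\<not> ?P (nat (j - 1))" unfolding i_def by (rule not_less_Least)
    then show ?thesis using that by (simp add: not_le)
  qed
  then have "first_hit e k (1 + int i) \<omega>" using i by (auto simp: first_hit_def)
  moreover have "1 + int i \<le> m" using le assms(1) by auto
  ultimately show ?thesis by blast
qed

lemma block_stop:
  assumes b: "\<omega> \<in> block k sync_steps" and c: "level k < \<omega> 0 0" and k: "k + 5 \<le> K"
    and l: "\<exists>m\<in>{1..int J}. \<omega> (- m) 0 \<le> level K" and r: "\<exists>m\<in>{1..int J}. \<omega> m 0 \<le> level K"
  shows "stop \<omega> J"
proof -
  obtain p' where p': "first_hit (-1) (k + 5) p' \<omega>" "p' \<le> int J"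
    using l first_hit_exists[of _ \<omega> "-1" K "k + 5"] k by fastforce
  obtain q' where q': "first_hit 1 (k + 5) q' \<omega>" "q' \<le> int J"
    using r first_hit_exists[of _ \<omega> 1 K "k + 5"] k by fastforce
  obtain p q where pq: "\<And>a b. col \<omega> (- p') q' a b 0 = col \<omega> (- p) q (fst (run_steps sync_steps (a, b))) (snd (run_steps sync_steps (a, b))) 0"
    using col_block[of \<omega> k sync_steps p' q'] b dir_sync c p' q' by auto
  have "\<omega> (- p') 0 < \<omega> j 0 \<and> \<omega> q' 0 < \<omega> j 0" if j: "j \<in> {- p'<..<q'}" for j
  proof -
    consider "j < 0" | "j = 0" | "0 < j" by linarith
    then have "level (k + 5) < \<omega> j 0"
    proof cases
      case 1
      then show ?thesis using p'(1) j by (auto simp: first_hit_def dest!: bspec[where x = "- j"])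
    next
      case 2
      then show ?thesis using c level_mono[of k "k + 5"] by simp
    next
      case 3
      then show ?thesis using q'(1) j by (auto simp: first_hit_def)
    qed
    then show ?thesis using p'(1) q'(1) by (auto simp: first_hit_def)
  qed
  then have "coalesced \<omega> (- p') q' (col \<omega> (- p) q 1 4 0)"
    unfolding coalesced_def using pq run_sync by auto
  moreover have "- p' \<in> {- int J..<0}" "q' \<in> {0<..int J}"
    using p' q' first_hit_pos[OF p'(1)] first_hit_pos[OF q'(1)] by auto
  ultimately show ?thesis unfolding stop_def decides_def by (cases "special \<omega> J") (simp, metis)
qed

lemma measure_above_interval:
  assumes "0 \<le> s" "s \<le> 1"
  shows "measure S (all_above s l (l + 1 + int n)) = (1 - s) ^ n"
proof (induction n)
  case 0
  have "all_above s l (l + 1) = UNIV" by (auto simp: all_above_def)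
  then show ?case using S.prob_space by simp
next
  case (Suc n)
  let ?m = "l + 1 + int n"
  have "all_above s l (l + 1 + int (Suc n)) = all_above s l ?m \<inter> {\<omega>. \<omega> ?m \<in> {y. s < y 0}}"
  proof -
    have "{l<..<l + 1 + int (Suc n)} = insert ?m {l<..<?m}" by auto
    then show ?thesis by (auto simp: all_above_def)
  qed
  also have "measure S \<dots> = measure S (all_above s l ?m) * measure S {\<omega>. \<omega> ?m \<in> {y. s < y 0}}"
  proof (rule indep_dep_on[of _ "{l<..<?m}" _ "{?m}"])
    show "{\<omega>. \<omega> ?m \<in> {y. s < y 0}} \<in> sets S" by (rule sets_coord) (rule sets_mark_above)
  qed (auto simp: dep_on_def all_above_def sets_all_above[unfolded all_above_def])
  also have "measure S {\<omega>. \<omega> ?m \<in> {y. s < y 0}} = 1 - s"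
    using measure_coord[OF sets_mark_above, of ?m s] measure_mark_above[OF assms] by simp
  finally show ?case using Suc by simp
qed

text \<open>With \<open>s = 2^-6n\<close> and \<open>J \<ge> 1/s^2\<close>, Bernoulli's inequality gives \<open>(1 + s)^J \<ge> 1/s\<close>, and \<open>(1 - s)^J\<close> is at most the
  inverse of the left-hand side.\<close>
lemma power_tail: "(2::real) ^ (12 * n) \<le> real J \<Longrightarrow> (1 - level (6 * n)) ^ J \<le> (1/2) ^ n"
proof -
  assume J: "(2::real) ^ (12 * n) \<le> real J"
  define s where "s = level (6 * n)"
  have s: "0 < s" "s \<le> 1" using level_props by (auto simp: s_def)
  have "s * 2 ^ (6 * n) = 1" by (simp add: s_def level_def power_one_over)
  then have "(2::real) ^ (6 * n) = 2 ^ (6 * n) * (s * 2 ^ (6 * n))" by simp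
  also have "\<dots> = 2 ^ (12 * n) * s" by (simp flip: power_add)
  also have "\<dots> \<le> real J * s"
    using J s by (intro mult_right_mono) auto
  also have "real J * s \<le> (1 + s) ^ J" using Bernoulli_inequality[of s J] s by simp
  finally have 1: "2 ^ (6 * n) \<le> (1 + s) ^ J" .
  have "(1 - s) ^ J * (1 + s) ^ J = (1 - s * s) ^ J"
    by (simp add: algebra_simps flip: power_mult_distrib)
  also have "\<dots> \<le> 1" using s by (intro power_le_one) (auto simp: mult_le_one)
  finally have "(1 - s) ^ J * 2 ^ (6 * n) \<le> 1"
    using mult_left_mono[OF 1, of "(1 - s) ^ J"] s by simp
  then have "(1 - s) ^ J \<le> 1 / 2 ^ (6 * n)" by (simp add: field_simps)
  also have "\<dots> \<le> (1/2) ^ n" by (simp add: power_one_over field_simps power_increasing)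
  finally show ?thesis by (simp add: s_def)
qed

text \<open>The probability that a block of five slots is not synchronizing.\<close>
definition coal_rate :: real where
  "coal_rate = 1 - (1/16) ^ 5"

lemma coal_rate: "1/2 \<le> coal_rate" "coal_rate < 1" "0 < coal_rate"
  by (auto simp: coal_rate_def power_divide)

text \<open>The \<open>n\<close> blocks start at slot \<open>n\<close>, so that the origin is younger than all of them with
  probability \<open>1 - 2^-n\<close>, and they end at slot \<open>6 n\<close>, so that the arrivals older than all of them are
  found within distance \<open>2^(12 n)\<close> on both sides, up to a small probability.\<close>
lemma late_bound:
  assumes J: "(2::real) ^ (12 * n) \<le> real J"
  shows "late J \<le> 4 * coal_rate ^ n"
proof -
  let ?s = "level (6 * n)"
  have s: "0 \<le> ?s" "?s \<le> 1" using level_props[of "6 * n"] by auto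
  define A1 where "A1 = UNIV - {\<omega>. \<omega> (0::int) \<in> {y :: nat \<Rightarrow> real. level n < y 0}}"
  define A2 where "A2 = all_above ?s 0 (0 + 1 + int J)"
  define A3 where "A3 = all_above ?s (- int J - 1) (- int J - 1 + 1 + int J)"
  have sets: "A1 \<in> sets S" "A2 \<in> sets S" "A3 \<in> sets S"
    using sets.compl_sets[OF sets_coord[OF sets_mark_above, of 0 "level n"]] by (auto simp: A1_def A2_def A3_def)
  have "{\<omega>. \<forall>t\<le>J. \<not> stop \<omega> t} \<subseteq> (A1 \<union> A2) \<union> (A3 \<union> no_block n n)"
  proof
    fix \<omega> assume ns: "\<omega> \<in> {\<omega>. \<forall>t\<le>J. \<not> stop \<omega> t}"
    show "\<omega> \<in> (A1 \<union> A2) \<union> (A3 \<union> no_block n n)"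
    proof (rule ccontr)
      assume "\<not> ?thesis"
      then have n: "\<omega> \<notin> A1" "\<omega> \<notin> A2" "\<omega> \<notin> A3" "\<omega> \<notin> no_block n n" by auto
      obtain i where i: "i < n" "\<omega> \<in> block (n + 5 * i) sync_steps" using n(4) by (auto simp: no_block_def)
      have "level (n + 5 * i) < \<omega> 0 0" using n(1) level_mono[of n "n + 5 * i"] by (simp add: A1_def)
      moreover have "\<exists>m\<in>{1..int J}. \<omega> m 0 \<le> ?s" 
      proof -
        obtain j where "0 < j" "j < 1 + int J" "\<omega> j 0 \<le> ?s" using n(2) by (auto simp: A2_def all_above_def not_less)
        then show ?thesis by (intro bexI[of _ j]) auto
      qed
      moreover have "\<exists>m\<in>{1..int J}. \<omega> (- m) 0 \<le> ?s"
      proof -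
        obtain j where "- int J - 1 < j" "j < 0" "\<omega> j 0 \<le> ?s" using n(3) by (auto simp: A3_def all_above_def not_less)
        then show ?thesis by (intro bexI[of _ "- j"]) auto
      qed
      ultimately have "stop \<omega> J"
        using i by (intro block_stop[of \<omega> "n + 5 * i" "6 * n"]) auto
      then show False using ns by auto
    qed
  qed
  then have "late J \<le> measure S ((A1 \<union> A2) \<union> (A3 \<union> no_block n n))"
    unfolding late_def using sets by (intro S.finite_measure_mono) auto
  also have "\<dots> \<le> measure S (A1 \<union> A2) + measure S (A3 \<union> no_block n n)"
    using sets by (intro measure_Un_le) auto
  also have "\<dots> \<le> (measure S A1 + measure S A2) + (measure S A3 + measure S (no_block n n))"
    using sets by (intro add_mono measure_Un_le) auto
  also have "measure S A1 = level n"
  proof -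
    have "measure S A1 = 1 - measure S {\<omega>. \<omega> 0 \<in> {y. level n < y 0}}"
      unfolding A1_def using S.prob_compl[OF sets_coord[OF sets_mark_above, of 0 "level n"]] by simp
    also have "\<dots> = level n"
      using measure_coord[OF sets_mark_above, of 0 "level n"] measure_mark_above[of "level n"] level_props[of n] by simp
    finally show ?thesis .
  qed
  also have "measure S A2 = (1 - ?s) ^ J" unfolding A2_def by (rule measure_above_interval[OF s])
  also have "measure S A3 = (1 - ?s) ^ J" unfolding A3_def by (rule measure_above_interval[OF s])
  also have "measure S (no_block n n) = coal_rate ^ n" by (simp add: measure_no_block coal_rate_def)
  also have "level n + (1 - ?s) ^ J + ((1 - ?s) ^ J + coal_rate ^ n) \<le> 3 * (1/2) ^ n + coal_rate ^ n"
    using power_tail[OF J] by (simp add: level_def)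
  also have "\<dots> \<le> 4 * coal_rate ^ n" using power_mono[of "1/2" coal_rate n] coal_rate by simp
  finally show ?thesis .
qed

lemma late_tendsto: "late \<longlonglongrightarrow> 0"
proof (rule LIMSEQ_I)
  fix r :: real assume "0 < r"
  then obtain n where n: "coal_rate ^ n < r / 4" using real_arch_pow_inv[of "r / 4" coal_rate] coal_rate by auto
  have "norm (late J - 0) < r" if "2 ^ (12 * n) \<le> J" for J :: nat
  proof -
    have "(2::real) ^ (12 * n) \<le> real J" using that by (metis of_nat_le_iff of_nat_numeral of_nat_power)
    then have "late J < r" using late_bound[of n J] n by simp
    moreover have "0 \<le> late J" by (simp add: late_def)
    ultimately show ?thesis by simp
  qed
  then show "\<exists>no. \<forall>J\<ge>no. norm (late J - 0) < r" by blast
qed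

lemma AE_stop: "AE \<omega> in S. \<forall>i. \<exists>t. stop (shift i \<omega>) t"
proof -
  have "AE \<omega> in S. \<exists>t. stop (shift i \<omega>) t" for i
  proof (rule AE_I)
    let ?N = "\<Inter>J. {\<omega>. \<forall>t\<le>J. \<not> stop (shift i \<omega>) t}"
    show "{\<omega> \<in> space S. \<not> (\<exists>t. stop (shift i \<omega>) t)} \<subseteq> ?N" by auto
    show sN: "?N \<in> sets S" using sets_late_shift by (intro sets.countable_INT) auto
    have "measure S ?N \<le> late J" for J
      unfolding late_shift[of J i, symmetric] using sets_late_shift by (intro S.finite_measure_mono) auto
    then have "measure S ?N \<le> 0" by (intro LIMSEQ_le_const[OF late_tendsto]) auto
    then show "emeasure S ?N = 0" by (simp add: S.emeasure_eq_measure measure_le_0_iff)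
  qed
  then show ?thesis by (simp add: AE_all_countable)
qed

lemma AE_proper: "AE \<omega> in S. \<forall>i. factor \<omega> i \<noteq> factor \<omega> (i + 1)"
  using AE_stop AE_unit
proof eventually_elim
  case (elim \<omega>)
  show ?case
  proof
    fix i
    obtain t1 t2 where t: "stop (shift i \<omega>) t1" "stop (shift (i + 1) \<omega>) t2" using elim(1) by blast
    define J where "J = max t1 t2"
    let ?l = "i - int J - 1" and ?r = "i + int J + 2"
    have pos: "0 \<le> \<omega> j 0" for j using elim(2) by auto
    have "factor \<omega> i = col \<omega> ?l ?r 1 2 i"
      by (rule factor_eq_col[OF pos _ t(1), of J]) (auto simp: J_def)
    moreover have "factor \<omega> (i + 1) = col \<omega> ?l ?r 1 2 (i + 1)"
      by (rule factor_eq_col[OF pos _ t(2), of J]) (auto simp: J_def)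
    moreover have "col \<omega> ?l ?r 1 2 i \<noteq> col \<omega> ?l ?r 1 2 (i + 1)"
      by (rule col_proper) auto
    ultimately show "factor \<omega> i \<noteq> factor \<omega> (i + 1)" by simp
  qed
qed

text \<open>By \<open>late_bound\<close> the tail at distance \<open>t = 2^(12 n)\<close> is of order \<open>coal_rate ^ n\<close>, which is
  this negative power of \<open>t\<close>.\<close>
definition tail_exponent :: real where
  "tail_exponent = - log 2 coal_rate / 12"

lemma tail_exponent_pos: "0 < tail_exponent"
  using coal_rate by (simp add: tail_exponent_def)

lemma tail_bound:
  assumes t: "1 \<le> t"
  shows "measure S {\<omega> \<in> space S. ereal_of_enat (radius \<omega>) > ereal t} < 8 / coal_rate * t powr (- tail_exponent)"
proof -
  define J where "J = nat \<lfloor>t\<rfloor>"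
  \<comment> \<open>The largest \<open>n\<close> with \<open>2^(12 n) \<le> t\<close>; the rounding costs the factor \<open>1 / coal_rate\<close>.\<close>
  define n where "n = nat \<lfloor>log 2 t / 12\<rfloor>"
  have J: "real J \<le> t" "t < real J + 1" using t by (auto simp: J_def)
  have lt: "0 \<le> log 2 t" using t by simp
  have n: "real n \<le> log 2 t / 12" "log 2 t / 12 - 1 \<le> real n" using lt by (auto simp: n_def) linarith
  have "(2::real) ^ (12 * n) = 2 powr real (12 * n)" by (simp only: powr_realpow[symmetric] zero_less_numeral)
  also have "\<dots> \<le> 2 powr (log 2 t)" using n by (intro powr_mono) auto
  also have "\<dots> = t" using t by simp
  finally have "real (2 ^ (12 * n)) \<le> t" by simp
  then have "int (2 ^ (12 * n)) \<le> \<lfloor>t\<rfloor>" by (subst le_floor_iff) simp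
  then have "2 ^ (12 * n) \<le> J" unfolding J_def by linarith
  then have "(2::real) ^ (12 * n) \<le> real J" by (metis of_nat_le_iff of_nat_numeral of_nat_power)
  then have b: "late J \<le> 4 * coal_rate ^ n" by (rule late_bound)
  have "{\<omega> \<in> space S. ereal_of_enat (radius \<omega>) > ereal t} \<subseteq> {\<omega>. \<forall>t\<le>J. \<not> stop \<omega> t}"
  proof safe
    fix \<omega> s assume r: "ereal t < ereal_of_enat (radius \<omega>)" and s: "s \<le> J" "stop \<omega> s"
    have "radius \<omega> = enat (LEAST t. stop \<omega> t)" using s(2) by (auto simp: radius_def)
    then have "t < real (LEAST t. stop \<omega> t)" using r by simp
    also have "real (LEAST t. stop \<omega> t) \<le> real s" using Least_le[of "stop \<omega>", OF s(2)] by simp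
    also have "\<dots> \<le> t" using s J by simp
    finally show False by simp
  qed
  then have "measure S {\<omega> \<in> space S. ereal_of_enat (radius \<omega>) > ereal t} \<le> late J"
    unfolding late_def by (intro S.finite_measure_mono) auto
  also note b
  also have "coal_rate ^ n = coal_rate powr real n" using coal_rate by (simp add: powr_realpow)
  also have "coal_rate powr real n \<le> coal_rate powr (log 2 t / 12 - 1)"
    using n coal_rate by (intro powr_mono') auto
  also have "\<dots> = t powr (- tail_exponent) / coal_rate"
  proof -
    have "coal_rate powr (log 2 t / 12) = exp (ln coal_rate * ln t / (12 * ln 2))"
      using coal_rate by (simp add: powr_def log_def mult.commute)
    also have "\<dots> = t powr (- tail_exponent)"
      using t coal_rate by (simp add: powr_def log_def tail_exponent_def mult.commute)
    finally show ?thesis using coal_rate by (simp add: powr_diff)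
  qed
  finally have "measure S {\<omega> \<in> space S. ereal_of_enat (radius \<omega>) > ereal t} \<le> 4 * (t powr (- tail_exponent) / coal_rate)"
    by simp
  also have "\<dots> < 8 / coal_rate * t powr (- tail_exponent)"
  proof -
    have "0 < t powr (- tail_exponent) / coal_rate" using t coal_rate by simp
    then show ?thesis by simp
  qed
  finally show ?thesis .
qed

lemma law_S: "law S mark (\<lambda>i \<omega>. \<omega> i) = S"
  by (simp add: law_def distr_id2)

theorem theorem1:
  shows "\<exists>(M' :: (int \<Rightarrow> nat \<Rightarrow> real) measure) (X :: int \<Rightarrow> (int \<Rightarrow> nat \<Rightarrow> real) \<Rightarrow> nat)
          (M :: (int \<Rightarrow> nat \<Rightarrow> real) measure) (N :: (nat \<Rightarrow> real) measure)
          (Y :: int \<Rightarrow> (int \<Rightarrow> nat \<Rightarrow> real) \<Rightarrow> nat \<Rightarrow> real)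
          (F :: (int \<Rightarrow> nat \<Rightarrow> real) \<Rightarrow> int \<Rightarrow> nat) (T :: (int \<Rightarrow> nat \<Rightarrow> real) \<Rightarrow> enat)
          (c :: real) (\<alpha> :: real).
      coloring 4 M' X \<and> k_dependent 1 M' (colors 4) X \<and>
      iid_process M N Y \<and>
      factor_via F M' (colors 4) X M N Y \<and> finitary F M N Y \<and>
      T = (\<lambda>\<omega>. coding_radius N F (\<lambda>i. Y i \<omega>)) \<and>
      T \<in> measurable M (count_space UNIV) \<and>
      c > 0 \<and> \<alpha> > 0 \<and>
      (\<forall>t::real. t \<ge> 1 \<longrightarrow>
        measure M {\<omega> \<in> space M. ereal_of_enat (T \<omega>) > ereal t} < c * t powr (- \<alpha>))"
proof -
  let ?X = "\<lambda>i \<omega>. factor \<omega> i" and ?Y = "\<lambda>i (\<omega> :: int \<Rightarrow> nat \<Rightarrow> real). \<omega> i"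
  have pX: "process S (colors 4) ?X"
    unfolding process_def using prob_space_S measurable_factor_colors by blast
  have "coloring 4 S ?X"
    unfolding coloring_def using pX AE_proper by blast
  moreover have "k_dependent 1 S (colors 4) ?X"
    unfolding k_dependent_def using pX indep_factor[OF late_tendsto] by simp
  moreover have "iid_process S mark ?Y"
    unfolding iid_process_def process_def
    using prob_space_S measurable_S_coord indep_coords
      distr_PiM_component[of "UNIV :: int set" "\<lambda>_. mark"] prob_space_mark by simp
  moreover have "factor_via factor S (colors 4) ?X S mark ?Y"
    unfolding factor_via_def using measurable_factor equivariant_factor by simp
  moreover have "finitary factor S mark ?Y"
    unfolding finitary_def law_S determined_within_iff
    using AE_stop by eventually_elim (metis order_refl shift_0)
  moreover have "radius = (\<lambda>\<omega>. coding_radius mark factor (\<lambda>i. ?Y i \<omega>))"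
    by (simp add: coding_radius_eq)
  moreover have "0 < 8 / coal_rate" using coal_rate by simp
  ultimately show ?thesis
    using measurable_radius tail_exponent_pos tail_bound by blast
qed

end
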